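(* Let $(A,B)$ be a regular inclusion of $C^*$-algebras having the ideal intersection property, let $(I(B),\iota)$ be an injective envelope for $B$, and let $N\subseteq N(A,B)$ be a generating $*$-semigroup. Assume there is an $N$-invariant faithful pseudo-expectation $\Phi\colon A\to I(B)$. Then the invariant regular ideals of $B$ form a Boolean algebra. The map $J\mapsto J\cap B$ is a Boolean algebra isomorphism from the regular ideals of $A$ onto the invariant regular ideals of $B$, and its inverse is given by $K\mapsto L_K=J_K^{\perp\perp}=K^{\perp\perp}$ (annihilators taken in $A$), where $J_K=\{a\in A:\Phi(a^*a)\in\iota(K)\}$ and $L_K=\{a\in A:\Phi(a^*a)\in\iota(K)^{\perp\perp}\}$ (with $\iota(K)^{\perp\perp}$ computed in $I(B)$).
   Context: Ideals are closed and two-sided. An inclusion $(A,B)$ of $C^*$-algebras is a $C^*$-algebra $A$ with a $C^*$-subalgebra $B\subseteq A$ containing an approximate unit for $A$. A normalizer is $n\in A$ with $nBn^*\subseteq B$ and $n^*Bn\subseteq B$; $N(A,B)$ is the set of normalizers. The inclusion is regular if $N(A,B)$ has dense span in $A$; a generating $*$-semigroup is a $*$-semigroup $N\subseteq N(A,B)$ with dense span in $A$. The inclusion has the ideal intersection property if $J\cap B\neq\{0\}$ for every non-zero ideal $J$ of $A$. For a subset $X$ of a $C^*$-algebra $A$, $X^\perp=\{a\in A: aX=Xa=\{0\}\}$ and $X^{\perp\perp}=(X^\perp)^\perp$. An ideal $J$ of $A$ is regular if $J=J^{\perp\perp}$ (annihilators in $A$; for ideals of $B$, annihilators in $B$). An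 ideal $K$ of $B$ is invariant if $nKn^*\subseteq K$ for all $n\in N(A,B)$. Collections of regular ideals are ordered by inclusion. Injective envelope: for unital $B$, $(I(B),\iota)$ consists of an injective $C^*$-algebra $I(B)$ and a unital $*$-monomorphism $\iota\colon B\to I(B)$ such that the only unital completely positive map $\phi\colon I(B)\to I(B)$ with $\phi\circ\iota=\iota$ is the identity; for non-unital $B$, an injective envelope of $B$ is one of the unitization $\tilde B$. A pseudo-expectation for $(A,B)$ is a completely positive contraction $\Phi\colon A\to I(B)$ with $\Phi|_B=\iota$; it is faithful if $\Phi(a^*a)=0$ implies $a=0$. For a hereditary $C^*$-subalgebra $C$ of $B$, the structure projection of $C$ is the unique projection $p\in I(B)$ such that $(pI(B)p,\iota|_C)$ is an injective envelope of $C$. For $n\in N(A,B)$, let $p,q$ be the structure projections of the hereditary subalgebras $\overline{nBn^*}=\overline{|n^*|B|n^*|}$ and $\overline{n^*Bn}$ of $B$. The map $|n^*|b|n^*|\mapsto n^*bn$ ($b\in B$) extends uniquely to a $*$-isomorphism $\theta_n\colon\overline{nBn^*}\to\overline{n^*Bn}$, and there is a unique $*$-isomorphism $\tilde\theta_n\colon pI(B)p\to qI(B)q$ with $\tilde\theta_n\circ\iota=\iota\circ\theta_n$ on $\overline{nBn^*}$. A pseudo-expectation $\Phi$ is $N$-invariant if $\Phi(n^*an)=\tilde\theta_n(\Phi(|n^*|a|n^*|))$ for all $n\in N$, $a\in A$ (one has $\Phi(|n^*|a|n^*|)\in pI(B)p$). *)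

theory Defs
  imports "HOL-Analysis.Analysis" "HOL-Algebra.Lattice"
begin

section \<open>\<open>C\<^sup>*\<close>-algebras\<close>

text \<open>
  \<open>C\<^sup>*\<close>-algebras, unital or not, are records with an explicit carrier, so that
  subalgebras, corners and unitizations are again objects of the same kind and can be
  quantified over.  There is no field for a unit; see \<open>cunital\<close> and \<open>cone\<close>.
\<close>

record 'a cstar = "'a partial_object" +
  czero :: 'a (\<open>\<zero>\<index>\<close>)
  cadd :: "'a \<Rightarrow> 'a \<Rightarrow> 'a" (infixl \<open>\<oplus>\<index>\<close> 65)
  cscale :: "complex \<Rightarrow> 'a \<Rightarrow> 'a" (infixr \<open>\<odot>\<index>\<close> 75)
  cmult :: "'a \<Rightarrow> 'a \<Rightarrow> 'a" (infixl \<open>\<otimes>\<index>\<close> 70)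
  cadj :: "'a \<Rightarrow> 'a"
  cnorm :: "'a \<Rightarrow> real"

definition cdiff :: "'a cstar \<Rightarrow> 'a \<Rightarrow> 'a \<Rightarrow> 'a" (infixl \<open>\<ominus>\<index>\<close> 65) where
  "x \<ominus>\<^bsub>A\<^esub> y = x \<oplus>\<^bsub>A\<^esub> (- 1) \<odot>\<^bsub>A\<^esub> y"

text \<open>
  \<^locale>\<open>Metric_space\<close> asks for nonnegativity and symmetry also off the carrier; hence the
  case distinction.
\<close>
definition cdist :: "'a cstar \<Rightarrow> 'a \<Rightarrow> 'a \<Rightarrow> real" where
  "cdist A x y = (if x \<in> carrier A \<and> y \<in> carrier A then cnorm A (x \<ominus>\<^bsub>A\<^esub> y) else 0)"

abbreviation ctopology :: "'a cstar \<Rightarrow> 'a topology" where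
  "ctopology A \<equiv> Metric_space.mtopology (carrier A) (cdist A)"

locale cstar_algebra =
  fixes A :: "'a cstar" (structure)
  assumes zero_closed: "\<zero> \<in> carrier A"
    and add_closed: "\<lbrakk>x \<in> carrier A; y \<in> carrier A\<rbrakk> \<Longrightarrow> x \<oplus> y \<in> carrier A"
    and scale_closed: "x \<in> carrier A \<Longrightarrow> c \<odot> x \<in> carrier A"
    and mult_closed: "\<lbrakk>x \<in> carrier A; y \<in> carrier A\<rbrakk> \<Longrightarrow> x \<otimes> y \<in> carrier A"
    and adj_closed: "x \<in> carrier A \<Longrightarrow> cadj A x \<in> carrier A"
    and add_assoc: "\<lbrakk>x \<in> carrier A; y \<in> carrier A; z \<in> carrier A\<rbrakk> \<Longrightarrow> x \<oplus> y \<oplus> z = x \<oplus> (y \<oplus> z)"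
    and add_comm: "\<lbrakk>x \<in> carrier A; y \<in> carrier A\<rbrakk> \<Longrightarrow> x \<oplus> y = y \<oplus> x"
    and add_zero: "x \<in> carrier A \<Longrightarrow> x \<oplus> \<zero> = x"
    and diff_self: "x \<in> carrier A \<Longrightarrow> x \<ominus> x = \<zero>"
    and scale_add: "\<lbrakk>x \<in> carrier A; y \<in> carrier A\<rbrakk> \<Longrightarrow> c \<odot> (x \<oplus> y) = c \<odot> x \<oplus> c \<odot> y"
    and add_scale: "x \<in> carrier A \<Longrightarrow> (c + d) \<odot> x = c \<odot> x \<oplus> d \<odot> x"
    and scale_scale: "x \<in> carrier A \<Longrightarrow> c \<odot> d \<odot> x = (c * d) \<odot> x"
    and scale_one: "x \<in> carrier A \<Longrightarrow> 1 \<odot> x = x"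
    and mult_assoc: "\<lbrakk>x \<in> carrier A; y \<in> carrier A; z \<in> carrier A\<rbrakk> \<Longrightarrow> x \<otimes> y \<otimes> z = x \<otimes> (y \<otimes> z)"
    and distrib_right: "\<lbrakk>x \<in> carrier A; y \<in> carrier A; z \<in> carrier A\<rbrakk>
      \<Longrightarrow> (x \<oplus> y) \<otimes> z = x \<otimes> z \<oplus> y \<otimes> z"
    and distrib_left: "\<lbrakk>x \<in> carrier A; y \<in> carrier A; z \<in> carrier A\<rbrakk>
      \<Longrightarrow> x \<otimes> (y \<oplus> z) = x \<otimes> y \<oplus> x \<otimes> z"
    and scale_mult_left: "\<lbrakk>x \<in> carrier A; y \<in> carrier A\<rbrakk> \<Longrightarrow> (c \<odot> x) \<otimes> y = c \<odot> (x \<otimes> y)"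
    and scale_mult_right: "\<lbrakk>x \<in> carrier A; y \<in> carrier A\<rbrakk> \<Longrightarrow> x \<otimes> (c \<odot> y) = c \<odot> (x \<otimes> y)"
    and adj_add: "\<lbrakk>x \<in> carrier A; y \<in> carrier A\<rbrakk> \<Longrightarrow> cadj A (x \<oplus> y) = cadj A x \<oplus> cadj A y"
    and adj_scale: "x \<in> carrier A \<Longrightarrow> cadj A (c \<odot> x) = cnj c \<odot> cadj A x"
    and adj_mult: "\<lbrakk>x \<in> carrier A; y \<in> carrier A\<rbrakk> \<Longrightarrow> cadj A (x \<otimes> y) = cadj A y \<otimes> cadj A x"
    and adj_adj: "x \<in> carrier A \<Longrightarrow> cadj A (cadj A x) = x"
    and norm_nonneg: "x \<in> carrier A \<Longrightarrow> 0 \<le> cnorm A x"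
    and norm_eq_zero: "x \<in> carrier A \<Longrightarrow> cnorm A x = 0 \<longleftrightarrow> x = \<zero>"
    and norm_triangle: "\<lbrakk>x \<in> carrier A; y \<in> carrier A\<rbrakk> \<Longrightarrow> cnorm A (x \<oplus> y) \<le> cnorm A x + cnorm A y"
    and norm_scale: "x \<in> carrier A \<Longrightarrow> cnorm A (c \<odot> x) = cmod c * cnorm A x"
    and norm_mult: "\<lbrakk>x \<in> carrier A; y \<in> carrier A\<rbrakk> \<Longrightarrow> cnorm A (x \<otimes> y) \<le> cnorm A x * cnorm A y"
    and cstar_identity: "x \<in> carrier A \<Longrightarrow> cnorm A (cadj A x \<otimes> x) = (cnorm A x)\<^sup>2"
    and complete: "Metric_space.mcomplete (carrier A) (cdist A)"

abbreviation sub_cstar :: "'a cstar \<Rightarrow> 'a set \<Rightarrow> 'a cstar" (infixl \<open>restr\<close> 80) where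
  "A restr B \<equiv> A\<lparr>carrier := B\<rparr>"

definition csubspace :: "'a cstar \<Rightarrow> 'a set \<Rightarrow> bool" where
  "csubspace A V \<longleftrightarrow> V \<subseteq> carrier A \<and> \<zero>\<^bsub>A\<^esub> \<in> V \<and>
     (\<forall>x\<in>V. \<forall>y\<in>V. x \<oplus>\<^bsub>A\<^esub> y \<in> V) \<and> (\<forall>c. \<forall>x\<in>V. c \<odot>\<^bsub>A\<^esub> x \<in> V)"

definition cspan :: "'a cstar \<Rightarrow> 'a set \<Rightarrow> 'a set" where
  "cspan A X = csubspace A hull X"

definition cclosure :: "'a cstar \<Rightarrow> 'a set \<Rightarrow> 'a set" where
  "cclosure A X = ctopology A closure_of X"

definition cstar_subalgebra :: "'a cstar \<Rightarrow> 'a set \<Rightarrow> bool" where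
  "cstar_subalgebra A B \<longleftrightarrow> csubspace A B \<and> closedin (ctopology A) B \<and>
     (\<forall>x\<in>B. \<forall>y\<in>B. x \<otimes>\<^bsub>A\<^esub> y \<in> B) \<and> (\<forall>x\<in>B. cadj A x \<in> B)"

definition cstar_ideal :: "'a cstar \<Rightarrow> 'a set \<Rightarrow> bool" where
  "cstar_ideal A J \<longleftrightarrow> csubspace A J \<and> closedin (ctopology A) J \<and>
     (\<forall>a\<in>carrier A. \<forall>x\<in>J. a \<otimes>\<^bsub>A\<^esub> x \<in> J \<and> x \<otimes>\<^bsub>A\<^esub> a \<in> J)"

definition cunit :: "'a cstar \<Rightarrow> 'a \<Rightarrow> bool" where
  "cunit A e \<longleftrightarrow> e \<in> carrier A \<and> (\<forall>x\<in>carrier A. e \<otimes>\<^bsub>A\<^esub> x = x \<and> x \<otimes>\<^bsub>A\<^esub> e = x)"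

definition cunital :: "'a cstar \<Rightarrow> bool" where
  "cunital A \<longleftrightarrow> (\<exists>e. cunit A e)"

definition cone :: "'a cstar \<Rightarrow> 'a" (\<open>\<one>\<index>\<close>) where
  "\<one>\<^bsub>A\<^esub> = (THE e. cunit A e)"

definition cpositive :: "'a cstar \<Rightarrow> 'a \<Rightarrow> bool" where
  "cpositive A x \<longleftrightarrow> (\<exists>y\<in>carrier A. x = cadj A y \<otimes>\<^bsub>A\<^esub> y)"

definition cle :: "'a cstar \<Rightarrow> 'a \<Rightarrow> 'a \<Rightarrow> bool" where
  "cle A x y \<longleftrightarrow> cpositive A (y \<ominus>\<^bsub>A\<^esub> x)"

definition csqrt_pos :: "'a cstar \<Rightarrow> 'a \<Rightarrow> 'a" where
  "csqrt_pos A x = (THE y. cpositive A y \<and> y \<otimes>\<^bsub>A\<^esub> y = x)"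

definition cabs :: "'a cstar \<Rightarrow> 'a \<Rightarrow> 'a" where
  "cabs A x = csqrt_pos A (cadj A x \<otimes>\<^bsub>A\<^esub> x)"

definition star_hom :: "'a cstar \<Rightarrow> 'b cstar \<Rightarrow> ('a \<Rightarrow> 'b) \<Rightarrow> bool" where
  "star_hom A C f \<longleftrightarrow> f \<in> carrier A \<rightarrow> carrier C \<and>
     (\<forall>x\<in>carrier A. \<forall>y\<in>carrier A. f (x \<oplus>\<^bsub>A\<^esub> y) = f x \<oplus>\<^bsub>C\<^esub> f y) \<and>
     (\<forall>c. \<forall>x\<in>carrier A. f (c \<odot>\<^bsub>A\<^esub> x) = c \<odot>\<^bsub>C\<^esub> f x) \<and>
     (\<forall>x\<in>carrier A. \<forall>y\<in>carrier A. f (x \<otimes>\<^bsub>A\<^esub> y) = f x \<otimes>\<^bsub>C\<^esub> f y) \<and>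
     (\<forall>x\<in>carrier A. f (cadj A x) = cadj C (f x))"

definition star_iso :: "'a cstar \<Rightarrow> 'b cstar \<Rightarrow> ('a \<Rightarrow> 'b) \<Rightarrow> bool" where
  "star_iso A C f \<longleftrightarrow> star_hom A C f \<and> bij_betw f (carrier A) (carrier C)"

text \<open>The norm is the operator norm of left multiplication by \<open>(x, c)\<close> on \<open>A\<close>; it is a
  \<open>C\<^sup>*\<close>-norm when \<open>A\<close> has no unit.\<close>
definition unitization :: "'a cstar \<Rightarrow> ('a \<times> complex) cstar" where
  "unitization A =
    \<lparr>carrier = carrier A \<times> UNIV,
     czero = (\<zero>\<^bsub>A\<^esub>, 0),
     cadd = (\<lambda>(x, c) (y, d). (x \<oplus>\<^bsub>A\<^esub> y, c + d)),
     cscale = (\<lambda>k (x, c). (k \<odot>\<^bsub>A\<^esub> x, k * c)),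
     cmult = (\<lambda>(x, c) (y, d). (x \<otimes>\<^bsub>A\<^esub> y \<oplus>\<^bsub>A\<^esub> d \<odot>\<^bsub>A\<^esub> x \<oplus>\<^bsub>A\<^esub> c \<odot>\<^bsub>A\<^esub> y, c * d)),
     cadj = (\<lambda>(x, c). (cadj A x, cnj c)),
     cnorm = (\<lambda>(x, c). SUP y\<in>{y\<in>carrier A. cnorm A y \<le> 1}. cnorm A (x \<otimes>\<^bsub>A\<^esub> y \<oplus>\<^bsub>A\<^esub> c \<odot>\<^bsub>A\<^esub> y))\<rparr>"

definition corner :: "'a cstar \<Rightarrow> 'a \<Rightarrow> 'a cstar" where
  "corner A p = A restr ((\<lambda>x. p \<otimes>\<^bsub>A\<^esub> x \<otimes>\<^bsub>A\<^esub> p) ` carrier A)"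


section \<open>Completely positive maps and injectivity\<close>

primrec csum :: "'a cstar \<Rightarrow> (nat \<Rightarrow> 'a) \<Rightarrow> nat \<Rightarrow> 'a" where
  "csum A f 0 = \<zero>\<^bsub>A\<^esub>"
| "csum A f (Suc n) = csum A f n \<oplus>\<^bsub>A\<^esub> f n"

text \<open>Positivity in \<open>M\<^sub>n(A)\<close>, that is, \<open>X = Y\<^sup>* Y\<close> for some \<open>n \<times> n\<close> matrix \<open>Y\<close> over \<open>A\<close>.\<close>
definition mat_positive :: "'a cstar \<Rightarrow> nat \<Rightarrow> (nat \<Rightarrow> nat \<Rightarrow> 'a) \<Rightarrow> bool" where
  "mat_positive A n X \<longleftrightarrow>
     (\<exists>Y. (\<forall>i<n. \<forall>j<n. Y i j \<in> carrier A) \<and>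
          (\<forall>i<n. \<forall>j<n. X i j = csum A (\<lambda>k. cadj A (Y k i) \<otimes>\<^bsub>A\<^esub> Y k j) n))"

text \<open>\<open>E\<close> is a linear subspace of \<open>D\<close>; its matrix order is inherited from \<open>D\<close>.\<close>
definition cp_map :: "'d cstar \<Rightarrow> 'd set \<Rightarrow> 'c cstar \<Rightarrow> ('d \<Rightarrow> 'c) \<Rightarrow> bool" where
  "cp_map D E C f \<longleftrightarrow> f \<in> E \<rightarrow> carrier C \<and>
     (\<forall>x\<in>E. \<forall>y\<in>E. f (x \<oplus>\<^bsub>D\<^esub> y) = f x \<oplus>\<^bsub>C\<^esub> f y) \<and>
     (\<forall>c. \<forall>x\<in>E. f (c \<odot>\<^bsub>D\<^esub> x) = c \<odot>\<^bsub>C\<^esub> f x) \<and>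
     (\<forall>n X. (\<forall>i<n. \<forall>j<n. X i j \<in> E) \<longrightarrow> mat_positive D n X \<longrightarrow>
        mat_positive C n (\<lambda>i j. f (X i j)))"

definition ucp_map :: "'d cstar \<Rightarrow> 'd set \<Rightarrow> 'c cstar \<Rightarrow> ('d \<Rightarrow> 'c) \<Rightarrow> bool" where
  "ucp_map D E C f \<longleftrightarrow> cp_map D E C f \<and> f \<one>\<^bsub>D\<^esub> = \<one>\<^bsub>C\<^esub>"

definition operator_system :: "'d cstar \<Rightarrow> 'd set \<Rightarrow> bool" where
  "operator_system D E \<longleftrightarrow> csubspace D E \<and> (\<forall>x\<in>E. cadj D x \<in> E) \<and> \<one>\<^bsub>D\<^esub> \<in> E"

text \<open>
  Injectivity in the category of operator systems and unital completely positive maps.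
  A formula cannot quantify over types, so the ambient \<open>C\<^sup>*\<close>-algebras \<open>D\<close> range over all those
  whose carrier is a set of \<open>'c\<close>-indexed complex matrices, for \<open>I\<close> over the type \<open>'c\<close>.  No
  generality is lost: a nonzero \<open>I\<close> embeds unitally into the bounded operators on a Hilbert
  space with an orthonormal basis indexed by a subset of \<open>'c\<close> (a direct sum of at most
  \<open>|I|\<close> GNS spaces, each of density at most \<open>|I|\<close>), and these operators are such matrices.
  Extending the inverse of this embedding to all bounded operators, which are injective by
  Arveson's theorem, shows that \<open>I\<close> is injective with respect to all operator systems.
\<close>
definition injective_cstar :: "'c cstar \<Rightarrow> bool" where
  "injective_cstar I \<longleftrightarrow> cstar_algebra I \<and> cunital I \<and>
     (\<forall>(D :: ('c \<Rightarrow> 'c \<Rightarrow> complex) cstar) E F f.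
        cstar_algebra D \<and> cunital D \<and> operator_system D E \<and> operator_system D F \<and> E \<subseteq> F \<and>
        ucp_map D E I f \<longrightarrow> (\<exists>g. ucp_map D F I g \<and> (\<forall>x\<in>E. g x = f x)))"


section \<open>Injective envelopes and structure projections\<close>

definition injective_envelope_unital :: "'b cstar \<Rightarrow> 'c cstar \<Rightarrow> ('b \<Rightarrow> 'c) \<Rightarrow> bool" where
  "injective_envelope_unital B I \<iota> \<longleftrightarrow> injective_cstar I \<and>
     star_hom B I \<iota> \<and> inj_on \<iota> (carrier B) \<and> \<iota> \<one>\<^bsub>B\<^esub> = \<one>\<^bsub>I\<^esub> \<and>
     (\<forall>\<phi>. ucp_map I (carrier I) I \<phi> \<and> (\<forall>b\<in>carrier B. \<phi> (\<iota> b) = \<iota> b) \<longrightarrow>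
        (\<forall>x\<in>carrier I. \<phi> x = x))"

text \<open>
  If \<open>B\<close> has no unit, \<open>\<iota>\<close> denotes the restriction to \<open>B\<close> of the embedding of the unitization,
  which it determines.
\<close>
definition injective_envelope :: "'b cstar \<Rightarrow> 'c cstar \<Rightarrow> ('b \<Rightarrow> 'c) \<Rightarrow> bool" where
  "injective_envelope B I \<iota> \<longleftrightarrow>
     (if cunital B then injective_envelope_unital B I \<iota>
      else injective_envelope_unital (unitization B) I (\<lambda>(b, c). \<iota> b \<oplus>\<^bsub>I\<^esub> c \<odot>\<^bsub>I\<^esub> \<one>\<^bsub>I\<^esub>))"

text \<open>\<open>p\<close> is the structure projection in \<open>I\<close> of the hereditary subalgebra \<open>C\<close> of \<open>B\<close>,
  for an injective envelope \<open>(I, \<iota>)\<close> of \<open>B\<close>.\<close>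
definition structure_projection ::
    "'b cstar \<Rightarrow> 'c cstar \<Rightarrow> ('b \<Rightarrow> 'c) \<Rightarrow> 'b set \<Rightarrow> 'c \<Rightarrow> bool" where
  "structure_projection B I \<iota> C p \<longleftrightarrow>
     p \<in> carrier I \<and> cadj I p = p \<and> p \<otimes>\<^bsub>I\<^esub> p = p \<and>
     injective_envelope (B restr C) (corner I p) \<iota>"


section \<open>Inclusions and normalizers\<close>

text \<open>
  An increasing approximate unit of positive contractions, given as an upward directed set
  indexed by itself.  The range of any increasing approximate unit is such a set.
\<close>
definition approximate_unit :: "'a cstar \<Rightarrow> 'a set \<Rightarrow> bool" where
  "approximate_unit A U \<longleftrightarrow> U \<noteq> {} \<and> U \<subseteq> carrier A \<and>
     (\<forall>u\<in>U. cpositive A u \<and> cnorm A u \<le> 1) \<and>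
     (\<forall>u\<in>U. \<forall>v\<in>U. \<exists>w\<in>U. cle A u w \<and> cle A v w) \<and>
     (\<forall>a\<in>carrier A. \<forall>\<epsilon>>0. \<exists>u\<^sub>0\<in>U. \<forall>u\<in>U. cle A u\<^sub>0 u \<longrightarrow>
        cnorm A (u \<otimes>\<^bsub>A\<^esub> a \<ominus>\<^bsub>A\<^esub> a) < \<epsilon> \<and> cnorm A (a \<otimes>\<^bsub>A\<^esub> u \<ominus>\<^bsub>A\<^esub> a) < \<epsilon>)"

definition cstar_inclusion :: "'a cstar \<Rightarrow> 'a set \<Rightarrow> bool" where
  "cstar_inclusion A B \<longleftrightarrow> cstar_algebra A \<and> cstar_subalgebra A B \<and>
     (\<exists>U. approximate_unit A U \<and> U \<subseteq> B)"

text \<open>\<open>conj_set A n X\<close> is the set \<open>n X n\<^sup>*\<close>.\<close>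
definition conj_set :: "'a cstar \<Rightarrow> 'a \<Rightarrow> 'a set \<Rightarrow> 'a set" where
  "conj_set A n X = (\<lambda>x. n \<otimes>\<^bsub>A\<^esub> x \<otimes>\<^bsub>A\<^esub> cadj A n) ` X"

definition normalizers :: "'a cstar \<Rightarrow> 'a set \<Rightarrow> 'a set" where
  "normalizers A B =
     {n \<in> carrier A. conj_set A n B \<subseteq> B \<and> conj_set A (cadj A n) B \<subseteq> B}"

definition dense_span :: "'a cstar \<Rightarrow> 'a set \<Rightarrow> bool" where
  "dense_span A X \<longleftrightarrow> cclosure A (cspan A X) = carrier A"

definition regular_inclusion :: "'a cstar \<Rightarrow> 'a set \<Rightarrow> bool" where
  "regular_inclusion A B \<longleftrightarrow> cstar_inclusion A B \<and> dense_span A (normalizers A B)"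

definition generating_star_semigroup :: "'a cstar \<Rightarrow> 'a set \<Rightarrow> 'a set \<Rightarrow> bool" where
  "generating_star_semigroup A B N \<longleftrightarrow> N \<subseteq> normalizers A B \<and>
     (\<forall>m\<in>N. \<forall>n\<in>N. m \<otimes>\<^bsub>A\<^esub> n \<in> N) \<and> (\<forall>n\<in>N. cadj A n \<in> N) \<and> dense_span A N"

definition ideal_intersection_property :: "'a cstar \<Rightarrow> 'a set \<Rightarrow> bool" where
  "ideal_intersection_property A B \<longleftrightarrow>
     (\<forall>J. cstar_ideal A J \<and> J \<noteq> {\<zero>\<^bsub>A\<^esub>} \<longrightarrow> J \<inter> B \<noteq> {\<zero>\<^bsub>A\<^esub>})"


section \<open>Pseudo-expectations\<close>

definition pseudo_expectation ::
    "'a cstar \<Rightarrow> 'a set \<Rightarrow> 'c cstar \<Rightarrow> ('a \<Rightarrow> 'c) \<Rightarrow> ('a \<Rightarrow> 'c) \<Rightarrow> bool" where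
  "pseudo_expectation A B I \<iota> \<Phi> \<longleftrightarrow> cp_map A (carrier A) I \<Phi> \<and>
     (\<forall>a\<in>carrier A. cnorm I (\<Phi> a) \<le> cnorm A a) \<and> (\<forall>b\<in>B. \<Phi> b = \<iota> b)"

definition faithful_map :: "'a cstar \<Rightarrow> 'c cstar \<Rightarrow> ('a \<Rightarrow> 'c) \<Rightarrow> bool" where
  "faithful_map A I \<Phi> \<longleftrightarrow>
     (\<forall>a\<in>carrier A. \<Phi> (cadj A a \<otimes>\<^bsub>A\<^esub> a) = \<zero>\<^bsub>I\<^esub> \<longrightarrow> a = \<zero>\<^bsub>A\<^esub>)"

definition normalizer_iso :: "'a cstar \<Rightarrow> 'a set \<Rightarrow> 'a \<Rightarrow> ('a \<Rightarrow> 'a) \<Rightarrow> bool" where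
  "normalizer_iso A B n \<theta> \<longleftrightarrow>
     star_iso (A restr cclosure A (conj_set A n B))
       (A restr cclosure A (conj_set A (cadj A n) B)) \<theta> \<and>
     (\<forall>b\<in>B. \<theta> (cabs A (cadj A n) \<otimes>\<^bsub>A\<^esub> b \<otimes>\<^bsub>A\<^esub> cabs A (cadj A n)) = cadj A n \<otimes>\<^bsub>A\<^esub> b \<otimes>\<^bsub>A\<^esub> n)"

definition envelope_normalizer_iso ::
    "'a cstar \<Rightarrow> 'a set \<Rightarrow> 'c cstar \<Rightarrow> ('a \<Rightarrow> 'c) \<Rightarrow> 'a \<Rightarrow> ('c \<Rightarrow> 'c) \<Rightarrow> bool" where
  "envelope_normalizer_iso A B I \<iota> n \<theta>' \<longleftrightarrow>
     (\<exists>p q \<theta>. structure_projection (A restr B) I \<iota> (cclosure A (conj_set A n B)) p \<and>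
        structure_projection (A restr B) I \<iota> (cclosure A (conj_set A (cadj A n) B)) q \<and>
        normalizer_iso A B n \<theta> \<and> star_iso (corner I p) (corner I q) \<theta>' \<and>
        (\<forall>x\<in>cclosure A (conj_set A n B). \<theta>' (\<iota> x) = \<iota> (\<theta> x)))"

text \<open>
  The isomorphism \<open>\<theta>'\<close> (in the literature \<open>\<theta>\<^sub>n\<close> with a tilde) exists and is unique on
  its domain, so the existential quantifier merely names it.
\<close>
definition invariant_map ::
    "'a cstar \<Rightarrow> 'a set \<Rightarrow> 'c cstar \<Rightarrow> ('a \<Rightarrow> 'c) \<Rightarrow> 'a set \<Rightarrow> ('a \<Rightarrow> 'c) \<Rightarrow> bool" where
  "invariant_map A B I \<iota> N \<Phi> \<longleftrightarrow>
     (\<forall>n\<in>N. \<exists>\<theta>'. envelope_normalizer_iso A B I \<iota> n \<theta>' \<and>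
        (\<forall>a\<in>carrier A. \<Phi> (cadj A n \<otimes>\<^bsub>A\<^esub> a \<otimes>\<^bsub>A\<^esub> n) =
           \<theta>' (\<Phi> (cabs A (cadj A n) \<otimes>\<^bsub>A\<^esub> a \<otimes>\<^bsub>A\<^esub> cabs A (cadj A n)))))"


section \<open>Regular ideals and Boolean algebras\<close>

definition annihilator :: "'a cstar \<Rightarrow> 'a set \<Rightarrow> 'a set" where
  "annihilator A X =
     {a \<in> carrier A. \<forall>x\<in>X. a \<otimes>\<^bsub>A\<^esub> x = \<zero>\<^bsub>A\<^esub> \<and> x \<otimes>\<^bsub>A\<^esub> a = \<zero>\<^bsub>A\<^esub>}"

abbreviation biannihilator :: "'a cstar \<Rightarrow> 'a set \<Rightarrow> 'a set" where
  "biannihilator A X \<equiv> annihilator A (annihilator A X)"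

definition regular_ideals :: "'a cstar \<Rightarrow> 'a set set" where
  "regular_ideals A = {J. cstar_ideal A J \<and> J = biannihilator A J}"

definition invariant_regular_ideals :: "'a cstar \<Rightarrow> 'a set \<Rightarrow> 'a set set" where
  "invariant_regular_ideals A B =
     {K \<in> regular_ideals (A restr B). \<forall>n\<in>normalizers A B. conj_set A n K \<subseteq> K}"

definition J_ideal :: "'a cstar \<Rightarrow> ('a \<Rightarrow> 'c) \<Rightarrow> ('a \<Rightarrow> 'c) \<Rightarrow> 'a set \<Rightarrow> 'a set" where
  "J_ideal A \<iota> \<Phi> K = {a \<in> carrier A. \<Phi> (cadj A a \<otimes>\<^bsub>A\<^esub> a) \<in> \<iota> ` K}"

definition L_ideal ::
    "'a cstar \<Rightarrow> 'c cstar \<Rightarrow> ('a \<Rightarrow> 'c) \<Rightarrow> ('a \<Rightarrow> 'c) \<Rightarrow> 'a set \<Rightarrow> 'a set" where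
  "L_ideal A I \<iota> \<Phi> K = {a \<in> carrier A. \<Phi> (cadj A a \<otimes>\<^bsub>A\<^esub> a) \<in> biannihilator I (\<iota> ` K)}"

abbreviation inclusion_order :: "'a set set \<Rightarrow> 'a set gorder" where
  "inclusion_order F \<equiv> \<lparr>carrier = F, eq = (=), le = (\<subseteq>)\<rparr>"

text \<open>The one-element lattice is allowed: it occurs for the zero algebra.\<close>
locale boolean_lattice = bounded_lattice L for L (structure) +
  assumes meet_join_distrib:
    "\<lbrakk>x \<in> carrier L; y \<in> carrier L; z \<in> carrier L\<rbrakk> \<Longrightarrow> x \<sqinter> (y \<squnion> z) = (x \<sqinter> y) \<squnion> (x \<sqinter> z)"
    and complement_exists:
    "x \<in> carrier L \<Longrightarrow> \<exists>y\<in>carrier L. x \<sqinter> y = \<bottom> \<and> x \<squnion> y = \<top>"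

definition complement_of :: "('a, 'm) gorder_scheme \<Rightarrow> 'a \<Rightarrow> 'a" where
  "complement_of L x =
     (THE y. y \<in> carrier L \<and> x \<sqinter>\<^bsub>L\<^esub> y = \<bottom>\<^bsub>L\<^esub> \<and> x \<squnion>\<^bsub>L\<^esub> y = \<top>\<^bsub>L\<^esub>)"

definition boolean_iso ::
    "('a, 'm) gorder_scheme \<Rightarrow> ('b, 'n) gorder_scheme \<Rightarrow> ('a \<Rightarrow> 'b) \<Rightarrow> bool" where
  "boolean_iso L M f \<longleftrightarrow> boolean_lattice L \<and> boolean_lattice M \<and>
     bij_betw f (carrier L) (carrier M) \<and> join_pres L M f \<and> meet_pres L M f \<and>
     f \<bottom>\<^bsub>L\<^esub> = \<bottom>\<^bsub>M\<^esub> \<and> f \<top>\<^bsub>L\<^esub> = \<top>\<^bsub>M\<^esub> \<and>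
     (\<forall>x\<in>carrier L. f (complement_of L x) = complement_of M (f x))"

end

theory Submission
  imports Defs "HOL-Computational_Algebra.Polynomial"
begin

text \<open>
  For an invariant ideal \<open>K\<close> of \<open>B\<close>, regularity makes \<open>K\<^sup>\<bottom>\<close> (in \<open>A\<close>) an ideal of \<open>A\<close>, and
  the ideal intersection property gives \<open>(J \<inter> B)\<^sup>\<bottom> = J\<^sup>\<bottom>\<close> for ideals \<open>J\<close> of \<open>A\<close>.  Hence
  \<open>J \<mapsto> J \<inter> B\<close> and \<open>K \<mapsto> K\<^sup>\<bottom>\<^sup>\<bottom>\<close> are inverse to each other and respect intersections and
  annihilators.

  Let \<open>M\<close> be the annihilator of \<open>K\<close> in \<open>B\<close>, so that \<open>K\<^sup>\<bottom>\<^sup>\<bottom> = M\<^sup>\<bottom>\<close> in \<open>A\<close>.  As \<open>\<Phi>\<close> is a faithful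
  \<open>B\<close>-bimodule map, \<open>a\<close> is orthogonal to \<open>M\<close> if and only if \<open>\<Phi>(a\<^sup>*a)\<close> is orthogonal to
  \<open>\<iota>(M)\<close>, so \<open>L\<^sub>K = K\<^sup>\<bottom>\<^sup>\<bottom>\<close> amounts to \<open>\<iota>(M)\<^sup>\<bottom> \<subseteq> \<iota>(K)\<^sup>\<bottom>\<^sup>\<bottom>\<close> in \<open>I(B)\<close>.  This follows from injectivity
  and rigidity of \<open>I(B)\<close>, because \<open>K + M\<close> is essential in \<open>B\<close>.  What complete
  positivity requires for this, square roots of positive matrices over \<open>B\<close>, is obtained from power
  series.
\<close>

section \<open>Banach \<open>*\<close>-algebras\<close>

text \<open>The envelope step says in effect that the supports of \<iota>(K) and \<iota>(M) in the
  envelope are complementary central projections. Instead of constructing them, the proof lets the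
  two summands of I \<oplus> I play their roles: injectivity extends a map given on those pairs that
  look like one element of B, on K through the first coordinate and on M through the second. The
  obstacle is that \<open>cp_map\<close> speaks of factorizations Y^* Y of matrices, so complete
  positivity of this map calls for true square roots over B. The entry-sum norm on matrices is
  complete and submultiplicative but not a C*-norm. Hence square roots are developed in Banach
  star-algebras from bounded powers, and positivity of x^* x in a C*-algebra is obtained from norm
  estimates in place of spectra. If B has no unit, its unitization must first be shown to be a
  C*-algebra. As A may lack a unit too, the module property of \<Phi> is proved on products with
  elements of an approximate unit and then passed to the limit.\<close>

definition clim :: "'a cstar \<Rightarrow> (nat \<Rightarrow> 'a) \<Rightarrow> 'a \<Rightarrow> bool" where
  "clim A s l \<longleftrightarrow> l \<in> carrier A \<and> (\<forall>n. s n \<in> carrier A) \<and>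
     (\<lambda>n. cnorm A (s n \<ominus>\<^bsub>A\<^esub> l)) \<longlonglongrightarrow> 0"

definition ccauchy :: "'a cstar \<Rightarrow> (nat \<Rightarrow> 'a) \<Rightarrow> bool" where
  "ccauchy A s \<longleftrightarrow> (\<forall>n. s n \<in> carrier A) \<and>
     (\<forall>e>0. \<exists>k. \<forall>m\<ge>k. \<forall>n\<ge>k. cnorm A (s m \<ominus>\<^bsub>A\<^esub> s n) < e)"

text \<open>An isometric involution takes the place of the C*-identity, so that matrix algebras with
  a merely equivalent norm are instances. Completeness is added separately, in
  \<open>banach_star\<close>, once the norm has given a metric.\<close>

locale normed_star =
  fixes A :: "'a cstar" (structure)
  assumes zero_cl [simp, intro]: "\<zero> \<in> carrier A"
    and add_cl [simp, intro]: "\<lbrakk>x \<in> carrier A; y \<in> carrier A\<rbrakk> \<Longrightarrow> x \<oplus> y \<in> carrier A"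
    and scale_cl [simp, intro]: "x \<in> carrier A \<Longrightarrow> c \<odot> x \<in> carrier A"
    and mult_cl [simp, intro]: "\<lbrakk>x \<in> carrier A; y \<in> carrier A\<rbrakk> \<Longrightarrow> x \<otimes> y \<in> carrier A"
    and adj_cl [simp, intro]: "x \<in> carrier A \<Longrightarrow> cadj A x \<in> carrier A"
    and a_assoc: "\<lbrakk>x \<in> carrier A; y \<in> carrier A; z \<in> carrier A\<rbrakk> \<Longrightarrow> x \<oplus> y \<oplus> z = x \<oplus> (y \<oplus> z)"
    and a_comm: "\<lbrakk>x \<in> carrier A; y \<in> carrier A\<rbrakk> \<Longrightarrow> x \<oplus> y = y \<oplus> x"
    and a_zero [simp]: "x \<in> carrier A \<Longrightarrow> x \<oplus> \<zero> = x"
    and minus_self [simp]: "x \<in> carrier A \<Longrightarrow> x \<ominus> x = \<zero>"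
    and s_add: "\<lbrakk>x \<in> carrier A; y \<in> carrier A\<rbrakk> \<Longrightarrow> c \<odot> (x \<oplus> y) = c \<odot> x \<oplus> c \<odot> y"
    and add_s: "x \<in> carrier A \<Longrightarrow> (c + d) \<odot> x = c \<odot> x \<oplus> d \<odot> x"
    and s_s [simp]: "x \<in> carrier A \<Longrightarrow> c \<odot> d \<odot> x = (c * d) \<odot> x"
    and s_one [simp]: "x \<in> carrier A \<Longrightarrow> 1 \<odot> x = x"
    and m_assoc: "\<lbrakk>x \<in> carrier A; y \<in> carrier A; z \<in> carrier A\<rbrakk> \<Longrightarrow> x \<otimes> y \<otimes> z = x \<otimes> (y \<otimes> z)"
    and r_distr: "\<lbrakk>x \<in> carrier A; y \<in> carrier A; z \<in> carrier A\<rbrakk>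
      \<Longrightarrow> (x \<oplus> y) \<otimes> z = x \<otimes> z \<oplus> y \<otimes> z"
    and l_distr: "\<lbrakk>x \<in> carrier A; y \<in> carrier A; z \<in> carrier A\<rbrakk>
      \<Longrightarrow> x \<otimes> (y \<oplus> z) = x \<otimes> y \<oplus> x \<otimes> z"
    and s_mult_l [simp]: "\<lbrakk>x \<in> carrier A; y \<in> carrier A\<rbrakk> \<Longrightarrow> (c \<odot> x) \<otimes> y = c \<odot> (x \<otimes> y)"
    and s_mult_r [simp]: "\<lbrakk>x \<in> carrier A; y \<in> carrier A\<rbrakk> \<Longrightarrow> x \<otimes> (c \<odot> y) = c \<odot> (x \<otimes> y)"
    and adj_sum: "\<lbrakk>x \<in> carrier A; y \<in> carrier A\<rbrakk> \<Longrightarrow> cadj A (x \<oplus> y) = cadj A x \<oplus> cadj A y"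
    and adj_s [simp]: "x \<in> carrier A \<Longrightarrow> cadj A (c \<odot> x) = cnj c \<odot> cadj A x"
    and adj_prod: "\<lbrakk>x \<in> carrier A; y \<in> carrier A\<rbrakk> \<Longrightarrow> cadj A (x \<otimes> y) = cadj A y \<otimes> cadj A x"
    and adj_invol [simp]: "x \<in> carrier A \<Longrightarrow> cadj A (cadj A x) = x"
    and norm_ge_0 [simp]: "x \<in> carrier A \<Longrightarrow> 0 \<le> cnorm A x"
    and norm_0_iff: "x \<in> carrier A \<Longrightarrow> cnorm A x = 0 \<longleftrightarrow> x = \<zero>"
    and norm_add: "\<lbrakk>x \<in> carrier A; y \<in> carrier A\<rbrakk> \<Longrightarrow> cnorm A (x \<oplus> y) \<le> cnorm A x + cnorm A y"
    and norm_s: "x \<in> carrier A \<Longrightarrow> cnorm A (c \<odot> x) = cmod c * cnorm A x"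
    and norm_prod: "\<lbrakk>x \<in> carrier A; y \<in> carrier A\<rbrakk> \<Longrightarrow> cnorm A (x \<otimes> y) \<le> cnorm A x * cnorm A y"
    and norm_adj [simp]: "x \<in> carrier A \<Longrightarrow> cnorm A (cadj A x) = cnorm A x"
begin

lemma minus_cl [simp, intro]: "\<lbrakk>x \<in> carrier A; y \<in> carrier A\<rbrakk> \<Longrightarrow> x \<ominus> y \<in> carrier A"
  by (simp add: cdiff_def)

lemma zero_a [simp]: "x \<in> carrier A \<Longrightarrow> \<zero> \<oplus> x = x"
  using a_comm by fastforce

lemma a_lcomm: "\<lbrakk>x \<in> carrier A; y \<in> carrier A; z \<in> carrier A\<rbrakk> \<Longrightarrow> x \<oplus> (y \<oplus> z) = y \<oplus> (x \<oplus> z)"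
  by (metis a_assoc a_comm)

lemmas a_ac = a_assoc a_comm a_lcomm

lemma a_neg [simp]: "x \<in> carrier A \<Longrightarrow> x \<oplus> (- 1) \<odot> x = \<zero>"
  using minus_self[of x] by (simp add: cdiff_def)

text \<open>With \<open>a_ac\<close> sorting sums, a summand and its negative may be separated by
  another term or followed by a tail; this rule and the next ones cancel them in those
  shapes.\<close>

lemma a_neg2 [simp]: "x \<in> carrier A \<Longrightarrow> y \<in> carrier A \<Longrightarrow> x \<oplus> ((- 1) \<odot> x \<oplus> y) = y"
  by (simp add: a_assoc[symmetric])

lemma a_neg3 [simp]: "x \<in> carrier A \<Longrightarrow> z \<in> carrier A \<Longrightarrow> x \<oplus> (z \<oplus> (- 1) \<odot> x) = z"
  by (simp add: a_lcomm[of x z])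

lemma a_neg4 [simp]:
  "\<lbrakk>x \<in> carrier A; z \<in> carrier A; w \<in> carrier A\<rbrakk> \<Longrightarrow> x \<oplus> (z \<oplus> ((- 1) \<odot> x \<oplus> w)) = z \<oplus> w"
  by (simp add: a_lcomm[of x z])

lemma neg_a [simp]: "x \<in> carrier A \<Longrightarrow> (- 1) \<odot> x \<oplus> x = \<zero>"
  by (simp add: a_comm)

lemma neg_a2 [simp]: "x \<in> carrier A \<Longrightarrow> y \<in> carrier A \<Longrightarrow> (- 1) \<odot> x \<oplus> (x \<oplus> y) = y"
  by (simp add: a_assoc[symmetric])

lemma minus_0_iff: "\<lbrakk>x \<in> carrier A; y \<in> carrier A\<rbrakk> \<Longrightarrow> x \<ominus> y = \<zero> \<longleftrightarrow> x = y"
  by (metis a_comm a_neg2 a_zero cdiff_def minus_self scale_cl)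

lemma add_s2: "\<lbrakk>x \<in> carrier A; z \<in> carrier A\<rbrakk> \<Longrightarrow> c \<odot> x \<oplus> (d \<odot> x \<oplus> z) = (c + d) \<odot> x \<oplus> z"
  by (simp add: a_assoc[symmetric] add_s)

lemma s_zero_scalar [simp]: "x \<in> carrier A \<Longrightarrow> 0 \<odot> x = \<zero>"
  using add_s[of x 1 "-1"] by simp

lemma s_zero [simp]: "c \<odot> \<zero> = \<zero>"
  using s_s[of \<zero> c 0] by simp

lemma m_zero [simp]: "x \<in> carrier A \<Longrightarrow> x \<otimes> \<zero> = \<zero>"
  using s_mult_r[of x \<zero> 0] by simp

lemma zero_m [simp]: "x \<in> carrier A \<Longrightarrow> \<zero> \<otimes> x = \<zero>"
  using s_mult_l[of \<zero> x 0] by simp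

lemma m_swap:
  "\<lbrakk>y \<otimes> x = x \<otimes> y; x \<in> carrier A; y \<in> carrier A; z \<in> carrier A\<rbrakk>
    \<Longrightarrow> y \<otimes> (x \<otimes> z) = x \<otimes> (y \<otimes> z)"
  by (metis m_assoc)

lemma adj_zero [simp]: "cadj A \<zero> = \<zero>"
  using adj_s[of \<zero> 0] by simp

lemma norm_zero [simp]: "cnorm A \<zero> = 0"
  by (simp add: norm_0_iff)

lemma minus_zero [simp]: "x \<in> carrier A \<Longrightarrow> x \<ominus> \<zero> = x"
  by (simp add: cdiff_def)

lemma adj_minus: "\<lbrakk>x \<in> carrier A; y \<in> carrier A\<rbrakk> \<Longrightarrow> cadj A (x \<ominus> y) = cadj A x \<ominus> cadj A y"
  by (simp add: cdiff_def adj_sum)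

lemma l_minus: "\<lbrakk>x \<in> carrier A; y \<in> carrier A; z \<in> carrier A\<rbrakk> \<Longrightarrow> x \<otimes> (y \<ominus> z) = x \<otimes> y \<ominus> x \<otimes> z"
  by (simp add: cdiff_def l_distr)

lemma r_minus: "\<lbrakk>x \<in> carrier A; y \<in> carrier A; z \<in> carrier A\<rbrakk> \<Longrightarrow> (x \<ominus> y) \<otimes> z = x \<otimes> z \<ominus> y \<otimes> z"
  by (simp add: cdiff_def r_distr)

lemma s_minus: "\<lbrakk>x \<in> carrier A; y \<in> carrier A\<rbrakk> \<Longrightarrow> c \<odot> (x \<ominus> y) = c \<odot> x \<ominus> c \<odot> y"
  by (simp add: cdiff_def s_add mult.commute)

lemma minus_trans: "\<lbrakk>x \<in> carrier A; y \<in> carrier A; z \<in> carrier A\<rbrakk> \<Longrightarrow> x \<ominus> z = (x \<ominus> y) \<oplus> (y \<ominus> z)"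
  by (simp add: cdiff_def a_assoc)

lemma minus_add: "\<lbrakk>x \<in> carrier A; y \<in> carrier A\<rbrakk> \<Longrightarrow> (x \<ominus> y) \<oplus> y = x"
  by (simp add: cdiff_def a_assoc)

lemma neg_minus: "\<lbrakk>x \<in> carrier A; y \<in> carrier A\<rbrakk> \<Longrightarrow> y \<ominus> x = (- 1) \<odot> (x \<ominus> y)"
  by (simp add: cdiff_def s_add a_comm)

lemma norm_minus_comm: "\<lbrakk>x \<in> carrier A; y \<in> carrier A\<rbrakk> \<Longrightarrow> cnorm A (x \<ominus> y) = cnorm A (y \<ominus> x)"
  using neg_minus[of x y] by (simp add: norm_s)

lemma norm_minus_triangle:
  "\<lbrakk>x \<in> carrier A; y \<in> carrier A; z \<in> carrier A\<rbrakk>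
    \<Longrightarrow> cnorm A (x \<ominus> z) \<le> cnorm A (x \<ominus> y) + cnorm A (y \<ominus> z)"
  using minus_trans[of x y z] norm_add[of "x \<ominus> y" "y \<ominus> z"] by simp

lemma norm_minus_le: "\<lbrakk>x \<in> carrier A; y \<in> carrier A\<rbrakk> \<Longrightarrow> cnorm A (x \<ominus> y) \<le> cnorm A x + cnorm A y"
  using norm_add[of x "(- 1) \<odot> y"] by (simp add: cdiff_def norm_s)

lemma norm_le_minus: "\<lbrakk>x \<in> carrier A; y \<in> carrier A\<rbrakk> \<Longrightarrow> cnorm A x \<le> cnorm A (x \<ominus> y) + cnorm A y"
  using norm_add[of "x \<ominus> y" y] by (simp add: minus_add)

section \<open>Limits of sequences in the norm metric\<close>

sublocale Metric_space "carrier A" "cdist A"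
proof
  fix x y z
  show "0 \<le> cdist A x y" by (simp add: cdist_def)
  show "cdist A x y = cdist A y x" by (auto simp: cdist_def norm_minus_comm)
  assume "x \<in> carrier A" "y \<in> carrier A"
  then show "cdist A x y = 0 \<longleftrightarrow> x = y"
    by (simp add: cdist_def norm_0_iff minus_0_iff)
  assume "z \<in> carrier A"
  then show "cdist A x z \<le> cdist A x y + cdist A y z"
    using \<open>x \<in> carrier A\<close> \<open>y \<in> carrier A\<close> by (simp add: cdist_def norm_minus_triangle)
qed

lemma MCauchy_iff: "MCauchy s \<longleftrightarrow> ccauchy A s"
proof -
  have "cdist A (s m) (s n) = cnorm A (s m \<ominus> s n)" if "\<And>n. s n \<in> carrier A" for m n
    using that by (simp add: cdist_def)
  then have "\<forall>n. s n \<in> carrier A \<Longrightarrow> ?thesis"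
    unfolding MCauchy_def ccauchy_def image_subset_iff by simp
  then show ?thesis
    unfolding MCauchy_def ccauchy_def image_subset_iff by blast
qed

text \<open>A metric limit constrains the terms only eventually, while \<open>clim\<close> wants
  every term in the carrier; hence the hypothesis.\<close>

lemma limitin_iff:
  assumes "\<And>n. s n \<in> carrier A"
  shows "limitin mtopology s l sequentially \<longleftrightarrow> clim A s l"
proof -
  have "(\<lambda>n. cnorm A (s n \<ominus> l)) \<longlonglongrightarrow> 0 \<longleftrightarrow>
     (\<forall>e>0. \<exists>k. \<forall>n\<ge>k. cnorm A (s n \<ominus> l) < e)" if "l \<in> carrier A"
    using that assms by (simp add: LIMSEQ_def)
  then show ?thesis
    using assms unfolding limit_metric_sequentially clim_def cdist_def by auto
qed

lemma mcomplete_iff: "mcomplete \<longleftrightarrow> (\<forall>s. ccauchy A s \<longrightarrow> (\<exists>l. clim A s l))"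
  unfolding mcomplete_def MCauchy_iff by (metis ccauchy_def limitin_iff)

lemma clim_D:
  assumes "clim A s l"
  shows "l \<in> carrier A" "s n \<in> carrier A" "(\<lambda>n. cnorm A (s n \<ominus> l)) \<longlonglongrightarrow> 0"
  using assms by (auto simp: clim_def)

lemma clim_unique:
  assumes "clim A s l" "clim A s m"
  shows "l = m"
proof -
  have "limitin mtopology s l sequentially" "limitin mtopology s m sequentially"
    using assms by (auto simp: limitin_iff clim_def)
  then show ?thesis
    using limitin_metric_unique by (metis trivial_limit_sequentially)
qed

lemma clim_dominated:
  assumes "\<And>n. s n \<in> carrier A" "l \<in> carrier A" "\<And>n. cnorm A (s n \<ominus> l) \<le> r n" "r \<longlonglongrightarrow> 0"
  shows "clim A s l"
  unfolding clim_def
proof (intro conjI allI)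
  show "(\<lambda>n. cnorm A (s n \<ominus> l)) \<longlonglongrightarrow> 0"
    by (rule tendsto_sandwich[OF _ _ tendsto_const assms(4)]) (use assms in auto)
qed (use assms in auto)

lemma clim_const: "l \<in> carrier A \<Longrightarrow> clim A (\<lambda>n. l) l"
  by (simp add: clim_def)

lemma clim_Suc: "clim A s l \<Longrightarrow> clim A (\<lambda>n. s (Suc n)) l"
  unfolding clim_def using LIMSEQ_Suc by blast

lemma clim_add:
  assumes "clim A s l" "clim A t m"
  shows "clim A (\<lambda>n. s n \<oplus> t n) (l \<oplus> m)"
proof -
  note * = clim_D[OF assms(1)] clim_D[OF assms(2)]
  show ?thesis
  proof (rule clim_dominated)
    fix n
    have "s n \<oplus> t n \<ominus> (l \<oplus> m) = (s n \<ominus> l) \<oplus> (t n \<ominus> m)"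
      using * by (simp add: cdiff_def s_add a_ac)
    then show "cnorm A (s n \<oplus> t n \<ominus> (l \<oplus> m)) \<le> cnorm A (s n \<ominus> l) + cnorm A (t n \<ominus> m)"
      using * norm_add by simp
  next
    show "(\<lambda>n. cnorm A (s n \<ominus> l) + cnorm A (t n \<ominus> m)) \<longlonglongrightarrow> 0"
      using tendsto_add[OF *(3) *(6)] by simp
  qed (use * in auto)
qed

lemma clim_scale:
  assumes "clim A s l"
  shows "clim A (\<lambda>n. c \<odot> s n) (c \<odot> l)"
proof -
  note * = clim_D[OF assms]
  show ?thesis
  proof (rule clim_dominated)
    fix n
    show "cnorm A (c \<odot> s n \<ominus> c \<odot> l) \<le> cmod c * cnorm A (s n \<ominus> l)"
      using * by (simp add: s_minus[symmetric] norm_s)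
  next
    show "(\<lambda>n. cmod c * cnorm A (s n \<ominus> l)) \<longlonglongrightarrow> 0"
      using tendsto_mult_left[OF *(3), of "cmod c"] by simp
  qed (use * in auto)
qed

lemma clim_adj:
  assumes "clim A s l"
  shows "clim A (\<lambda>n. cadj A (s n)) (cadj A l)"
  using assms by (simp add: clim_def adj_minus[symmetric])

lemma clim_norm:
  assumes "clim A s l"
  shows "(\<lambda>n. cnorm A (s n)) \<longlonglongrightarrow> cnorm A l"
proof -
  note * = clim_D[OF assms]
  have "norm (cnorm A (s n) - cnorm A l) \<le> cnorm A (s n \<ominus> l)" for n
    using * norm_le_minus[of "s n" l] norm_le_minus[of l "s n"] norm_minus_comm[of l "s n"]
    by (simp add: abs_le_iff)
  then have "(\<lambda>n. cnorm A (s n) - cnorm A l) \<longlonglongrightarrow> 0"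
    by (intro Lim_null_comparison[OF _ *(3)]) auto
  then show ?thesis
    by (simp add: LIM_zero_iff)
qed

lemma clim_norm_le:
  assumes "clim A s l" "\<And>n. cnorm A (s n) \<le> C"
  shows "cnorm A l \<le> C"
  using LIMSEQ_le_const2[OF clim_norm[OF assms(1)]] assms(2) by blast

lemma clim_mult:
  assumes "clim A s l" "clim A t m"
  shows "clim A (\<lambda>n. s n \<otimes> t n) (l \<otimes> m)"
proof -
  note * = clim_D[OF assms(1)] clim_D[OF assms(2)]
  show ?thesis
  proof (rule clim_dominated)
    fix n
    have "s n \<otimes> t n \<ominus> l \<otimes> m = s n \<otimes> (t n \<ominus> m) \<oplus> (s n \<ominus> l) \<otimes> m"
      using * minus_trans[of "s n \<otimes> t n" "s n \<otimes> m" "l \<otimes> m"] by (simp add: l_minus r_minus)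
    then have "cnorm A (s n \<otimes> t n \<ominus> l \<otimes> m) \<le> cnorm A (s n \<otimes> (t n \<ominus> m)) + cnorm A ((s n \<ominus> l) \<otimes> m)"
      using * norm_add by simp
    also have "\<dots> \<le> cnorm A (s n) * cnorm A (t n \<ominus> m) + cnorm A (s n \<ominus> l) * cnorm A m"
      by (intro add_mono norm_prod) (use * in auto)
    finally show "cnorm A (s n \<otimes> t n \<ominus> l \<otimes> m) \<le> \<dots>" .
  next
    show "(\<lambda>n. cnorm A (s n) * cnorm A (t n \<ominus> m) + cnorm A (s n \<ominus> l) * cnorm A m) \<longlonglongrightarrow> 0"
      using tendsto_add[OF tendsto_mult[OF clim_norm[OF assms(1)] *(6)]
          tendsto_mult_right[OF *(3), of "cnorm A m"]] by simp
  qed (use * in auto)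
qed

end

locale banach_star = normed_star +
  assumes ccauchy_clim: "ccauchy A s \<Longrightarrow> \<exists>l. clim A s l"

text \<open>The involution is isometric because ||y||^2 = ||y^* y|| \<le> ||y^*|| ||y||, which is
  divided by ||y|| and applied to both x and its adjoint.\<close>

sublocale cstar_algebra \<subseteq> banach_star A
proof -
  have adj: "cnorm A (cadj A x) = cnorm A x" if x: "x \<in> carrier A" for x
  proof -
    have le: "cnorm A y \<le> cnorm A (cadj A y)" if y: "y \<in> carrier A" for y
    proof (cases "cnorm A y = 0")
      case True
      then show ?thesis using y norm_nonneg adj_closed by simp
    next
      case False
      have "cnorm A y * cnorm A y \<le> cnorm A (cadj A y) * cnorm A y"
        using y norm_mult[of "cadj A y" y] cstar_identity[of y] adj_closed
        by (simp add: power2_eq_square)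
      then show ?thesis using False norm_nonneg[OF y] by simp
    qed
    show ?thesis using le[of x] le[of "cadj A x"] x adj_adj adj_closed by fastforce
  qed
  interpret normed_star A
    by unfold_locales (fact zero_closed add_closed scale_closed mult_closed adj_closed add_assoc
      add_comm add_zero diff_self scale_add add_scale scale_scale scale_one mult_assoc
      distrib_right distrib_left scale_mult_left scale_mult_right adj_add adj_scale adj_mult
      adj_adj norm_nonneg norm_eq_zero norm_triangle norm_scale norm_mult adj)+
  show "banach_star A"
    by unfold_locales (use complete mcomplete_iff in blast)
qed

lemma cstar_algebraI:
  assumes "normed_star A"
    and "\<And>x. x \<in> carrier A \<Longrightarrow> cnorm A (cadj A x \<otimes>\<^bsub>A\<^esub> x) = (cnorm A x)\<^sup>2"
    and "\<And>s. ccauchy A s \<Longrightarrow> \<exists>l. clim A s l"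
  shows "cstar_algebra A"
proof -
  interpret normed_star A by fact
  have mc: "mcomplete"
    using assms(3) mcomplete_iff by blast
  show ?thesis
    by unfold_locales (fact zero_cl add_cl scale_cl mult_cl adj_cl a_assoc
      a_comm a_zero minus_self s_add add_s s_s s_one m_assoc r_distr l_distr s_mult_l s_mult_r
      adj_sum adj_s adj_prod adj_invol norm_ge_0 norm_0_iff norm_add norm_s norm_prod assms(2) mc)+
qed

section \<open>Square roots by power series\<close>

primrec cpow :: "'a cstar \<Rightarrow> 'a \<Rightarrow> nat \<Rightarrow> 'a" where
  "cpow A x 0 = \<one>\<^bsub>A\<^esub>"
| "cpow A x (Suc n) = x \<otimes>\<^bsub>A\<^esub> cpow A x n"

lemma cunit_unique: "cunit A e \<Longrightarrow> cunit A f \<Longrightarrow> e = f"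
  unfolding cunit_def by metis

lemma cone_eq: "cunit A e \<Longrightarrow> \<one>\<^bsub>A\<^esub> = e"
  unfolding cone_def by (rule the_equality) (auto intro: cunit_unique)

lemma cunit_cone: "cunital A \<Longrightarrow> cunit A \<one>\<^bsub>A\<^esub>"
  using cone_eq[of A] unfolding cunital_def by fastforce

section \<open>Polynomials with nonnegative coefficients\<close>

definition nonneg_coeffs :: "real poly \<Rightarrow> bool" where
  "nonneg_coeffs p \<longleftrightarrow> (\<forall>k. coeff p k \<ge> 0)"

lemma nonneg_coeffs_add: "nonneg_coeffs p \<Longrightarrow> nonneg_coeffs q \<Longrightarrow> nonneg_coeffs (p + q)"
  by (simp add: nonneg_coeffs_def)

lemma nonneg_coeffs_mult: "nonneg_coeffs p \<Longrightarrow> nonneg_coeffs q \<Longrightarrow> nonneg_coeffs (p * q)"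
  by (simp add: nonneg_coeffs_def coeff_mult sum_nonneg)

lemma nonneg_coeffs_smult: "nonneg_coeffs p \<Longrightarrow> c \<ge> 0 \<Longrightarrow> nonneg_coeffs (smult c p)"
  by (simp add: nonneg_coeffs_def)

lemma nonneg_coeffs_pCons: "nonneg_coeffs (pCons a p) \<longleftrightarrow> a \<ge> 0 \<and> nonneg_coeffs p"
  unfolding nonneg_coeffs_def by (metis coeff_pCons_0 coeff_pCons_Suc not0_implies_Suc)

lemma nonneg_coeffs_power: "nonneg_coeffs p \<Longrightarrow> nonneg_coeffs (p ^ k)"
proof (induction k)
  case 0
  then show ?case by (simp add: nonneg_coeffs_def)
qed (simp add: nonneg_coeffs_mult)

lemma nonneg_coeffs_poly: "nonneg_coeffs p \<Longrightarrow> poly p 1 \<ge> 0"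
  unfolding poly_altdef nonneg_coeffs_def by (simp add: sum_nonneg)

text \<open>The iteration \<open>y \<mapsto> (x + y\<^sup>2) / 2\<close>, whose limit is \<open>1 - sqrt (1 - x)\<close>.\<close>
primrec root_poly :: "nat \<Rightarrow> real poly" where
  "root_poly 0 = 0"
| "root_poly (Suc n) = smult (1/2) ([:0, 1:] + root_poly n * root_poly n)"

lemma nonneg_root_poly: "nonneg_coeffs (root_poly n)"
proof (induction n)
  case 0
  then show ?case by (simp add: nonneg_coeffs_def)
next
  case (Suc n)
  have "nonneg_coeffs [:0, 1:]"
    by (simp add: nonneg_coeffs_pCons) (simp add: nonneg_coeffs_def)
  then show ?case
    using Suc by (auto intro!: nonneg_coeffs_smult nonneg_coeffs_add nonneg_coeffs_mult)
qed

text \<open>Consecutive iterates satisfy a^2 - b^2 = (a - b)(a + b), and products and sums keep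
  coefficients nonnegative.\<close>

lemma nonneg_root_poly_Suc: "nonneg_coeffs (root_poly (Suc n) - root_poly n)"
proof (induction n)
  case 0
  show ?case
    by (simp add: nonneg_coeffs_pCons) (simp add: nonneg_coeffs_def)
next
  case (Suc n)
  let ?a = "root_poly (Suc n)" and ?b = "root_poly n"
  have "root_poly (Suc (Suc n)) - ?a
      = smult (1/2) ([:0, 1:] + ?a * ?a) - smult (1/2) ([:0, 1:] + ?b * ?b)"
    by simp
  also have "\<dots> = smult (1/2) ((?a - ?b) * (?a + ?b))"
    by (simp only: smult_diff_right[symmetric]) (simp add: algebra_simps del: root_poly.simps)
  also have "nonneg_coeffs \<dots>"
    using Suc by (intro nonneg_coeffs_smult nonneg_coeffs_mult nonneg_coeffs_add nonneg_root_poly) auto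
  finally show ?case .
qed

lemma nonneg_root_poly_diff: "n \<le> m \<Longrightarrow> nonneg_coeffs (root_poly m - root_poly n)"
proof (induction m rule: dec_induct)
  case base
  then show ?case by (simp add: nonneg_coeffs_def)
next
  case (step m)
  then show ?case
    using nonneg_coeffs_add[OF nonneg_root_poly_Suc[of m] step.IH] by simp
qed

text \<open>At the point 1 the recursion is t \<mapsto> (1 + t^2) / 2, which maps [0, 1] into
  itself. This bounds the increasing real sequence that controls the norms in
  \<open>sqrt_exists\<close>.\<close>

lemma root_poly_le_1: "poly (root_poly n) 1 \<le> 1"
proof (induction n)
  case (Suc n)
  then show ?case
    using mult_le_one[OF Suc nonneg_coeffs_poly[OF nonneg_root_poly] Suc] by simp
qed simp

section \<open>Polynomials in an element and the limit of the iteration\<close>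

locale unital_banach_star = banach_star +
  assumes unital: "cunital A"
begin

lemma one_cl [simp, intro]: "\<one> \<in> carrier A"
  and one_m [simp]: "x \<in> carrier A \<Longrightarrow> \<one> \<otimes> x = x"
  and m_one [simp]: "x \<in> carrier A \<Longrightarrow> x \<otimes> \<one> = x"
  using cunit_cone[OF unital] unfolding cunit_def by auto

lemma adj_one [simp]: "cadj A \<one> = \<one>"
  by (metis adj_cl adj_invol adj_prod m_one one_cl)

lemma cpow_cl [simp, intro]: "x \<in> carrier A \<Longrightarrow> cpow A x n \<in> carrier A"
  by (induction n) auto

lemma cpow_commute:
  assumes "x \<in> carrier A" "y \<in> carrier A" "y \<otimes> x = x \<otimes> y"
  shows "y \<otimes> cpow A x n = cpow A x n \<otimes> y"
proof (induction n)
  case (Suc n)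
  then show ?case
    using assms m_swap[of y x "cpow A x n"] by (simp add: m_assoc)
qed (use assms in auto)

lemma cpow_Suc2: "x \<in> carrier A \<Longrightarrow> cpow A x (Suc n) = cpow A x n \<otimes> x"
  using cpow_commute[of x x] by simp

lemma cpow_adj: "x \<in> carrier A \<Longrightarrow> cadj A x = x \<Longrightarrow> cadj A (cpow A x n) = cpow A x n"
  by (induction n) (simp_all add: adj_prod cpow_Suc2[simplified])

lemma cpow_mult_add: "x \<in> carrier A \<Longrightarrow> cpow A x (m + n) = cpow A x m \<otimes> cpow A x n"
  by (induction m) (simp_all add: m_assoc)

text \<open>Horner evaluation, with constants read as multiples of the unit. Real coefficients keep
  a self-adjoint argument self-adjoint, see \<open>evp_adj\<close>.\<close>

definition evp :: "'a \<Rightarrow> real poly \<Rightarrow> 'a" where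
  "evp x p = fold_coeffs (\<lambda>a y. complex_of_real a \<odot> \<one> \<oplus> x \<otimes> y) p \<zero>"

lemma evp_0 [simp]: "evp x 0 = \<zero>"
  by (simp add: evp_def)

lemma evp_pCons:
  assumes "x \<in> carrier A"
  shows "evp x (pCons a p) = complex_of_real a \<odot> \<one> \<oplus> x \<otimes> evp x p"
  using assms by (cases "p = 0 \<and> a = 0") (auto simp: evp_def)

lemma evp_cl [simp, intro]: "x \<in> carrier A \<Longrightarrow> evp x p \<in> carrier A"
  by (induction p) (simp_all add: evp_pCons)

lemma evp_add: "x \<in> carrier A \<Longrightarrow> evp x (p + q) = evp x p \<oplus> evp x q"
proof (induction p q rule: poly_induct2)
  case (pCons a p b q)
  then show ?case
    by (simp add: evp_pCons l_distr add_s a_ac)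
qed simp

lemma evp_smult: "x \<in> carrier A \<Longrightarrow> evp x (smult c p) = complex_of_real c \<odot> evp x p"
  by (induction p) (simp_all add: evp_pCons s_add)

lemma evp_minus: "x \<in> carrier A \<Longrightarrow> evp x (p - q) = evp x p \<ominus> evp x q"
  using evp_add[of x p "smult (-1) q"] evp_smult[of x "-1" q] by (simp add: cdiff_def)

lemma evp_mult: "x \<in> carrier A \<Longrightarrow> evp x (p * q) = evp x p \<otimes> evp x q"
  by (induction p) (simp_all add: evp_pCons evp_add evp_smult r_distr m_assoc)

lemma evp_power: "x \<in> carrier A \<Longrightarrow> evp x (p ^ k) = cpow A (evp x p) k"
proof (induction k)
  case 0
  then show ?case using evp_pCons[of x 1 0] by (simp add: one_pCons)
qed (simp add: evp_mult)

lemma evp_commute: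
  assumes "x \<in> carrier A" "y \<in> carrier A" "y \<otimes> x = x \<otimes> y"
  shows "y \<otimes> evp x p = evp x p \<otimes> y"
proof (induction p)
  case (pCons a p)
  have "y \<otimes> (x \<otimes> evp x p) = x \<otimes> evp x p \<otimes> y"
    using assms pCons(2) m_swap[of y x "evp x p"] by (simp add: m_assoc)
  then show ?case
    using assms by (simp add: evp_pCons l_distr r_distr)
qed (use assms in auto)

lemma evp_adj:
  assumes "x \<in> carrier A" "cadj A x = x"
  shows "cadj A (evp x p) = evp x p"
proof (induction p)
  case (pCons a p)
  then show ?case
    using assms evp_commute[of x x p] by (simp add: evp_pCons adj_sum adj_prod)
qed simp

text \<open>The triangle inequality bounds the norm by the sum of the a_k ||x^k||, and
  \<open>poly p 1\<close> is the sum of the coefficients a_k.\<close>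

lemma norm_evp_le:
  assumes x: "x \<in> carrier A" and C: "\<And>k. cnorm A (cpow A x k) \<le> C" and p: "nonneg_coeffs p"
  shows "cnorm A (evp x p) \<le> C * poly p 1"
proof -
  \<comment> \<open>The power in front makes the induction go through: each Horner step moves one
    factor x into it, so that the bound C is used once per coefficient and never multiplied.\<close>
  have "cnorm A (cpow A x j \<otimes> evp x p) \<le> C * poly p 1" for j
    using p
  proof (induction p arbitrary: j)
    case (pCons a p)
    then have a: "a \<ge> 0" and p: "nonneg_coeffs p" by (auto simp: nonneg_coeffs_pCons)
    have "cpow A x j \<otimes> (x \<otimes> evp x p) = cpow A x (Suc j) \<otimes> evp x p"
      using x by (simp only: cpow_Suc2 m_assoc cpow_cl evp_cl)
    then have "cpow A x j \<otimes> evp x (pCons a p)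
        = complex_of_real a \<odot> cpow A x j \<oplus> cpow A x (Suc j) \<otimes> evp x p"
      using x by (simp add: evp_pCons l_distr del: cpow.simps)
    then have "cnorm A (cpow A x j \<otimes> evp x (pCons a p))
        \<le> a * cnorm A (cpow A x j) + cnorm A (cpow A x (Suc j) \<otimes> evp x p)"
      using x a norm_add[of "complex_of_real a \<odot> cpow A x j" "cpow A x (Suc j) \<otimes> evp x p"]
      by (simp add: norm_s del: cpow.simps)
    also have "\<dots> \<le> a * C + C * poly p 1"
      by (intro add_mono mult_left_mono C a pCons.IH p)
    finally show ?case by (simp add: algebra_simps)
  qed (use x in simp)
  from this[of 0] show ?thesis using x by simp
qed

text \<open>Power boundedness, rather than \<open>norm x \<le> 1\<close>, is what the absolutely convergent series
  needs; it does not depend on the choice of an equivalent norm.\<close>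
lemma sqrt_exists:
  assumes x: "x \<in> carrier A" "cadj A x = x" and C: "\<And>k. cnorm A (cpow A x k) \<le> C"
  obtains y where "y \<in> carrier A" "cadj A y = y" "\<And>k. cnorm A (cpow A y k) \<le> C"
    "(\<one> \<ominus> y) \<otimes> (\<one> \<ominus> y) = \<one> \<ominus> x"
    "\<And>z. z \<in> carrier A \<Longrightarrow> z \<otimes> x = x \<otimes> z \<Longrightarrow> z \<otimes> y = y \<otimes> z"
proof -
  define s where "s n = evp x (root_poly n)" for n
  define r where "r n = poly (root_poly n) 1" for n
  have C0: "C \<ge> 0" using order_trans[OF norm_ge_0 C[of 0]] x(1) by auto
  have s_cl: "s n \<in> carrier A" for n using x by (simp add: s_def)
  \<comment> \<open>A difference of iterates is again, up to sign, a polynomial with nonnegative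
    coefficients, so the bounded monotone sequence \<open>r\<close> makes \<open>s\<close>
    Cauchy.\<close>
  have diff: "cnorm A (s m \<ominus> s n) \<le> C * \<bar>r m - r n\<bar>" for m n
  proof -
    have *: "cnorm A (s m \<ominus> s n) \<le> C * (r m - r n)" if "n \<le> m" for m n
      using norm_evp_le[OF x(1) C nonneg_root_poly_diff[OF that]] x by (simp add: evp_minus s_def r_def)
    have le: "r n \<le> r m" if "n \<le> m" for m n
      using nonneg_coeffs_poly[OF nonneg_root_poly_diff[OF that]] by (simp add: r_def)
    show ?thesis
      using *[of m n] *[of n m] le[of m n] le[of n m] norm_minus_comm[OF s_cl s_cl, of m n]
      by (cases "n \<le> m") auto
  qed
  have "incseq r"
    using nonneg_coeffs_poly[OF nonneg_root_poly_Suc] by (auto simp: r_def intro!: incseq_SucI)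
  then have "Cauchy r"
    using incseq_convergent[of r 1] root_poly_le_1 by (metis LIMSEQ_imp_Cauchy r_def)
  have "ccauchy A s"
    unfolding ccauchy_def
  proof (intro conjI allI impI s_cl)
    fix e :: real assume "e > 0"
    then obtain k where k: "\<bar>r m - r n\<bar> < e / (C + 1)" if "m \<ge> k" "n \<ge> k" for m n
      using \<open>Cauchy r\<close> C0 unfolding Cauchy_def dist_real_def
      by (metis add_nonneg_pos divide_pos_pos zero_less_one)
    have "cnorm A (s m \<ominus> s n) < e" if "m \<ge> k" "n \<ge> k" for m n
    proof -
      have "cnorm A (s m \<ominus> s n) \<le> (C + 1) * \<bar>r m - r n\<bar>"
        using diff[of m n] by (simp add: algebra_simps)
      also have "\<dots> < e" using k[OF that] C0 by (simp add: field_simps)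
      finally show ?thesis .
    qed
    then show "\<exists>k. \<forall>m\<ge>k. \<forall>n\<ge>k. cnorm A (s m \<ominus> s n) < e" by blast
  qed
  then obtain y where y: "clim A s y" using ccauchy_clim by blast
  then have y_cl: "y \<in> carrier A" by (rule clim_D)
  have pow: "clim A (\<lambda>n. cpow A (s n) k) (cpow A y k)" for k
    by (induction k) (auto intro: clim_const clim_mult y)
  \<comment> \<open>Keeping the same C for the powers of y allows the construction to be iterated,
    as \<open>neg_part_exists\<close> does. The polynomial here is a power of an iterate, of value
    at most 1 at the point 1.\<close>
  have powC: "cnorm A (cpow A (s n) k) \<le> C" for n k
  proof -
    have "cnorm A (cpow A (s n) k) \<le> C * r n ^ k"
      using norm_evp_le[OF x(1) C nonneg_coeffs_power[OF nonneg_root_poly], of n k] x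
      by (simp add: evp_power s_def r_def)
    also have "\<dots> \<le> C"
      using C0 root_poly_le_1[of n] nonneg_coeffs_poly[OF nonneg_root_poly, of n]
      by (intro mult_left_le) (auto simp: r_def power_le_one)
    finally show ?thesis .
  qed
  have "s (Suc n) = (1/2) \<odot> (x \<oplus> s n \<otimes> s n)" for n
    using x by (simp add: s_def evp_smult evp_add evp_mult evp_pCons)
  moreover have "clim A (\<lambda>n. (1/2) \<odot> (x \<oplus> s n \<otimes> s n)) ((1/2) \<odot> (x \<oplus> y \<otimes> y))"
    using y x by (intro clim_scale clim_add clim_mult clim_const) auto
  ultimately have "clim A (\<lambda>n. s (Suc n)) ((1/2) \<odot> (x \<oplus> y \<otimes> y))"
    by simp
  \<comment> \<open>The limit solves 2 y = x + y^2, which is (1 - y)^2 = 1 - x expanded.\<close>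
  then have fix_y: "y = (1/2) \<odot> (x \<oplus> y \<otimes> y)"
    by (rule clim_unique[OF clim_Suc[OF y]])
  show ?thesis
  proof
    show "cadj A y = y"
    proof (rule clim_unique[OF clim_adj[OF y]])
      show "clim A (\<lambda>n. cadj A (s n)) y"
        using y evp_adj[OF x] by (simp add: s_def[abs_def])
    qed
    show "cnorm A (cpow A y k) \<le> C" for k
      using clim_norm_le[OF pow powC] .
    have "y \<oplus> y = 2 \<odot> y" using y_cl add_s[of y 1 1] by simp
    also have "\<dots> = 2 \<odot> ((1/2) \<odot> (x \<oplus> y \<otimes> y))"
      using fix_y by (rule arg_cong)
    also have "\<dots> = x \<oplus> y \<otimes> y"
      using x y_cl by simp
    finally have yy: "y \<oplus> y = x \<oplus> y \<otimes> y" .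
    have "(\<one> \<ominus> y) \<otimes> (\<one> \<ominus> y) = \<one> \<oplus> (-1) \<odot> (y \<oplus> y) \<oplus> y \<otimes> y"
      using y_cl by (simp add: cdiff_def l_distr r_distr s_add a_ac)
    also have "\<dots> = \<one> \<ominus> x"
      using y_cl x by (simp only: yy) (simp add: cdiff_def s_add a_ac)
    finally show "(\<one> \<ominus> y) \<otimes> (\<one> \<ominus> y) = \<one> \<ominus> x" .
    fix z assume z: "z \<in> carrier A" "z \<otimes> x = x \<otimes> z"
    have "clim A (\<lambda>n. z \<otimes> s n) (z \<otimes> y)" "clim A (\<lambda>n. s n \<otimes> z) (y \<otimes> z)"
      using z y by (auto intro: clim_mult clim_const)
    moreover have "z \<otimes> s n = s n \<otimes> z" for n
      using evp_commute[OF x(1) z] by (simp add: s_def)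
    ultimately show "z \<otimes> y = y \<otimes> z" using clim_unique by simp
  qed (fact y_cl)
qed

text \<open>Here \<open>h\<close> is the square root of the absolute value of \<open>T\<close> and \<open>N\<close> is twice its negative part.\<close>
lemma neg_part_exists:
  assumes T: "T \<in> carrier A" "cadj A T = T" and C: "\<And>k. cnorm A (cpow A (\<one> \<ominus> T \<otimes> T) k) \<le> C"
  obtains h N where "h \<in> carrier A" "N \<in> carrier A" "cadj A h = h" "cadj A N = N"
    "h \<otimes> N = N \<otimes> h" "T = h \<otimes> h \<ominus> N"
    "N \<otimes> (T \<otimes> N) = (-1) \<odot> ((h \<otimes> N) \<otimes> (h \<otimes> N))"
    "N \<otimes> N = 2 \<odot> (h \<otimes> (h \<otimes> N))"
proof -
  let ?x = "\<one> \<ominus> T \<otimes> T"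
  have x: "?x \<in> carrier A" "cadj A ?x = ?x"
    using T by (auto simp: adj_minus adj_prod)
  \<comment> \<open>As 1 - x = T^2, the root 1 - y is the absolute value |T|. A second root, 1 - y',
    is then h.\<close>
  obtain y where y: "y \<in> carrier A" "cadj A y = y" "\<And>k. cnorm A (cpow A y k) \<le> C"
    "(\<one> \<ominus> y) \<otimes> (\<one> \<ominus> y) = \<one> \<ominus> ?x"
    "\<And>z. z \<in> carrier A \<Longrightarrow> z \<otimes> ?x = ?x \<otimes> z \<Longrightarrow> z \<otimes> y = y \<otimes> z"
    using sqrt_exists[OF x C] by metis
  obtain y' where y': "y' \<in> carrier A" "cadj A y' = y'"
    "(\<one> \<ominus> y') \<otimes> (\<one> \<ominus> y') = \<one> \<ominus> y"
    "\<And>z. z \<in> carrier A \<Longrightarrow> z \<otimes> y = y \<otimes> z \<Longrightarrow> z \<otimes> y' = y' \<otimes> z"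
    using sqrt_exists[OF y(1-3)] by metis
  have Ty: "T \<otimes> y = y \<otimes> T"
    using y(5)[OF T(1)] T by (simp add: l_minus r_minus m_assoc)
  have Ty': "T \<otimes> y' = y' \<otimes> T"
    using y'(4)[OF T(1) Ty] .
  let ?g = "\<one> \<ominus> y" and ?h = "\<one> \<ominus> y'"
  let ?N = "?g \<ominus> T"
  have h: "?h \<in> carrier A" "cadj A ?h = ?h" and g: "?g \<in> carrier A" "cadj A ?g = ?g"
    using y y' by (auto simp: adj_minus)
  have hg: "?h \<otimes> ?h = ?g" using y' by simp
  have gg: "?g \<otimes> ?g = T \<otimes> T"
    unfolding y(4) using T by (simp add: cdiff_def s_add)
  have hT: "?h \<otimes> T = T \<otimes> ?h" and gT: "?g \<otimes> T = T \<otimes> ?g"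
    using Ty Ty' T y(1) y'(1) by (simp_all add: l_minus r_minus)
  have hgc: "?h \<otimes> ?g = ?g \<otimes> ?h"
    using h by (simp add: hg[symmetric] m_assoc)
  have N: "?N \<in> carrier A" "cadj A ?N = ?N" using g T by (auto simp: adj_minus)
  have hN: "?h \<otimes> ?N = ?N \<otimes> ?h"
    using h g T hT hgc by (simp add: l_minus r_minus)
  have gN: "?g \<otimes> ?N = T \<otimes> T \<ominus> T \<otimes> ?g" using h g T gg gT by (simp add: l_minus)
  \<comment> \<open>T(|T| - T) = -|T|(|T| - T) because |T|^2 = T^2: on its negative part T acts as
    -|T|.\<close>
  have TN: "T \<otimes> ?N = (-1) \<odot> (?g \<otimes> ?N)"
    unfolding gN using g T by (simp add: l_minus) (simp add: neg_minus[of "T \<otimes> ?g"])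
  have Ng: "?N \<otimes> ?g = ?g \<otimes> ?N" using g T gT by (simp add: l_minus r_minus)
  show ?thesis
  proof
    show "T = ?h \<otimes> ?h \<ominus> ?N"
      using T g by (simp add: hg) (simp add: cdiff_def s_add)
    have "?N \<otimes> (?g \<otimes> ?N) = (?h \<otimes> ?N) \<otimes> (?h \<otimes> ?N)"
    proof -
      have "(?h \<otimes> ?N) \<otimes> (?h \<otimes> ?N) = (?N \<otimes> ?h) \<otimes> (?h \<otimes> ?N)"
        by (simp only: hN)
      also have "\<dots> = ?N \<otimes> (?h \<otimes> ?h \<otimes> ?N)"
        using h N by (simp only: m_assoc mult_cl)
      finally show ?thesis by (simp only: hg)
    qed
    then show "?N \<otimes> (T \<otimes> ?N) = (-1) \<odot> ((?h \<otimes> ?N) \<otimes> (?h \<otimes> ?N))"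
      using N g by (simp add: TN)
    have "?N \<otimes> ?N = ?g \<otimes> ?N \<ominus> T \<otimes> ?N" using N g T by (simp add: r_minus)
    also have "\<dots> = 2 \<odot> (?g \<otimes> ?N)"
      using N g add_s[of "?g \<otimes> ?N" 1 1] by (simp only: TN) (simp add: cdiff_def)
    also have "?g \<otimes> ?N = ?h \<otimes> (?h \<otimes> ?N)"
      using h N by (simp only: hg[symmetric] m_assoc)
    finally show "?N \<otimes> ?N = 2 \<odot> (?h \<otimes> (?h \<otimes> ?N))" .
  qed (use h N hN in auto)
qed

end

locale unital_cstar = cstar_algebra +
  assumes unital: "cunital A"

sublocale unital_cstar \<subseteq> unital_banach_star
  by unfold_locales (rule unital)

section \<open>The positive cone of a unital \<open>C\<^sup>*\<close>-algebra\<close>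

text \<open>For q = 1 + d with d > 0, squaring Bernoulli's inequality gives growth at least
  quadratic in n = 2^j, which beats any linear bound. Exponents 2^j are the ones for which the
  C*-identity computes norms of self-adjoint powers.\<close>

lemma linear_growth_pow2:
  fixes q :: real
  assumes "\<And>j. q ^ (2 ^ j) \<le> 1 + L * 2 ^ j"
  shows "q \<le> 1"
proof (rule ccontr)
  assume "\<not> q \<le> 1"
  define d where "d = q - 1"
  have d: "d > 0" using \<open>\<not> q \<le> 1\<close> by (simp add: d_def)
  obtain j where j: "2 * L / d\<^sup>2 < 2 ^ j"
    using real_arch_pow[of 2 "2 * L / d\<^sup>2"] by auto
  define n :: nat where "n = 2 ^ j"
  have n: "2 * L < n * d\<^sup>2" "n > 0" using j d by (auto simp: n_def field_simps)
  have "1 + real n * d \<le> q ^ n"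
    using Bernoulli_inequality[of d n] d by (simp add: d_def)
  then have "(1 + real n * d)\<^sup>2 \<le> (q ^ n)\<^sup>2"
    using d by (intro power_mono) auto
  also have "\<dots> = q ^ (2 ^ Suc j)" by (simp add: n_def power_mult[symmetric] mult.commute)
  also have "\<dots> \<le> 1 + L * (2 * real n)" using assms[of "Suc j"] by (simp add: n_def)
  finally have "real n * (2 * d + n * d\<^sup>2) \<le> real n * (2 * L)"
    by (simp add: power2_eq_square algebra_simps)
  then have "2 * d + n * d\<^sup>2 \<le> 2 * L" using n(2) by simp
  then show False using n d by simp
qed

context unital_cstar
begin

text \<open>Only an inequality, since the unit of the zero algebra has norm 0.\<close>

lemma norm_one_le: "cnorm A \<one> \<le> 1"
proof -
  have "cnorm A \<one> * cnorm A \<one> = cnorm A \<one>"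
    using cstar_identity[of \<one>] by (simp add: power2_eq_square)
  then show ?thesis by (metis mult_cancel_right1 order_refl zero_le_one)
qed

lemma norm_square: "x \<in> carrier A \<Longrightarrow> cadj A x = x \<Longrightarrow> cnorm A (x \<otimes> x) = (cnorm A x)\<^sup>2"
  using cstar_identity[of x] by simp

lemma star_mult_eq_0: "x \<in> carrier A \<Longrightarrow> cadj A x \<otimes> x = \<zero> \<longleftrightarrow> x = \<zero>"
  using cstar_identity[of x] by (auto simp: norm_0_iff)

lemma norm_cpow_le:
  assumes "x \<in> carrier A" "cnorm A x \<le> 1"
  shows "cnorm A (cpow A x k) \<le> 1"
proof (induction k)
  case (Suc k)
  have "cnorm A (cpow A x (Suc k)) \<le> cnorm A x * cnorm A (cpow A x k)"
    using assms norm_prod by simp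
  also have "\<dots> \<le> 1" using assms Suc by (intro mult_le_one) auto
  finally show ?case .
qed (simp add: norm_one_le)

text \<open>As r and h commute, u = r + i h satisfies u^* u = r^2 + h^2, and its imaginary part h
  has norm at most ||u||. This stands in for monotonicity of the norm on positive elements.\<close>

lemma norm_sum_squares:
  assumes r: "r \<in> carrier A" "cadj A r = r" and h: "h \<in> carrier A" "cadj A h = h"
    and rh: "r \<otimes> h = h \<otimes> r"
  shows "(cnorm A h)\<^sup>2 \<le> cnorm A (r \<otimes> r \<oplus> h \<otimes> h)"
proof -
  define u where "u = r \<oplus> \<i> \<odot> h"
  have u: "u \<in> carrier A" using r h by (simp add: u_def)
  have us: "cadj A u = r \<oplus> (- \<i>) \<odot> h" using r h by (simp add: u_def adj_sum)
  have "cadj A u \<otimes> u = r \<otimes> r \<oplus> (\<i> \<odot> (r \<otimes> h) \<oplus> ((- \<i>) \<odot> (r \<otimes> h) \<oplus> h \<otimes> h))"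
    unfolding us using r h by (simp add: u_def l_distr r_distr rh s_add a_ac)
  also have "\<dots> = r \<otimes> r \<oplus> h \<otimes> h" using r h by (simp add: add_s2)
  finally have uu: "(cnorm A u)\<^sup>2 = cnorm A (r \<otimes> r \<oplus> h \<otimes> h)"
    using cstar_identity[OF u] by simp
  have "u \<ominus> cadj A u = \<i> \<odot> h \<oplus> \<i> \<odot> h"
    unfolding us using r h by (simp add: u_def cdiff_def s_add a_ac)
  then have "u \<ominus> cadj A u = (2 * \<i>) \<odot> h"
    using h add_s[of h "\<i>" "\<i>"] by simp
  then have "2 * cnorm A h = cnorm A (u \<ominus> cadj A u)"
    using h by (simp add: norm_s norm_mult)
  also have "\<dots> \<le> 2 * cnorm A u"
    using norm_minus_le[of u "cadj A u"] u by simp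
  finally have "cnorm A h \<le> cnorm A u" by simp
  then show ?thesis using uu h by (metis norm_ge_0 power_mono)
qed

text \<open>1 - T^2 has a self-adjoint root R commuting with T, and ||R||^2 \<le> ||T^2 + R^2|| =
  ||1||.\<close>

lemma norm_one_minus_square:
  assumes T: "T \<in> carrier A" "cadj A T = T" "cnorm A T \<le> 1"
  shows "cnorm A (\<one> \<ominus> T \<otimes> T) \<le> 1"
proof -
  have x: "T \<otimes> T \<in> carrier A" "cadj A (T \<otimes> T) = T \<otimes> T" "cnorm A (T \<otimes> T) \<le> 1"
    using T by (auto simp: adj_prod norm_square power_le_one)
  obtain y where y: "y \<in> carrier A" "cadj A y = y" 
    "(\<one> \<ominus> y) \<otimes> (\<one> \<ominus> y) = \<one> \<ominus> T \<otimes> T"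
    "\<And>z. z \<in> carrier A \<Longrightarrow> z \<otimes> (T \<otimes> T) = (T \<otimes> T) \<otimes> z \<Longrightarrow> z \<otimes> y = y \<otimes> z"
    using sqrt_exists[OF x(1,2) norm_cpow_le[OF x(1,3)]] by metis
  have Ty: "T \<otimes> y = y \<otimes> T" using y(4)[OF T(1)] T by (simp add: m_assoc)
  have R: "\<one> \<ominus> y \<in> carrier A" "cadj A (\<one> \<ominus> y) = \<one> \<ominus> y"
    using y(1,2) by (auto simp: adj_minus)
  have "(cnorm A (\<one> \<ominus> y))\<^sup>2 \<le> cnorm A (T \<otimes> T \<oplus> (\<one> \<ominus> y) \<otimes> (\<one> \<ominus> y))"
    by (rule norm_sum_squares) (use T R Ty y(1) in \<open>auto simp: l_minus r_minus\<close>)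
  also have "T \<otimes> T \<oplus> (\<one> \<ominus> y) \<otimes> (\<one> \<ominus> y) = \<one>"
    unfolding y(3) using T by (simp add: cdiff_def)
  finally show ?thesis
    using norm_square[OF R] norm_one_le y(3) by simp
qed

text \<open>Equivalent to \<open>a\<close> being self-adjoint with nonnegative spectrum.\<close>
definition pos :: "'a \<Rightarrow> bool" where
  "pos a \<longleftrightarrow> a \<in> carrier A \<and> cadj A a = a \<and>
     (\<exists>t\<ge>0. cnorm A (complex_of_real t \<odot> \<one> \<ominus> a) \<le> t)"

lemma pos_cl [simp]: "pos a \<Longrightarrow> a \<in> carrier A"
  and pos_adj: "pos a \<Longrightarrow> cadj A a = a"
  by (auto simp: pos_def)

lemma pos_zero [simp]: "pos \<zero>"
  unfolding pos_def by (auto intro!: exI[of _ 0])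

text \<open>The constants t simply add up; for elements of the form y^* y, closure under sums is far
  from evident. This is what the norm condition in \<open>pos\<close> buys.\<close>

lemma pos_add:
  assumes "pos a" "pos b"
  shows "pos (a \<oplus> b)"
proof -
  obtain s t where s: "s \<ge> 0" "cnorm A (complex_of_real s \<odot> \<one> \<ominus> a) \<le> s"
    and t: "t \<ge> 0" "cnorm A (complex_of_real t \<odot> \<one> \<ominus> b) \<le> t"
    using assms by (auto simp: pos_def)
  have "complex_of_real (s + t) \<odot> \<one> \<ominus> (a \<oplus> b)
      = (complex_of_real s \<odot> \<one> \<ominus> a) \<oplus> (complex_of_real t \<odot> \<one> \<ominus> b)"
    using assms by (simp add: cdiff_def s_add add_s a_ac)
  then have "cnorm A (complex_of_real (s + t) \<odot> \<one> \<ominus> (a \<oplus> b)) \<le> s + t"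
    using norm_add[of "complex_of_real s \<odot> \<one> \<ominus> a" "complex_of_real t \<odot> \<one> \<ominus> b"] s t assms
    by simp
  then show ?thesis
    unfolding pos_def using assms s t
    by (auto simp: adj_sum pos_adj intro!: exI[of _ "s + t"])
qed

lemma pos_scale:
  assumes "pos a" "c \<ge> 0"
  shows "pos (complex_of_real c \<odot> a)"
proof -
  obtain s where s: "s \<ge> 0" "cnorm A (complex_of_real s \<odot> \<one> \<ominus> a) \<le> s"
    using assms by (auto simp: pos_def)
  have "complex_of_real (c * s) \<odot> \<one> \<ominus> complex_of_real c \<odot> a
      = complex_of_real c \<odot> (complex_of_real s \<odot> \<one> \<ominus> a)"
    using assms by (simp add: s_minus)
  then have "cnorm A (complex_of_real (c * s) \<odot> \<one> \<ominus> complex_of_real c \<odot> a) \<le> c * s"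
    using s assms by (simp add: norm_s mult_left_mono)
  then show ?thesis
    unfolding pos_def using assms s by (auto simp: pos_adj intro!: exI[of _ "c * s"])
qed

lemma pos_square:
  assumes s: "s \<in> carrier A" "cadj A s = s"
  shows "pos (s \<otimes> s)"
proof (cases "s = \<zero>")
  case False
  define c where "c = cnorm A s"
  have c: "c > 0" using False s norm_0_iff[of s] norm_ge_0[of s] by (simp add: c_def less_le)
  define T where "T = complex_of_real (1/c) \<odot> s"
  have "cnorm A T \<le> 1" using c s by (simp add: T_def norm_s c_def norm_divide)
  then have "cnorm A (\<one> \<ominus> T \<otimes> T) \<le> 1"
    using s by (intro norm_one_minus_square) (auto simp: T_def)
  then have "pos (T \<otimes> T)"
    unfolding pos_def using s by (auto simp: T_def adj_prod intro!: exI[of _ 1])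
  then have "pos (complex_of_real (c * c) \<odot> (T \<otimes> T))"
    by (rule pos_scale) (use c in simp)
  moreover have "complex_of_real (c * c) \<odot> (T \<otimes> T) = s \<otimes> s"
    using s c by (simp add: T_def)
  ultimately show ?thesis by simp
qed simp

text \<open>Lets the constant t of \<open>pos\<close> be enlarged to a strictly positive one before
  dividing by it.\<close>

lemma pos_mono:
  assumes "a \<in> carrier A" "0 \<le> s" "s \<le> t" "cnorm A (complex_of_real s \<odot> \<one> \<ominus> a) \<le> s"
  shows "cnorm A (complex_of_real t \<odot> \<one> \<ominus> a) \<le> t"
proof -
  have "complex_of_real t \<odot> \<one> \<ominus> a
      = complex_of_real (t - s) \<odot> \<one> \<oplus> (complex_of_real s \<odot> \<one> \<ominus> a)"
    using assms add_s[of \<one> "complex_of_real (t - s)" "complex_of_real s"]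
    by (simp add: cdiff_def a_assoc[symmetric])
  then have "cnorm A (complex_of_real t \<odot> \<one> \<ominus> a)
      \<le> cnorm A (complex_of_real (t - s) \<odot> \<one>) + cnorm A (complex_of_real s \<odot> \<one> \<ominus> a)"
    using norm_add assms by simp
  also have "cnorm A (complex_of_real (t - s) \<odot> \<one>) \<le> t - s"
    using assms norm_one_le by (simp add: norm_s mult_left_le del: of_real_diff)
  finally show ?thesis using assms by simp
qed

text \<open>\<open>sqrt_exists\<close> is applied to x = 1 - a/t, of norm at most 1, and the root of
  a/t is rescaled. The last conclusion puts h into the bicommutant of a.\<close>

lemma pos_sqrt:
  assumes "pos a"
  obtains h where "h \<in> carrier A" "cadj A h = h" "h \<otimes> h = a"
    "\<And>z. z \<in> carrier A \<Longrightarrow> z \<otimes> a = a \<otimes> z \<Longrightarrow> z \<otimes> h = h \<otimes> z"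
proof -
  obtain s where s: "s \<ge> 0" "cnorm A (complex_of_real s \<odot> \<one> \<ominus> a) \<le> s"
    using assms by (auto simp: pos_def)
  have a: "a \<in> carrier A" "cadj A a = a" using assms by (auto simp: pos_adj)
  define t where "t = s + 1"
  have t: "t > 0" "cnorm A (complex_of_real t \<odot> \<one> \<ominus> a) \<le> t"
    using pos_mono[OF a(1) s(1) _ s(2), of t] s by (auto simp: t_def)
  define x where "x = \<one> \<ominus> complex_of_real (1/t) \<odot> a"
  have x: "x \<in> carrier A" "cadj A x = x" using a by (auto simp: x_def adj_minus)
  have "x = complex_of_real (1/t) \<odot> (complex_of_real t \<odot> \<one> \<ominus> a)"
    using a t by (simp add: x_def s_minus)
  then have "cnorm A x \<le> 1" using t a by (simp add: norm_s norm_divide)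
  then obtain y where y: "y \<in> carrier A" "cadj A y = y" 
    "(\<one> \<ominus> y) \<otimes> (\<one> \<ominus> y) = \<one> \<ominus> x"
    "\<And>z. z \<in> carrier A \<Longrightarrow> z \<otimes> x = x \<otimes> z \<Longrightarrow> z \<otimes> y = y \<otimes> z"
    using sqrt_exists[OF x norm_cpow_le[OF x(1)]] by metis
  define h where "h = complex_of_real (sqrt t) \<odot> (\<one> \<ominus> y)"
  show ?thesis
  proof
    show h: "h \<in> carrier A" "cadj A h = h" using y(1,2) by (auto simp: h_def adj_minus)
    have "h \<otimes> h = complex_of_real t \<odot> (\<one> \<ominus> x)"
      using y(1,3) x t by (simp add: h_def flip: of_real_mult)
    also have "\<one> \<ominus> x = complex_of_real (1/t) \<odot> a"
      using a by (simp add: x_def cdiff_def s_add)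
    finally show "h \<otimes> h = a" using t a by simp
    fix z assume z: "z \<in> carrier A" "z \<otimes> a = a \<otimes> z"
    then have "z \<otimes> y = y \<otimes> z"
      using y(4)[of z] a by (simp add: x_def l_minus r_minus)
    then show "z \<otimes> h = h \<otimes> z" using z y(1) by (simp add: h_def l_minus r_minus)
  qed
qed

text \<open>h commutes with a, hence with b by hypothesis, hence with r, which lies in the
  bicommutant of b.\<close>

lemma pos_sqrts_commute:
  assumes "pos a" "pos b" and ab: "\<And>z. z \<in> carrier A \<Longrightarrow> z \<otimes> a = a \<otimes> z \<Longrightarrow> z \<otimes> b = b \<otimes> z"
  obtains h r where "h \<in> carrier A" "cadj A h = h" "h \<otimes> h = a"
    "r \<in> carrier A" "cadj A r = r" "r \<otimes> r = b" "r \<otimes> h = h \<otimes> r"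
proof -
  obtain h where h: "h \<in> carrier A" "cadj A h = h" "h \<otimes> h = a"
    using pos_sqrt[OF assms(1)] by metis
  obtain r where r: "r \<in> carrier A" "cadj A r = r" "r \<otimes> r = b"
    and rc: "\<And>z. z \<in> carrier A \<Longrightarrow> z \<otimes> b = b \<otimes> z \<Longrightarrow> z \<otimes> r = r \<otimes> z"
    using pos_sqrt[OF assms(2)] by metis
  have "h \<otimes> a = a \<otimes> h" using h(1) by (simp add: h(3)[symmetric] m_assoc)
  then have "h \<otimes> r = r \<otimes> h" using rc ab h(1) by blast
  then show ?thesis using that h r by metis
qed

text \<open>Here b = -a, so the two roots commute and ||h||^2 \<le> ||b + a|| = 0: the cone contains
  no line.\<close>

lemma pos_proper:
  assumes "pos a" "pos b" "a \<oplus> b = \<zero>"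
  shows "a = \<zero>" "b = \<zero>"
proof -
  have b: "b = (- 1) \<odot> a"
    using neg_a2[of a b] assms by (metis a_zero pos_cl scale_cl)
  obtain h r where hr: "h \<in> carrier A" "cadj A h = h" "h \<otimes> h = a"
    "r \<in> carrier A" "cadj A r = r" "r \<otimes> r = b" "r \<otimes> h = h \<otimes> r"
    by (rule pos_sqrts_commute[OF assms(1,2)]) (use assms in \<open>auto simp: b\<close>)
  have "(cnorm A h)\<^sup>2 \<le> 0"
    using norm_sum_squares[of r h] hr(1,2,4,5,7) unfolding hr(3,6) a_comm[OF pos_cl[OF assms(2)] pos_cl[OF assms(1)]] assms(3)
    by simp
  then have "h = \<zero>" using norm_0_iff hr(1) by simp
  then show "a = \<zero>" using hr(3) by simp
  then show "b = \<zero>" using b by simp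
qed

text \<open>Roots h of a and r of 1 - a commute, so ||h||^2 \<le> ||(1 - a) + a|| \<le> 1.\<close>

lemma norm_le_1_if_pos:
  assumes "pos a" "pos (\<one> \<ominus> a)"
  shows "cnorm A a \<le> 1"
proof -
  obtain h r where hr: "h \<in> carrier A" "cadj A h = h" "h \<otimes> h = a"
    "r \<in> carrier A" "cadj A r = r" "r \<otimes> r = \<one> \<ominus> a" "r \<otimes> h = h \<otimes> r"
    by (rule pos_sqrts_commute[OF assms]) (use assms in \<open>auto simp: l_minus r_minus\<close>)
  have "(cnorm A h)\<^sup>2 \<le> cnorm A (r \<otimes> r \<oplus> h \<otimes> h)"
    using norm_sum_squares[of r h] hr(1,2,4,5,7) by simp
  also have "r \<otimes> r \<oplus> h \<otimes> h = \<one>" unfolding hr(3,6) using assms by (simp add: minus_add)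
  finally show ?thesis using norm_square[OF hr(1,2)] norm_one_le unfolding hr(3) by simp
qed

section \<open>Positivity of the elements x^* x\<close>

lemma norm_cpow2:
  assumes "x \<in> carrier A" "cadj A x = x"
  shows "cnorm A (cpow A x (2 ^ j)) = cnorm A x ^ (2 ^ j)"
proof (induction j)
  case 0
  then show ?case using assms by simp
next
  case (Suc j)
  have "cpow A x (2 ^ Suc j) = cpow A x (2 ^ j) \<otimes> cpow A x (2 ^ j)"
    using cpow_mult_add[OF assms(1), of "2 ^ j" "2 ^ j"] by (simp add: mult_2)
  then have "cnorm A (cpow A x (2 ^ Suc j)) = (cnorm A x ^ (2 ^ j))\<^sup>2"
    using norm_square[of "cpow A x (2 ^ j)"] cpow_adj[OF assms] assms Suc by simp
  then show ?case by (simp add: power_mult[symmetric] mult.commute)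
qed

text \<open>The powers of \<open>1 - z\<^sup>*z\<close> and of \<open>1 - zz\<^sup>*\<close> have comparable norms, by
  \<open>(1 - z\<^sup>*z)\<^sup>m = 1 - z\<^sup>*(\<Sum>i<m. (1 - zz\<^sup>*)\<^sup>i)z\<close>; this replaces the comparison of spectra.\<close>
lemma norm_one_minus_swap:
  assumes z: "z \<in> carrier A" and le: "cnorm A (\<one> \<ominus> z \<otimes> cadj A z) \<le> 1"
  shows "cnorm A (\<one> \<ominus> cadj A z \<otimes> z) \<le> 1"
proof -
  define a where "a = z \<otimes> cadj A z"
  define c where "c = cadj A z \<otimes> z"
  have a: "a \<in> carrier A" and c: "c \<in> carrier A" and zs: "cadj A z \<in> carrier A"
    using z by (auto simp: a_def c_def)
  have c': "\<one> \<ominus> c \<in> carrier A" "cadj A (\<one> \<ominus> c) = \<one> \<ominus> c"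
    using z by (auto simp: adj_minus adj_prod c_def)
  \<comment> \<open>G is the sum of the first m powers of 1 - z z^* and each of them has norm at
    most 1, whence the bound m. The factors z are kept outside so that the growth stays
    linear.\<close>
  have G: "\<exists>G\<in>carrier A. cnorm A G \<le> real m \<and> cpow A (\<one> \<ominus> c) m = \<one> \<ominus> cadj A z \<otimes> (G \<otimes> z)" for m
  proof (induction m)
    case 0
    show ?case using z by (auto intro!: bexI[of _ \<zero>])
  next
    case (Suc m)
    then obtain G where G: "G \<in> carrier A" "cnorm A G \<le> real m"
      "cpow A (\<one> \<ominus> c) m = \<one> \<ominus> cadj A z \<otimes> (G \<otimes> z)" by blast
    let ?H = "\<one> \<oplus> (\<one> \<ominus> a) \<otimes> G"
    have "cnorm A ?H \<le> cnorm A \<one> + cnorm A (\<one> \<ominus> a) * cnorm A G"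
      using norm_add[of \<one> "(\<one> \<ominus> a) \<otimes> G"] norm_prod[of "\<one> \<ominus> a" G] a G by simp
    also have "\<dots> \<le> 1 + 1 * real m"
      using norm_one_le le G(1,2) unfolding a_def[symmetric]
      by (intro add_mono mult_mono) auto
    finally have "cnorm A ?H \<le> real (Suc m)" by simp
    moreover have "cpow A (\<one> \<ominus> c) (Suc m) = \<one> \<ominus> cadj A z \<otimes> (?H \<otimes> z)"
      using z zs G(1)
      by (simp add: G(3)) (simp add: a_def c_def cdiff_def l_distr r_distr s_add m_assoc a_ac)
    ultimately show ?case using a G by (auto intro!: bexI[of _ ?H])
  qed
  have "cnorm A (\<one> \<ominus> c) ^ (2 ^ j) \<le> 1 + (cnorm A z)\<^sup>2 * 2 ^ j" for j
  proof -
    obtain G where G: "G \<in> carrier A" "cnorm A G \<le> real (2 ^ j)"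
      "cpow A (\<one> \<ominus> c) (2 ^ j) = \<one> \<ominus> cadj A z \<otimes> (G \<otimes> z)" using G by blast
    have "cnorm A (cadj A z \<otimes> (G \<otimes> z)) \<le> cnorm A z * cnorm A (G \<otimes> z)"
      using norm_prod[of "cadj A z" "G \<otimes> z"] z G(1) by simp
    also have "\<dots> \<le> cnorm A z * (cnorm A G * cnorm A z)"
      using norm_prod[of G z] z G(1) by (intro mult_left_mono) auto
    also have "\<dots> \<le> cnorm A z * (2 ^ j * cnorm A z)"
      using G(2) z by (intro mult_left_mono mult_right_mono) auto
    finally have "cnorm A (cpow A (\<one> \<ominus> c) (2 ^ j)) \<le> 1 + (cnorm A z)\<^sup>2 * 2 ^ j"
      using norm_minus_le[of \<one> "cadj A z \<otimes> (G \<otimes> z)"] norm_one_le G z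
      by (simp add: power2_eq_square mult_ac)
    then show ?thesis using norm_cpow2[OF c'] by simp
  qed
  then show ?thesis using linear_growth_pow2 unfolding c_def by blast
qed

text \<open>\<open>norm_one_minus_swap\<close> after z has been rescaled so that the constant in
  \<open>pos\<close> becomes 1; t = s + 1 keeps the divisor positive.\<close>

lemma pos_swap:
  assumes z: "z \<in> carrier A" and "pos (z \<otimes> cadj A z)"
  shows "pos (cadj A z \<otimes> z)"
proof -
  obtain s where s: "s \<ge> 0" "cnorm A (complex_of_real s \<odot> \<one> \<ominus> z \<otimes> cadj A z) \<le> s"
    using assms by (auto simp: pos_def)
  define t where "t = s + 1"
  have t: "t > 0" "cnorm A (complex_of_real t \<odot> \<one> \<ominus> z \<otimes> cadj A z) \<le> t"
    using pos_mono[OF _ s(1) _ s(2), of t] s z by (auto simp: t_def)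
  define w where "w = complex_of_real (1 / sqrt t) \<odot> z"
  have w: "w \<in> carrier A" using z by (simp add: w_def)
  have sq: "complex_of_real (1 / sqrt t) * complex_of_real (1 / sqrt t) = complex_of_real (1/t)"
    using t by (simp flip: of_real_mult)
  have ww: "w \<otimes> cadj A w = complex_of_real (1/t) \<odot> (z \<otimes> cadj A z)"
    "cadj A w \<otimes> w = complex_of_real (1/t) \<odot> (cadj A z \<otimes> z)"
    using z sq by (auto simp: w_def)
  have "\<one> \<ominus> w \<otimes> cadj A w
      = complex_of_real (1/t) \<odot> (complex_of_real t \<odot> \<one> \<ominus> z \<otimes> cadj A z)"
    using z t by (simp add: ww s_minus)
  then have "cnorm A (\<one> \<ominus> w \<otimes> cadj A w) \<le> 1"
    using t z by (simp add: norm_s norm_divide)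
  then have "cnorm A (\<one> \<ominus> cadj A w \<otimes> w) \<le> 1"
    by (rule norm_one_minus_swap[OF w])
  then have "pos (cadj A w \<otimes> w)"
    unfolding pos_def using w by (auto simp: adj_prod intro!: exI[of _ 1])
  then have "pos (complex_of_real t \<odot> (cadj A w \<otimes> w))"
    by (rule pos_scale) (use t in simp)
  then show ?thesis using t z by (simp add: ww)
qed

text \<open>The witnesses p and -q are the real and imaginary parts of z.\<close>

lemma sum_star_swap:
  assumes z: "z \<in> carrier A"
  obtains p q where "p \<in> carrier A" "cadj A p = p" "q \<in> carrier A" "cadj A q = q"
    "cadj A z \<otimes> z \<oplus> z \<otimes> cadj A z = 2 \<odot> (p \<otimes> p \<oplus> q \<otimes> q)"
proof
  let ?p = "(1/2) \<odot> (z \<oplus> cadj A z)" and ?q = "(\<i>/2) \<odot> (z \<ominus> cadj A z)"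
  show "?p \<in> carrier A" "?q \<in> carrier A" using z by auto
  show "cadj A ?p = ?p" using z by (simp add: adj_sum a_comm)
  show "cadj A ?q = ?q"
    using z by (simp add: adj_minus) (simp add: cdiff_def s_add a_comm)
  have pp: "?p \<otimes> ?p = (1/4) \<odot> ((z \<oplus> cadj A z) \<otimes> (z \<oplus> cadj A z))"
    and qq: "?q \<otimes> ?q = (1/4) \<odot> ((- 1) \<odot> ((z \<ominus> cadj A z) \<otimes> (z \<ominus> cadj A z)))"
    using z by simp_all
  have "(z \<oplus> cadj A z) \<otimes> (z \<oplus> cadj A z) \<oplus> (- 1) \<odot> ((z \<ominus> cadj A z) \<otimes> (z \<ominus> cadj A z))
     = 2 \<odot> (cadj A z \<otimes> z \<oplus> z \<otimes> cadj A z)"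
    using z add_s[of "cadj A z \<otimes> z" 1 1] add_s[of "z \<otimes> cadj A z" 1 1]
    by (simp add: cdiff_def l_distr r_distr s_add a_ac) (simp add: a_lcomm[of "z \<otimes> z"])
  then have "?p \<otimes> ?p \<oplus> ?q \<otimes> ?q = (1/4) \<odot> (2 \<odot> (cadj A z \<otimes> z \<oplus> z \<otimes> cadj A z))"
    unfolding pp qq using z by (simp only: s_add[symmetric] mult_cl add_cl adj_cl minus_cl scale_cl)
  then show "cadj A z \<otimes> z \<oplus> z \<otimes> cadj A z = 2 \<odot> (?p \<otimes> ?p \<oplus> ?q \<otimes> ?q)"
    using z by simp
qed

text \<open>Let N be the negative part of y^* y up to a scalar, and z = y N. Then z^* z = -b with b
  positive, so z z^* = 2(p^2 + q^2) + b is positive, and by \<open>pos_swap\<close> so is z^* z. As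
  the cone is proper, b = 0, which gives h N = 0, then N^2 = 2 h (h N) = 0 and N = 0.\<close>

lemma pos_star_mult:
  assumes y: "y \<in> carrier A"
  shows "pos (cadj A y \<otimes> y)"
proof (cases "y = \<zero>")
  case False
  define c where "c = (cnorm A y)\<^sup>2"
  have c: "c > 0" using False y norm_0_iff[of y] by (simp add: c_def)
  let ?a = "cadj A y \<otimes> y"
  define T where "T = complex_of_real (1/c) \<odot> ?a"
  have T: "T \<in> carrier A" "cadj A T = T" using y by (auto simp: T_def adj_prod)
  have "cnorm A T = 1" using y c cstar_identity[OF y] by (simp add: T_def norm_s norm_divide flip: c_def)
  then have "cnorm A (\<one> \<ominus> T \<otimes> T) \<le> 1" using norm_one_minus_square[OF T] by simp
  then have "cnorm A (cpow A (\<one> \<ominus> T \<otimes> T) k) \<le> 1" for k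
    using norm_cpow_le T by simp
  then obtain h N where hN: "h \<in> carrier A" "N \<in> carrier A" "cadj A h = h" "cadj A N = N"
    "h \<otimes> N = N \<otimes> h" "T = h \<otimes> h \<ominus> N"
    "N \<otimes> (T \<otimes> N) = (-1) \<odot> ((h \<otimes> N) \<otimes> (h \<otimes> N))"
    "N \<otimes> N = 2 \<odot> (h \<otimes> (h \<otimes> N))"
    using neg_part_exists[OF T] by metis
  define z where "z = y \<otimes> N"
  have z: "z \<in> carrier A" using y hN(2) by (simp add: z_def)
  have "cadj A z \<otimes> z = N \<otimes> (?a \<otimes> N)"
    using y hN(2,4) by (simp add: z_def adj_prod m_assoc)
  also have "?a = complex_of_real c \<odot> T" using c y by (simp add: T_def)
  also have "N \<otimes> (complex_of_real c \<odot> T \<otimes> N) = complex_of_real c \<odot> (N \<otimes> (T \<otimes> N))"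
    using hN(2) T(1) by simp
  finally have zz: "cadj A z \<otimes> z = (- 1) \<odot> (complex_of_real c \<odot> ((h \<otimes> N) \<otimes> (h \<otimes> N)))"
    unfolding hN(7) using hN(1,2) by (simp add: mult.commute)
  have hN': "h \<otimes> N \<in> carrier A" "cadj A (h \<otimes> N) = h \<otimes> N"
    using hN(1-5) by (auto simp: adj_prod)
  define b where "b = complex_of_real c \<odot> ((h \<otimes> N) \<otimes> (h \<otimes> N))"
  have b: "pos b" unfolding b_def using pos_scale[OF pos_square[OF hN']] c by simp
  obtain p q where pq: "p \<in> carrier A" "cadj A p = p" "q \<in> carrier A" "cadj A q = q"
    "cadj A z \<otimes> z \<oplus> z \<otimes> cadj A z = 2 \<odot> (p \<otimes> p \<oplus> q \<otimes> q)"
    using sum_star_swap[OF z] .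
  have "pos (complex_of_real 2 \<odot> (p \<otimes> p \<oplus> q \<otimes> q))"
    by (intro pos_scale pos_add pos_square pq) auto
  then have "pos (b \<oplus> (cadj A z \<otimes> z \<oplus> z \<otimes> cadj A z))"
    unfolding pq(5) using b pos_add by simp
  then have "pos (z \<otimes> cadj A z)"
    using z b unfolding zz b_def[symmetric] by simp
  then have "pos (cadj A z \<otimes> z)" by (rule pos_swap[OF z])
  moreover have "b \<oplus> cadj A z \<otimes> z = \<zero>"
    unfolding zz b_def[symmetric] using b by simp
  ultimately have "b = \<zero>" using pos_proper[OF b] by blast
  then have "(h \<otimes> N) \<otimes> (h \<otimes> N) = \<zero>"
    using c hN' norm_s[of "(h \<otimes> N) \<otimes> (h \<otimes> N)" "complex_of_real c"] by (simp add: b_def norm_0_iff)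
  then have "h \<otimes> N = \<zero>" using star_mult_eq_0[OF hN'(1)] hN'(2) by simp
  then have "N \<otimes> N = \<zero>" using hN by simp
  then have "N = \<zero>" using star_mult_eq_0[OF hN(2)] hN(4) by simp
  then have "pos T" using hN(6) pos_square[OF hN(1,3)] hN(1) by simp
  then have "pos (complex_of_real c \<odot> T)" by (rule pos_scale) (use c in simp)
  then show ?thesis using c y by (simp add: T_def)
qed simp

end

section \<open>Finite sums\<close>

context normed_star
begin

lemma csum_cl [simp, intro]: "(\<And>i. i < n \<Longrightarrow> f i \<in> carrier A) \<Longrightarrow> csum A f n \<in> carrier A"
  by (induction n) auto

lemma csum_cong: "(\<And>i. i < n \<Longrightarrow> f i = g i) \<Longrightarrow> csum A f n = csum A g n"
  by (induction n) auto

lemma csum_zero [simp]: "csum A (\<lambda>i. \<zero>) n = \<zero>"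
  by (induction n) auto

lemma csum_add:
  "(\<And>i. i < n \<Longrightarrow> f i \<in> carrier A) \<Longrightarrow> (\<And>i. i < n \<Longrightarrow> g i \<in> carrier A)
    \<Longrightarrow> csum A (\<lambda>i. f i \<oplus> g i) n = csum A f n \<oplus> csum A g n"
  by (induction n) (auto simp: a_ac)

lemma csum_scale:
  "(\<And>i. i < n \<Longrightarrow> f i \<in> carrier A) \<Longrightarrow> csum A (\<lambda>i. c \<odot> f i) n = c \<odot> csum A f n"
  by (induction n) (auto simp: s_add)

lemma csum_mult_l:
  "(\<And>i. i < n \<Longrightarrow> f i \<in> carrier A) \<Longrightarrow> x \<in> carrier A
    \<Longrightarrow> x \<otimes> csum A f n = csum A (\<lambda>i. x \<otimes> f i) n"
  by (induction n) (auto simp: l_distr)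

lemma csum_mult_r:
  "(\<And>i. i < n \<Longrightarrow> f i \<in> carrier A) \<Longrightarrow> x \<in> carrier A
    \<Longrightarrow> csum A f n \<otimes> x = csum A (\<lambda>i. f i \<otimes> x) n"
  by (induction n) (auto simp: r_distr)

lemma csum_adj:
  "(\<And>i. i < n \<Longrightarrow> f i \<in> carrier A) \<Longrightarrow> cadj A (csum A f n) = csum A (\<lambda>i. cadj A (f i)) n"
  by (induction n) (auto simp: adj_sum)

lemma csum_swap:
  "(\<And>i j. i < n \<Longrightarrow> j < m \<Longrightarrow> f i j \<in> carrier A)
    \<Longrightarrow> csum A (\<lambda>i. csum A (f i) m) n = csum A (\<lambda>j. csum A (\<lambda>i. f i j) n) m"
  by (induction n) (simp_all add: csum_add)

lemma norm_csum:
  "(\<And>i. i < n \<Longrightarrow> f i \<in> carrier A) \<Longrightarrow> cnorm A (csum A f n) \<le> (\<Sum>i<n. cnorm A (f i))"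
proof (induction n)
  case (Suc n)
  then show ?case using norm_add[of "csum A f n" "f n"] by fastforce
qed simp

lemma csum_single:
  "k < n \<Longrightarrow> f k \<in> carrier A \<Longrightarrow> (\<And>i. i < n \<Longrightarrow> i \<noteq> k \<Longrightarrow> f i = \<zero>) \<Longrightarrow> csum A f n = f k"
proof (induction n)
  case (Suc n)
  show ?case
  proof (cases "k = n")
    case True
    have "csum A f n = csum A (\<lambda>i. \<zero>) n" by (rule csum_cong) (use Suc True in auto)
    then show ?thesis using True Suc by simp
  next
    case False
    then show ?thesis using Suc by simp
  qed
qed simp

end

context unital_cstar
begin

lemma pos_csum: "(\<And>i. i < n \<Longrightarrow> pos (f i)) \<Longrightarrow> pos (csum A f n)"
  by (induction n) (auto intro: pos_add)

lemma pos_csum_eq_0: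
  "(\<And>i. i < n \<Longrightarrow> pos (f i)) \<Longrightarrow> csum A f n = \<zero> \<Longrightarrow> i < n \<Longrightarrow> f i = \<zero>"
proof (induction n)
  case (Suc n)
  then have "csum A f n = \<zero>" "f n = \<zero>"
    using pos_proper[of "csum A f n" "f n"] pos_csum[of n f] by auto
  then show ?case using Suc by (auto simp: less_Suc_eq)
qed simp

lemma csum_star_mult_eq_0:
  assumes "\<And>i. i < n \<Longrightarrow> y i \<in> carrier A" "csum A (\<lambda>i. cadj A (y i) \<otimes> y i) n = \<zero>" "i < n"
  shows "y i = \<zero>"
  using pos_csum_eq_0[of n "\<lambda>i. cadj A (y i) \<otimes> y i" i] assms
  by (auto simp: pos_star_mult star_mult_eq_0)

lemma pos_csum_ge:
  "(\<And>i. i < n \<Longrightarrow> pos (f i)) \<Longrightarrow> i < n \<Longrightarrow> pos (csum A f n \<ominus> f i)"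
proof (induction n)
  case (Suc n)
  show ?case
  proof (cases "i = n")
    case True
    have "csum A f (Suc n) \<ominus> f n = csum A f n"
      using Suc.prems by (simp add: cdiff_def a_assoc)
    then show ?thesis using True pos_csum Suc.prems by simp
  next
    case False
    then have "pos ((csum A f n \<ominus> f i) \<oplus> f n)" using Suc by (auto intro: pos_add)
    moreover have "csum A f (Suc n) \<ominus> f i = (csum A f n \<ominus> f i) \<oplus> f n"
      using Suc.prems by (simp add: cdiff_def a_ac)
    ultimately show ?thesis by simp
  qed
qed simp

text \<open>Meant for a column of a matrix Y: a positive diagonal entry of 1 - Y^* Y bounds each
  entry of that column. In 1 - y_i^* y_i the other summands are added back as positive
  terms.\<close>

lemma norm_le_1_if_csum:
  assumes y: "\<And>i. i < n \<Longrightarrow> y i \<in> carrier A"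
    and le: "pos (\<one> \<ominus> csum A (\<lambda>i. cadj A (y i) \<otimes> y i) n)" and i: "i < n"
  shows "cnorm A (y i) \<le> 1"
proof -
  let ?f = "\<lambda>i. cadj A (y i) \<otimes> y i"
  have f: "pos (?f i)" if "i < n" for i using y that pos_star_mult by simp
  have "\<one> \<ominus> ?f i = (\<one> \<ominus> csum A ?f n) \<oplus> (csum A ?f n \<ominus> ?f i)"
    using f i by (intro minus_trans) (auto simp: y)
  then have "pos (\<one> \<ominus> ?f i)"
    using pos_add[OF le pos_csum_ge[of n ?f i]] f i by simp
  then have "cnorm A (?f i) \<le> 1" using norm_le_1_if_pos f i by blast
  then show ?thesis
    using cstar_identity[OF y[OF i]] y[OF i] by (simp add: power_le_one_iff)
qed

end

section \<open>Matrix algebras\<close>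

text \<open>The norm is only equivalent to the \<open>C\<^sup>*\<close>-norm.\<close>
definition matalg :: "'a cstar \<Rightarrow> nat \<Rightarrow> (nat \<Rightarrow> nat \<Rightarrow> 'a) cstar" where
  "matalg A n =
    \<lparr>carrier = {X. (\<forall>i<n. \<forall>j<n. X i j \<in> carrier A) \<and> (\<forall>i j. \<not> (i < n \<and> j < n) \<longrightarrow> X i j = \<zero>\<^bsub>A\<^esub>)},
     czero = (\<lambda>i j. \<zero>\<^bsub>A\<^esub>),
     cadd = (\<lambda>X Y i j. X i j \<oplus>\<^bsub>A\<^esub> Y i j),
     cscale = (\<lambda>c X i j. c \<odot>\<^bsub>A\<^esub> X i j),
     cmult = (\<lambda>X Y i j. if i < n \<and> j < n then csum A (\<lambda>k. X i k \<otimes>\<^bsub>A\<^esub> Y k j) n else \<zero>\<^bsub>A\<^esub>),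
     cadj = (\<lambda>X i j. cadj A (X j i)),
     cnorm = (\<lambda>X. \<Sum>i<n. \<Sum>j<n. cnorm A (X i j))\<rparr>"

lemma matalg_sel:
  "\<zero>\<^bsub>matalg A n\<^esub> i j = \<zero>\<^bsub>A\<^esub>"
  "(X \<oplus>\<^bsub>matalg A n\<^esub> Y) i j = X i j \<oplus>\<^bsub>A\<^esub> Y i j"
  "(c \<odot>\<^bsub>matalg A n\<^esub> X) i j = c \<odot>\<^bsub>A\<^esub> X i j"
  "(X \<ominus>\<^bsub>matalg A n\<^esub> Y) i j = X i j \<ominus>\<^bsub>A\<^esub> Y i j"
  "i < n \<Longrightarrow> j < n \<Longrightarrow> (X \<otimes>\<^bsub>matalg A n\<^esub> Y) i j = csum A (\<lambda>k. X i k \<otimes>\<^bsub>A\<^esub> Y k j) n"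
  "cadj (matalg A n) X i j = cadj A (X j i)"
  "cnorm (matalg A n) X = (\<Sum>i<n. \<Sum>j<n. cnorm A (X i j))"
  by (simp_all add: matalg_def cdiff_def)

lemma matalg_mult_out: "\<not> (i < n \<and> j < n) \<Longrightarrow> (X \<otimes>\<^bsub>matalg A n\<^esub> Y) i j = \<zero>\<^bsub>A\<^esub>"
  by (auto simp: matalg_def)

lemma matalg_carrier:
  "X \<in> carrier (matalg A n) \<longleftrightarrow>
    (\<forall>i<n. \<forall>j<n. X i j \<in> carrier A) \<and> (\<forall>i j. \<not> (i < n \<and> j < n) \<longrightarrow> X i j = \<zero>\<^bsub>A\<^esub>)"
  by (simp add: matalg_def)

lemma (in normed_star) matalg_entry [simp]:
  "X \<in> carrier (matalg A n) \<Longrightarrow> X i j \<in> carrier A"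
  by (cases "i < n \<and> j < n") (auto simp: matalg_carrier)

text \<open>Entries outside the block are fixed to be zero, so that equality of matrices is equality
  of functions.\<close>

lemma (in normed_star) matalg_eqI:
  assumes "X \<in> carrier (matalg A n)" "Y \<in> carrier (matalg A n)"
    and "\<And>i j. i < n \<Longrightarrow> j < n \<Longrightarrow> X i j = Y i j"
  shows "X = Y"
proof (intro ext)
  fix i j
  show "X i j = Y i j" using assms by (cases "i < n \<and> j < n") (auto simp: matalg_carrier)
qed

lemma (in normed_star) matalg_mult_cl:
  "X \<in> carrier (matalg A n) \<Longrightarrow> Y \<in> carrier (matalg A n)
    \<Longrightarrow> X \<otimes>\<^bsub>matalg A n\<^esub> Y \<in> carrier (matalg A n)"
  by (subst matalg_carrier) (auto simp: matalg_sel matalg_mult_out)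

lemma (in normed_star) normed_star_matalg: "normed_star (matalg A n)"
proof -
  let ?M = "matalg A n"
  note cl = matalg_mult_cl
  have add: "X \<oplus>\<^bsub>?M\<^esub> Y \<in> carrier ?M" if "X \<in> carrier ?M" "Y \<in> carrier ?M" for X Y
    using that by (auto simp: matalg_carrier matalg_sel)
  show ?thesis
  proof
    fix X Y Z and c d :: complex
    show "\<zero>\<^bsub>?M\<^esub> \<in> carrier ?M" by (simp add: matalg_carrier matalg_sel)
    assume X: "X \<in> carrier ?M"
    show "c \<odot>\<^bsub>?M\<^esub> X \<in> carrier ?M" "cadj ?M X \<in> carrier ?M"
      using X by (auto simp: matalg_carrier matalg_sel)
    show "X \<oplus>\<^bsub>?M\<^esub> \<zero>\<^bsub>?M\<^esub> = X" "X \<ominus>\<^bsub>?M\<^esub> X = \<zero>\<^bsub>?M\<^esub>" "1 \<odot>\<^bsub>?M\<^esub> X = X"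
      "cadj ?M (cadj ?M X) = X" "c \<odot>\<^bsub>?M\<^esub> d \<odot>\<^bsub>?M\<^esub> X = (c * d) \<odot>\<^bsub>?M\<^esub> X"
      "(c + d) \<odot>\<^bsub>?M\<^esub> X = c \<odot>\<^bsub>?M\<^esub> X \<oplus>\<^bsub>?M\<^esub> d \<odot>\<^bsub>?M\<^esub> X"
      "cadj ?M (c \<odot>\<^bsub>?M\<^esub> X) = cnj c \<odot>\<^bsub>?M\<^esub> cadj ?M X"
      using X by (auto intro!: ext simp: matalg_sel add_s)
    show "0 \<le> cnorm ?M X" using X by (auto simp: matalg_sel intro!: sum_nonneg)
    have "cnorm ?M X = 0 \<longleftrightarrow> (\<forall>i<n. \<forall>j<n. X i j = \<zero>)"
      using X by (auto simp: matalg_sel sum_nonneg_eq_0_iff sum_nonneg norm_0_iff)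
    also have "\<dots> \<longleftrightarrow> X = \<zero>\<^bsub>?M\<^esub>"
      using X by (simp add: matalg_sel matalg_carrier fun_eq_iff) blast
    finally show "cnorm ?M X = 0 \<longleftrightarrow> X = \<zero>\<^bsub>?M\<^esub>" .
    show "cnorm ?M (c \<odot>\<^bsub>?M\<^esub> X) = cmod c * cnorm ?M X"
      using X by (simp add: matalg_sel norm_s sum_distrib_left)
    have "cnorm ?M (cadj ?M X) = (\<Sum>i<n. \<Sum>j<n. cnorm A (X j i))"
      using X by (simp add: matalg_sel)
    also have "\<dots> = cnorm ?M X"
      by (subst sum.swap) (simp add: matalg_sel)
    finally show "cnorm ?M (cadj ?M X) = cnorm ?M X" .
    assume Y: "Y \<in> carrier ?M"
    show "X \<oplus>\<^bsub>?M\<^esub> Y \<in> carrier ?M" "X \<otimes>\<^bsub>?M\<^esub> Y \<in> carrier ?M"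
      using X Y by (auto simp: add cl)
    show "X \<oplus>\<^bsub>?M\<^esub> Y = Y \<oplus>\<^bsub>?M\<^esub> X"
      "c \<odot>\<^bsub>?M\<^esub> (X \<oplus>\<^bsub>?M\<^esub> Y) = c \<odot>\<^bsub>?M\<^esub> X \<oplus>\<^bsub>?M\<^esub> c \<odot>\<^bsub>?M\<^esub> Y"
      "cadj ?M (X \<oplus>\<^bsub>?M\<^esub> Y) = cadj ?M X \<oplus>\<^bsub>?M\<^esub> cadj ?M Y"
      using X Y by (auto intro!: ext simp: matalg_sel s_add adj_sum a_comm)
    have entry: "(P \<otimes>\<^bsub>?M\<^esub> Q) i j = (if i < n \<and> j < n then csum A (\<lambda>k. P i k \<otimes> Q k j) n else \<zero>)"
      for P Q i j
      by (simp add: matalg_sel matalg_mult_out)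
    show "(c \<odot>\<^bsub>?M\<^esub> X) \<otimes>\<^bsub>?M\<^esub> Y = c \<odot>\<^bsub>?M\<^esub> (X \<otimes>\<^bsub>?M\<^esub> Y)" "X \<otimes>\<^bsub>?M\<^esub> (c \<odot>\<^bsub>?M\<^esub> Y) = c \<odot>\<^bsub>?M\<^esub> (X \<otimes>\<^bsub>?M\<^esub> Y)"
      using X Y by (auto intro!: ext simp: entry matalg_sel(3) csum_scale)
    show "cadj ?M (X \<otimes>\<^bsub>?M\<^esub> Y) = cadj ?M Y \<otimes>\<^bsub>?M\<^esub> cadj ?M X"
      using X Y by (auto intro!: ext simp: entry matalg_sel(6) csum_adj adj_prod)
    show "cnorm ?M (X \<oplus>\<^bsub>?M\<^esub> Y) \<le> cnorm ?M X + cnorm ?M Y"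
      using X Y by (auto simp: matalg_sel sum.distrib[symmetric] intro!: sum_mono norm_add)
    show "cnorm ?M (X \<otimes>\<^bsub>?M\<^esub> Y) \<le> cnorm ?M X * cnorm ?M Y"
    proof -
      have "cnorm ?M (X \<otimes>\<^bsub>?M\<^esub> Y)
          \<le> (\<Sum>i<n. \<Sum>j<n. \<Sum>k<n. cnorm A (X i k) * cnorm A (Y k j))"
        unfolding matalg_sel(7)
      proof (intro sum_mono)
        fix i j assume "i \<in> {..<n}" "j \<in> {..<n}"
        then have "cnorm A ((X \<otimes>\<^bsub>?M\<^esub> Y) i j) \<le> (\<Sum>k<n. cnorm A (X i k \<otimes> Y k j))"
          using X Y by (simp add: matalg_sel norm_csum)
        also have "\<dots> \<le> (\<Sum>k<n. cnorm A (X i k) * cnorm A (Y k j))"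
          using X Y by (auto intro!: sum_mono norm_prod)
        finally show "cnorm A ((X \<otimes>\<^bsub>?M\<^esub> Y) i j) \<le> \<dots>" .
      qed
      also have "\<dots> = (\<Sum>i<n. \<Sum>k<n. cnorm A (X i k) * (\<Sum>j<n. cnorm A (Y k j)))"
        by (subst sum.swap[of _ "{..<n}" "{..<n}"]) (simp add: sum_distrib_left)
      \<comment> \<open>The sum over row k of Y is enlarged to the sum over all rows, which
        decouples the two factors.\<close>
      also have "\<dots> \<le> (\<Sum>i<n. \<Sum>k<n. cnorm A (X i k) * (\<Sum>l<n. \<Sum>j<n. cnorm A (Y l j)))"
      proof (rule sum_mono, rule sum_mono, rule mult_left_mono)
        fix i k assume "k \<in> {..<n}"
        then show "(\<Sum>j<n. cnorm A (Y k j)) \<le> (\<Sum>l<n. \<Sum>j<n. cnorm A (Y l j))"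
          using Y by (intro member_le_sum[of k "{..<n}" "\<lambda>l. \<Sum>j<n. cnorm A (Y l j)"] sum_nonneg) auto
      qed (use X in auto)
      also have "\<dots> = cnorm ?M X * cnorm ?M Y"
        by (simp add: matalg_sel sum_distrib_right)
      finally show ?thesis .
    qed
    assume Z: "Z \<in> carrier ?M"
    show "X \<oplus>\<^bsub>?M\<^esub> Y \<oplus>\<^bsub>?M\<^esub> Z = X \<oplus>\<^bsub>?M\<^esub> (Y \<oplus>\<^bsub>?M\<^esub> Z)"
      using X Y Z by (auto intro!: ext simp: matalg_sel a_assoc)
    show "(X \<oplus>\<^bsub>?M\<^esub> Y) \<otimes>\<^bsub>?M\<^esub> Z = X \<otimes>\<^bsub>?M\<^esub> Z \<oplus>\<^bsub>?M\<^esub> Y \<otimes>\<^bsub>?M\<^esub> Z"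
      "X \<otimes>\<^bsub>?M\<^esub> (Y \<oplus>\<^bsub>?M\<^esub> Z) = X \<otimes>\<^bsub>?M\<^esub> Y \<oplus>\<^bsub>?M\<^esub> X \<otimes>\<^bsub>?M\<^esub> Z"
      using X Y Z by (auto intro!: ext simp: entry matalg_sel(2) r_distr l_distr csum_add)
    show "X \<otimes>\<^bsub>?M\<^esub> Y \<otimes>\<^bsub>?M\<^esub> Z = X \<otimes>\<^bsub>?M\<^esub> (Y \<otimes>\<^bsub>?M\<^esub> Z)"
    proof (rule matalg_eqI)
      fix i j assume ij: "i < n" "j < n"
      have "(X \<otimes>\<^bsub>?M\<^esub> Y \<otimes>\<^bsub>?M\<^esub> Z) i j = csum A (\<lambda>k. csum A (\<lambda>l. X i l \<otimes> (Y l k \<otimes> Z k j)) n) n"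
        using X Y Z ij
        by (auto simp: matalg_sel csum_mult_r m_assoc intro!: csum_cong)
      also have "\<dots> = csum A (\<lambda>l. csum A (\<lambda>k. X i l \<otimes> (Y l k \<otimes> Z k j)) n) n"
        using X Y Z by (intro csum_swap) auto
      also have "\<dots> = (X \<otimes>\<^bsub>?M\<^esub> (Y \<otimes>\<^bsub>?M\<^esub> Z)) i j"
        using X Y Z ij by (auto simp: matalg_sel csum_mult_l intro!: csum_cong)
      finally show "(X \<otimes>\<^bsub>?M\<^esub> Y \<otimes>\<^bsub>?M\<^esub> Z) i j = (X \<otimes>\<^bsub>?M\<^esub> (Y \<otimes>\<^bsub>?M\<^esub> Z)) i j" .
    qed (use X Y Z cl in auto)
  qed
qed

lemma (in banach_star) banach_star_matalg: "banach_star (matalg A n)"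
proof -
  let ?M = "matalg A n"
  interpret M: normed_star ?M by (rule normed_star_matalg)
  show ?thesis
  proof
    fix s assume s: "ccauchy ?M s"
    then have s_cl: "s k \<in> carrier ?M" for k by (simp add: ccauchy_def)
    have entry_le: "cnorm A (X i j) \<le> cnorm ?M X" if "X \<in> carrier ?M" "i < n" "j < n" for X i j
    proof -
      have "cnorm A (X i j) \<le> (\<Sum>l<n. cnorm A (X i l))"
        using that by (intro member_le_sum[of j "{..<n}" "\<lambda>l. cnorm A (X i l)"]) auto
      also have "\<dots> \<le> cnorm ?M X"
        unfolding matalg_sel using that
        by (intro member_le_sum[of i "{..<n}" "\<lambda>k. \<Sum>l<n. cnorm A (X k l)"] sum_nonneg) auto
      finally show ?thesis .
    qed
    have "\<exists>l. clim A (\<lambda>k. s k i j) l" if ij: "i < n" "j < n" for i j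
    proof (rule ccauchy_clim)
      show "ccauchy A (\<lambda>k. s k i j)"
        unfolding ccauchy_def
      proof (intro conjI allI impI)
        fix e :: real assume "e > 0"
        then obtain k where k: "\<forall>m\<ge>k. \<forall>n'\<ge>k. cnorm ?M (s m \<ominus>\<^bsub>?M\<^esub> s n') < e"
          using s unfolding ccauchy_def by blast
        have "cnorm A (s m i j \<ominus> s m' i j) < e" if "m \<ge> k" "m' \<ge> k" for m m'
          using entry_le[of "s m \<ominus>\<^bsub>?M\<^esub> s m'" i j] k that ij s_cl
          by (fastforce simp: matalg_sel(4))
        then show "\<exists>k. \<forall>m\<ge>k. \<forall>m'\<ge>k. cnorm A (s m i j \<ominus> s m' i j) < e" by blast
      qed (use matalg_entry[OF s_cl] in blast)
    qed
    then obtain L where L: "\<And>i j. i < n \<Longrightarrow> j < n \<Longrightarrow> clim A (\<lambda>k. s k i j) (L i j)"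
      by metis
    define X where "X i j = (if i < n \<and> j < n then L i j else \<zero>)" for i j
    have X: "X \<in> carrier ?M"
      using L clim_D(1) by (auto simp: matalg_carrier X_def)
    have "(\<lambda>k. \<Sum>i<n. \<Sum>j<n. cnorm A (s k i j \<ominus> X i j)) \<longlonglongrightarrow> (\<Sum>i<n. \<Sum>j<n. 0)"
      using L by (intro tendsto_sum) (auto simp: X_def clim_def)
    then have "clim ?M s X"
      unfolding clim_def using X s_cl by (simp add: matalg_sel)
    then show "\<exists>l. clim ?M s l" by blast
  qed
qed

lemma (in unital_banach_star) unital_banach_star_matalg:
  "unital_banach_star (matalg A n)"
  and matalg_one: "i < n \<Longrightarrow> j < n \<Longrightarrow> \<one>\<^bsub>matalg A n\<^esub> i j = (if i = j then \<one> else \<zero>)"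
proof -
  let ?M = "matalg A n"
  \<comment> \<open>The condition \<open>i < n\<close> keeps the entries outside the block zero, as
    the carrier demands.\<close>
  let ?E = "\<lambda>i j. if i = j \<and> i < n then \<one> else \<zero>"
  interpret M: banach_star ?M by (rule banach_star_matalg)
  have E: "?E \<in> carrier ?M" by (auto simp: matalg_carrier)
  have "cunit ?M ?E"
    unfolding cunit_def
  proof (intro conjI ballI E)
    fix X assume X: "X \<in> carrier ?M"
    show "?E \<otimes>\<^bsub>?M\<^esub> X = X"
    proof (rule matalg_eqI[OF M.mult_cl[OF E X] X])
      fix i j assume ij: "i < n" "j < n"
      have "csum A (\<lambda>k. ?E i k \<otimes> X k j) n = ?E i i \<otimes> X i j"
        by (rule csum_single) (use X ij in auto)
      then show "(?E \<otimes>\<^bsub>?M\<^esub> X) i j = X i j" using X ij by (simp add: matalg_sel)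
    qed
    show "X \<otimes>\<^bsub>?M\<^esub> ?E = X"
    proof (rule matalg_eqI[OF M.mult_cl[OF X E] X])
      fix i j assume ij: "i < n" "j < n"
      have "csum A (\<lambda>k. X i k \<otimes> ?E k j) n = X i j \<otimes> ?E j j"
        by (rule csum_single) (use X ij in auto)
      then show "(X \<otimes>\<^bsub>?M\<^esub> ?E) i j = X i j" using X ij by (simp add: matalg_sel)
    qed
  qed
  then show "unital_banach_star ?M"
    by unfold_locales (auto simp: cunital_def)
  have "\<one>\<^bsub>?M\<^esub> = ?E" using \<open>cunit ?M ?E\<close> by (rule cone_eq)
  then show "i < n \<Longrightarrow> j < n \<Longrightarrow> \<one>\<^bsub>?M\<^esub> i j = (if i = j then \<one> else \<zero>)"
    by simp
qed

text \<open>The bound is ||1|| rather than 1: in \<open>matalg A n\<close> the identity matrix has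
  norm n times that of \<open>\<one>\<close>.\<close>

lemma (in unital_banach_star) norm_cpow_le_one:
  assumes "x \<in> carrier A" "cnorm A x \<le> 1"
  shows "cnorm A (cpow A x k) \<le> cnorm A \<one>"
proof (induction k)
  case (Suc k)
  have "cnorm A (cpow A x (Suc k)) \<le> cnorm A x * cnorm A (cpow A x k)"
    using assms norm_prod by simp
  also have "\<dots> \<le> 1 * cnorm A \<one>" using assms Suc by (intro mult_mono) auto
  finally show ?case by simp
qed simp

lemma (in unital_cstar) pos_diag_star_mult:
  assumes "Y \<in> carrier (matalg A n)" "j < n"
  shows "pos ((cadj (matalg A n) Y \<otimes>\<^bsub>matalg A n\<^esub> Y) j j)"
  using assms by (auto simp: matalg_sel intro!: pos_csum pos_star_mult)

text \<open>The powers of \<open>1 - T\<^sup>2\<close> are contractions for the operator norm, because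
  \<open>1 - (1 - T\<^sup>2)\<^sup>2 = 2 (r T)\<^sup>*(r T)\<close> with \<open>r = sqrt (1 - T\<^sup>2 / 2)\<close>.  Reading this off the
  diagonal entries avoids introducing that norm.\<close>
lemma (in unital_cstar) matalg_power_bounded:
  fixes n :: nat
  defines "M \<equiv> matalg A n"
  assumes T: "T \<in> carrier M" "cadj M T = T" "cnorm M T \<le> 1"
  shows "cnorm M (cpow M (\<one>\<^bsub>M\<^esub> \<ominus>\<^bsub>M\<^esub> T \<otimes>\<^bsub>M\<^esub> T) k) \<le> real n * real n"
proof -
  interpret M: unital_banach_star M unfolding M_def by (rule unital_banach_star_matalg)
  define S where "S = T \<otimes>\<^bsub>M\<^esub> T"
  have S: "S \<in> carrier M" "cadj M S = S" using T by (auto simp: S_def M.adj_prod)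
  define x where "x = (1/2) \<odot>\<^bsub>M\<^esub> S"
  have x: "x \<in> carrier M" "cadj M x = x" using S by (auto simp: x_def)
  have "cnorm M S \<le> 1"
    unfolding S_def
    using order_trans[OF M.norm_prod[OF T(1) T(1)] mult_le_one[OF T(3) M.norm_ge_0[OF T(1)] T(3)]] .
  then have "cnorm M x \<le> 1" using S by (simp add: x_def M.norm_s)
  then obtain y where y: "y \<in> carrier M" "cadj M y = y"
    "(\<one>\<^bsub>M\<^esub> \<ominus>\<^bsub>M\<^esub> y) \<otimes>\<^bsub>M\<^esub> (\<one>\<^bsub>M\<^esub> \<ominus>\<^bsub>M\<^esub> y) = \<one>\<^bsub>M\<^esub> \<ominus>\<^bsub>M\<^esub> x"
    using M.sqrt_exists[OF x M.norm_cpow_le_one[OF x(1)]] by metis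
  define r where "r = \<one>\<^bsub>M\<^esub> \<ominus>\<^bsub>M\<^esub> y"
  have r: "r \<in> carrier M" "cadj M r = r" "r \<otimes>\<^bsub>M\<^esub> r = \<one>\<^bsub>M\<^esub> \<ominus>\<^bsub>M\<^esub> x"
    using y by (auto simp: r_def M.adj_minus)
  define U where "U = \<one>\<^bsub>M\<^esub> \<ominus>\<^bsub>M\<^esub> S"
  have U: "U \<in> carrier M" "cadj M U = U" using S by (auto simp: U_def M.adj_minus)
  define V where "V k = cpow M U k" for k
  have V: "V k \<in> carrier M" "cadj M (V k) = V k" for k
    using U M.cpow_adj[OF U] by (auto simp: V_def)
  have V_Suc: "V (Suc k) = U \<otimes>\<^bsub>M\<^esub> V k" "V (Suc k) = V k \<otimes>\<^bsub>M\<^esub> U" for k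
    using M.cpow_Suc2[OF U(1)] by (auto simp: V_def)
  define Y where "Y k = r \<otimes>\<^bsub>M\<^esub> (T \<otimes>\<^bsub>M\<^esub> V k)" for k
  have Y: "Y k \<in> carrier M" for k using r T V by (simp add: Y_def)
  have "2 \<odot>\<^bsub>M\<^esub> S = S \<oplus>\<^bsub>M\<^esub> S" using S M.add_s[of S 1 1] by simp
  then have "\<one>\<^bsub>M\<^esub> \<ominus>\<^bsub>M\<^esub> U \<otimes>\<^bsub>M\<^esub> U = 2 \<odot>\<^bsub>M\<^esub> S \<ominus>\<^bsub>M\<^esub> S \<otimes>\<^bsub>M\<^esub> S"
    using S by (simp add: U_def cdiff_def M.l_distr M.r_distr M.s_add M.a_assoc)
  also have "\<dots> = 2 \<odot>\<^bsub>M\<^esub> (T \<otimes>\<^bsub>M\<^esub> ((r \<otimes>\<^bsub>M\<^esub> r) \<otimes>\<^bsub>M\<^esub> T))"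
    unfolding r(3) using T by (simp add: x_def S_def M.l_minus M.r_minus M.s_minus M.m_assoc)
  finally have UU: "\<one>\<^bsub>M\<^esub> \<ominus>\<^bsub>M\<^esub> U \<otimes>\<^bsub>M\<^esub> U = \<dots>" .
  \<comment> \<open>The identity 1 - U^2 = 2 (r T)^*(r T), multiplied by V k on both sides, shows
    that 1 - (V k)^2 only gains star products as k grows; its diagonal entries therefore stay
    positive.\<close>
  have step: "\<one>\<^bsub>M\<^esub> \<ominus>\<^bsub>M\<^esub> V (Suc k) \<otimes>\<^bsub>M\<^esub> V (Suc k)
      = (\<one>\<^bsub>M\<^esub> \<ominus>\<^bsub>M\<^esub> V k \<otimes>\<^bsub>M\<^esub> V k) \<oplus>\<^bsub>M\<^esub> 2 \<odot>\<^bsub>M\<^esub> (cadj M (Y k) \<otimes>\<^bsub>M\<^esub> Y k)" for k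
  proof -
    have "V (Suc k) \<otimes>\<^bsub>M\<^esub> V (Suc k) = (V k \<otimes>\<^bsub>M\<^esub> U) \<otimes>\<^bsub>M\<^esub> (U \<otimes>\<^bsub>M\<^esub> V k)"
      by (rule arg_cong2[where f = "cmult M", OF V_Suc(2) V_Suc(1)])
    also have "\<dots> = V k \<otimes>\<^bsub>M\<^esub> ((U \<otimes>\<^bsub>M\<^esub> U) \<otimes>\<^bsub>M\<^esub> V k)"
      using U V by (simp add: M.m_assoc)
    finally have VV: "V (Suc k) \<otimes>\<^bsub>M\<^esub> V (Suc k) = \<dots>" .
    have "cadj M (Y k) \<otimes>\<^bsub>M\<^esub> Y k = V k \<otimes>\<^bsub>M\<^esub> ((T \<otimes>\<^bsub>M\<^esub> ((r \<otimes>\<^bsub>M\<^esub> r) \<otimes>\<^bsub>M\<^esub> T)) \<otimes>\<^bsub>M\<^esub> V k)"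
      using r(1,2) T V by (simp add: Y_def M.adj_prod M.m_assoc)
    then have "2 \<odot>\<^bsub>M\<^esub> (cadj M (Y k) \<otimes>\<^bsub>M\<^esub> Y k) = V k \<otimes>\<^bsub>M\<^esub> ((\<one>\<^bsub>M\<^esub> \<ominus>\<^bsub>M\<^esub> U \<otimes>\<^bsub>M\<^esub> U) \<otimes>\<^bsub>M\<^esub> V k)"
      unfolding UU using r(1) T V by simp
    also have "\<dots> = V k \<otimes>\<^bsub>M\<^esub> V k \<ominus>\<^bsub>M\<^esub> V k \<otimes>\<^bsub>M\<^esub> ((U \<otimes>\<^bsub>M\<^esub> U) \<otimes>\<^bsub>M\<^esub> V k)"
      using U V by (simp add: M.l_minus M.r_minus)
    finally have eq: "2 \<odot>\<^bsub>M\<^esub> (cadj M (Y k) \<otimes>\<^bsub>M\<^esub> Y k) = \<dots>" .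
    show ?thesis
      unfolding VV eq by (rule M.minus_trans) (use V U in auto)
  qed
  have pos_diag: "pos ((\<one>\<^bsub>M\<^esub> \<ominus>\<^bsub>M\<^esub> V k \<otimes>\<^bsub>M\<^esub> V k) j j)" if j: "j < n" for k j
  proof (induction k)
    case 0
    show ?case by (simp add: V_def) (simp add: M_def matalg_sel)
  next
    case (Suc k)
    have "pos (complex_of_real 2 \<odot> (cadj M (Y k) \<otimes>\<^bsub>M\<^esub> Y k) j j)"
      by (rule pos_scale) (use Y j pos_diag_star_mult in \<open>auto simp: M_def\<close>)
    then show ?case
      unfolding step using pos_add[OF Suc] by (simp add: M_def matalg_sel(2,3))
  qed
  have entry: "cnorm A (V k i j) \<le> 1" if ij: "i < n" "j < n" for k i j
  proof (rule norm_le_1_if_csum[of n "\<lambda>i. V k i j"])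
    show "V k i j \<in> carrier A" for i using V(1)[of k] by (simp add: M_def)
    have adj: "cadj A (V k i j) = V k j i" for i
      using fun_cong[OF fun_cong[OF V(2)[of k]], of j i] by (simp add: M_def matalg_sel)
    show "pos (\<one> \<ominus> csum A (\<lambda>i. cadj A (V k i j) \<otimes> V k i j) n)"
      using pos_diag[OF ij(2), of k] ij unfolding adj
      by (simp add: M_def matalg_sel matalg_one)
  qed (use ij in auto)
  \<comment> \<open>There are n^2 entries, each of norm at most 1 whatever k is.\<close>
  have "cnorm M (V k) \<le> (\<Sum>i<n. \<Sum>j<n. 1)"
    unfolding M_def matalg_sel by (intro sum_mono entry) auto
  then show ?thesis by (simp add: V_def U_def S_def)
qed

section \<open>Homomorphisms and completely positive maps\<close>

locale cstar_hom = A: cstar_algebra A + C: cstar_algebra C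
  for A :: "'a cstar" and C :: "'c cstar" +
  fixes f :: "'a \<Rightarrow> 'c"
  assumes star_hom: "star_hom A C f"
begin

lemma hom_cl [simp]: "x \<in> carrier A \<Longrightarrow> f x \<in> carrier C"
  and hom_add: "\<lbrakk>x \<in> carrier A; y \<in> carrier A\<rbrakk> \<Longrightarrow> f (x \<oplus>\<^bsub>A\<^esub> y) = f x \<oplus>\<^bsub>C\<^esub> f y"
  and hom_scale: "x \<in> carrier A \<Longrightarrow> f (c \<odot>\<^bsub>A\<^esub> x) = c \<odot>\<^bsub>C\<^esub> f x"
  and hom_mult: "\<lbrakk>x \<in> carrier A; y \<in> carrier A\<rbrakk> \<Longrightarrow> f (x \<otimes>\<^bsub>A\<^esub> y) = f x \<otimes>\<^bsub>C\<^esub> f y"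
  and hom_adj: "x \<in> carrier A \<Longrightarrow> f (cadj A x) = cadj C (f x)"
  using star_hom by (auto simp: star_hom_def)

lemma hom_zero [simp]: "f \<zero>\<^bsub>A\<^esub> = \<zero>\<^bsub>C\<^esub>"
  using hom_scale[of "\<zero>\<^bsub>A\<^esub>" 0] by simp

lemma hom_csum: "(\<And>i. i < n \<Longrightarrow> g i \<in> carrier A) \<Longrightarrow> f (csum A g n) = csum C (\<lambda>i. f (g i)) n"
  by (induction n) (simp_all add: hom_add)

lemma hom_mat_positive:
  assumes "mat_positive A n X"
  shows "mat_positive C n (\<lambda>i j. f (X i j))"
proof -
  obtain Y where Y: "\<forall>i<n. \<forall>j<n. Y i j \<in> carrier A"
    "\<forall>i<n. \<forall>j<n. X i j = csum A (\<lambda>k. cadj A (Y k i) \<otimes>\<^bsub>A\<^esub> Y k j) n"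
    using assms unfolding mat_positive_def by blast
  show ?thesis
    unfolding mat_positive_def
    by (rule exI[of _ "\<lambda>i j. f (Y i j)"])
      (use Y in \<open>auto simp: hom_csum hom_mult hom_adj intro!: C.csum_cong\<close>)
qed

end

text \<open>With u = Y a this is a^*(Y^* Y) a = u^* u, a sum of the u_m^* u_m; the work lies in
  reordering a triple sum.\<close>

lemma (in unital_cstar) pos_gram:
  assumes Y: "\<And>i j. i < n \<Longrightarrow> j < n \<Longrightarrow> Y i j \<in> carrier A"
    and G: "\<And>i j. i < n \<Longrightarrow> j < n \<Longrightarrow> G i j = csum A (\<lambda>k. cadj A (Y k i) \<otimes> Y k j) n"
    and a: "\<And>i. i < n \<Longrightarrow> a i \<in> carrier A"
  shows "pos (csum A (\<lambda>i. cadj A (a i) \<otimes> csum A (\<lambda>l. G i l \<otimes> a l) n) n)"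
proof -
  define u where "u m = csum A (\<lambda>l. Y m l \<otimes> a l) n" for m
  have u: "u m \<in> carrier A" if "m < n" for m using that Y a by (auto simp: u_def)
  have "cadj A (a i) \<otimes> csum A (\<lambda>l. G i l \<otimes> a l) n
      = csum A (\<lambda>m. cadj A (Y m i \<otimes> a i) \<otimes> u m) n" if i: "i < n" for i
  proof -
    have "csum A (\<lambda>l. G i l \<otimes> a l) n
        = csum A (\<lambda>l. csum A (\<lambda>m. cadj A (Y m i) \<otimes> (Y m l \<otimes> a l)) n) n"
      using i Y a by (auto simp: G csum_mult_r m_assoc intro!: csum_cong)
    also have "\<dots> = csum A (\<lambda>m. csum A (\<lambda>l. cadj A (Y m i) \<otimes> (Y m l \<otimes> a l)) n) n"
      using i Y a by (intro csum_swap) auto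
    also have "\<dots> = csum A (\<lambda>m. cadj A (Y m i) \<otimes> u m) n"
      using i Y a by (auto simp: u_def csum_mult_l intro!: csum_cong)
    finally show ?thesis
      using i Y a u by (auto simp: csum_mult_l adj_prod m_assoc intro!: csum_cong)
  qed
  then have "csum A (\<lambda>i. cadj A (a i) \<otimes> csum A (\<lambda>l. G i l \<otimes> a l) n) n
      = csum A (\<lambda>i. csum A (\<lambda>m. cadj A (Y m i \<otimes> a i) \<otimes> u m) n) n"
    by (rule csum_cong)
  also have "\<dots> = csum A (\<lambda>m. csum A (\<lambda>i. cadj A (Y m i \<otimes> a i) \<otimes> u m) n) n"
    using Y a u by (intro csum_swap) auto
  also have "\<dots> = csum A (\<lambda>m. cadj A (u m) \<otimes> u m) n"
  proof (rule csum_cong)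
    fix m assume m: "m < n"
    have "cadj A (u m) = csum A (\<lambda>i. cadj A (Y m i \<otimes> a i)) n"
      unfolding u_def using Y a m by (intro csum_adj) auto
    then show "csum A (\<lambda>i. cadj A (Y m i \<otimes> a i) \<otimes> u m) n = cadj A (u m) \<otimes> u m"
      using Y a u m by (simp add: csum_mult_r)
  qed
  finally show ?thesis using u by (auto intro!: pos_csum pos_star_mult)
qed

text \<open>Testing on the columns of the negative part of \<open>X\<close> shows that the negative part vanishes.\<close>
lemma mat_positive_test:
  fixes B :: "'b cstar" and I :: "'c cstar"
  assumes "unital_cstar B" "unital_cstar I" and hom: "star_hom B I \<iota>" and inj: "inj_on \<iota> (carrier B)"
    and S: "S \<subseteq> carrier B"
    and ess: "\<And>b. b \<in> carrier B \<Longrightarrow> (\<And>k. k \<in> S \<Longrightarrow> b \<otimes>\<^bsub>B\<^esub> k = \<zero>\<^bsub>B\<^esub>) \<Longrightarrow> b = \<zero>\<^bsub>B\<^esub>"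
    and X: "\<And>i j. i < n \<Longrightarrow> j < n \<Longrightarrow> X i j \<in> carrier B"
    and adj: "\<And>i j. i < n \<Longrightarrow> j < n \<Longrightarrow> cadj B (X j i) = X i j"
    and test: "\<And>k b. k \<in> S \<Longrightarrow> (\<And>i. i < n \<Longrightarrow> b i \<in> carrier B) \<Longrightarrow>
      unital_cstar.pos I (\<iota> (csum B (\<lambda>i. cadj B (b i \<otimes>\<^bsub>B\<^esub> k) \<otimes>\<^bsub>B\<^esub>
        csum B (\<lambda>l. X i l \<otimes>\<^bsub>B\<^esub> (b l \<otimes>\<^bsub>B\<^esub> k)) n) n))"
  shows "mat_positive B n X"
proof -
  interpret B: unital_cstar B by fact
  interpret I: unital_cstar I by fact
  interpret cstar_hom B I \<iota> by unfold_locales fact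
  define M where "M = matalg B n"
  interpret M: unital_banach_star M unfolding M_def by (rule B.unital_banach_star_matalg)
  have M_entry: "P \<in> carrier M \<Longrightarrow> P i j \<in> carrier B" for P i j
    unfolding M_def by (rule B.matalg_entry)
  have M_mult: "i < n \<Longrightarrow> j < n \<Longrightarrow> (P \<otimes>\<^bsub>M\<^esub> Q) i j = csum B (\<lambda>k. P i k \<otimes>\<^bsub>B\<^esub> Q k j) n" for P Q i j
    by (simp add: M_def matalg_sel)
  have M_adj: "cadj M P i j = cadj B (P j i)" for P i j by (simp add: M_def matalg_sel)
  have M_scale: "(c \<odot>\<^bsub>M\<^esub> P) i j = c \<odot>\<^bsub>B\<^esub> P i j" for c P i j by (simp add: M_def matalg_sel)
  define X' where "X' i j = (if i < n \<and> j < n then X i j else \<zero>\<^bsub>B\<^esub>)" for i j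
  have X': "X' \<in> carrier M" "cadj M X' = X'"
    using X adj by (auto simp: M_def X'_def matalg_carrier matalg_sel fun_eq_iff)
  define c where "c = cnorm M X' + 1"
  have c: "c > 0" using X'(1) by (simp add: c_def add_nonneg_pos)
  define T where "T = complex_of_real (1 / c) \<odot>\<^bsub>M\<^esub> X'"
  have T: "T \<in> carrier M" "cadj M T = T" using X' by (auto simp: T_def)
  have "cnorm M T \<le> 1" using X' c by (simp add: T_def M.norm_s norm_divide c_def)
  then obtain h N where hN: "h \<in> carrier M" "N \<in> carrier M" "cadj M h = h" "cadj M N = N"
    "h \<otimes>\<^bsub>M\<^esub> N = N \<otimes>\<^bsub>M\<^esub> h" "T = h \<otimes>\<^bsub>M\<^esub> h \<ominus>\<^bsub>M\<^esub> N"
    "N \<otimes>\<^bsub>M\<^esub> (T \<otimes>\<^bsub>M\<^esub> N) = (-1) \<odot>\<^bsub>M\<^esub> ((h \<otimes>\<^bsub>M\<^esub> N) \<otimes>\<^bsub>M\<^esub> (h \<otimes>\<^bsub>M\<^esub> N))"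
    "N \<otimes>\<^bsub>M\<^esub> N = 2 \<odot>\<^bsub>M\<^esub> (h \<otimes>\<^bsub>M\<^esub> (h \<otimes>\<^bsub>M\<^esub> N))"
    using M.neg_part_exists[OF T B.matalg_power_bounded[of T n, folded M_def, OF T]] by metis
  define P where "P = h \<otimes>\<^bsub>M\<^esub> N"
  have P: "P \<in> carrier M" "cadj M P = P" using hN(1-5) by (auto simp: P_def M.adj_prod)
  have XT: "X' = complex_of_real c \<odot>\<^bsub>M\<^esub> T" using X' c by (simp add: T_def)
  have P_ij: "P i j = \<zero>\<^bsub>B\<^esub>" if ij: "i < n" "j < n" for i j
  proof (rule ess)
    show "P i j \<in> carrier B" using P M_entry by blast
    fix k assume k: "k \<in> S"
    then have kB: "k \<in> carrier B" using S by blast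
    \<comment> \<open>With k at position (j, j) and zeros elsewhere, right multiplication by Q turns
      column j into column j times k and clears all other columns.\<close>
    define Q where "Q l m = (if l = j \<and> m = j then k else \<zero>\<^bsub>B\<^esub>)" for l m
    have Q: "Q \<in> carrier M" using kB ij by (auto simp: M_def matalg_carrier Q_def)
    have RQ: "(R \<otimes>\<^bsub>M\<^esub> Q) l j = R l j \<otimes>\<^bsub>B\<^esub> k" if "R \<in> carrier M" "l < n" for R l
    proof -
      have "csum B (\<lambda>m. R l m \<otimes>\<^bsub>B\<^esub> Q m j) n = R l j \<otimes>\<^bsub>B\<^esub> Q j j"
        by (rule B.csum_single) (use ij that M_entry kB in \<open>auto simp: Q_def\<close>)
      then show ?thesis using that ij by (simp add: M_mult Q_def)
    qed
    define Z where "Z = N \<otimes>\<^bsub>M\<^esub> Q"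
    have Z: "Z \<in> carrier M" using hN(2) Q by (simp add: Z_def)
    define PQ where "PQ = P \<otimes>\<^bsub>M\<^esub> Q"
    have PQj: "PQ l j = P l j \<otimes>\<^bsub>B\<^esub> k" if "l < n" for l
      using RQ[OF P(1) that] by (simp add: PQ_def)
    have Zj: "Z l j = N l j \<otimes>\<^bsub>B\<^esub> k" if "l < n" for l
      using RQ[OF hN(2) that] by (simp add: Z_def)
    have "cadj M Z \<otimes>\<^bsub>M\<^esub> (X' \<otimes>\<^bsub>M\<^esub> Z)
        = complex_of_real c \<odot>\<^bsub>M\<^esub> (cadj M Q \<otimes>\<^bsub>M\<^esub> ((N \<otimes>\<^bsub>M\<^esub> (T \<otimes>\<^bsub>M\<^esub> N)) \<otimes>\<^bsub>M\<^esub> Q))"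
      unfolding XT Z_def using T Q hN(2,4) by (simp add: M.adj_prod M.m_assoc)
    also have "\<dots> = (- complex_of_real c) \<odot>\<^bsub>M\<^esub> (cadj M (P \<otimes>\<^bsub>M\<^esub> Q) \<otimes>\<^bsub>M\<^esub> (P \<otimes>\<^bsub>M\<^esub> Q))"
      unfolding hN(7) P_def[symmetric] using P Q by (simp add: M.adj_prod M.m_assoc)
    also have "\<dots> = (- complex_of_real c) \<odot>\<^bsub>M\<^esub> (cadj M PQ \<otimes>\<^bsub>M\<^esub> PQ)"
      by (simp add: PQ_def)
    finally have eq: "cadj M Z \<otimes>\<^bsub>M\<^esub> (X' \<otimes>\<^bsub>M\<^esub> Z) = \<dots>" .
    define q where "q = csum B (\<lambda>l. cadj B (PQ l j) \<otimes>\<^bsub>B\<^esub> PQ l j) n"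
    have Pl: "PQ l j \<in> carrier B" for l
      using P Q M_entry[of PQ] by (simp add: PQ_def)
    have q: "q \<in> carrier B" using Pl by (auto simp: q_def)
    have "csum B (\<lambda>i. cadj B (N i j \<otimes>\<^bsub>B\<^esub> k) \<otimes>\<^bsub>B\<^esub> csum B (\<lambda>l. X i l \<otimes>\<^bsub>B\<^esub> (N l j \<otimes>\<^bsub>B\<^esub> k)) n) n
       = (cadj M Z \<otimes>\<^bsub>M\<^esub> (X' \<otimes>\<^bsub>M\<^esub> Z)) j j"
      using ij Zj by (auto simp: M_mult M_adj X'_def intro!: B.csum_cong arg_cong2[where f = "cmult B"])
    also have "\<dots> = (- complex_of_real c) \<odot>\<^bsub>B\<^esub> q"
      unfolding eq q_def M_scale using ij by (auto simp: M_mult M_adj intro!: arg_cong2[where f = "cscale B"] B.csum_cong)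
    \<comment> \<open>The test vector is column j of N. Its test value is -c q, while q is a sum of
      star products; so \<iota> q and its negative both lie in the proper cone.\<close>
    finally have "I.pos (\<iota> ((- complex_of_real c) \<odot>\<^bsub>B\<^esub> q))"
      using test[OF k, of "\<lambda>i. N i j"] hN(2) M_entry by simp
    then have "I.pos (complex_of_real (1/c) \<odot>\<^bsub>I\<^esub> \<iota> ((- complex_of_real c) \<odot>\<^bsub>B\<^esub> q))"
      by (rule I.pos_scale) (use c in simp)
    then have neg: "I.pos ((- 1) \<odot>\<^bsub>I\<^esub> \<iota> q)" using q c by (simp add: hom_scale)
    have \<iota>q: "\<iota> q = csum I (\<lambda>l. cadj I (\<iota> (PQ l j)) \<otimes>\<^bsub>I\<^esub> \<iota> (PQ l j)) n"
      unfolding q_def using Pl by (simp add: hom_csum hom_mult hom_adj)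
    have "I.pos (\<iota> q)" unfolding \<iota>q using Pl by (auto intro!: I.pos_csum I.pos_star_mult)
    then have "\<iota> q = \<zero>\<^bsub>I\<^esub>" using I.pos_proper(1)[OF _ neg] q by simp
    then have "\<iota> (PQ i j) = \<zero>\<^bsub>I\<^esub>"
      unfolding \<iota>q by (rule I.csum_star_mult_eq_0[rotated]) (use Pl ij in auto)
    then have "PQ i j = \<zero>\<^bsub>B\<^esub>"
      using inj Pl hom_zero by (metis B.zero_cl inj_onD)
    then show "P i j \<otimes>\<^bsub>B\<^esub> k = \<zero>\<^bsub>B\<^esub>" using PQj ij by simp
  qed
  have "P = \<zero>\<^bsub>M\<^esub>"
    using P_ij P(1) unfolding M_def by (intro B.matalg_eqI[of _ n]) (auto simp: matalg_sel matalg_carrier)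
  then have "N \<otimes>\<^bsub>M\<^esub> N = \<zero>\<^bsub>M\<^esub>" using hN(1,8) by (simp add: P_def)
  have "N i j = \<zero>\<^bsub>B\<^esub>" if ij: "i < n" "j < n" for i j
  proof -
    have "cadj B (N l j) = N j l" for l
      using fun_cong[OF fun_cong[OF hN(4)], of j l] by (simp add: M_adj)
    then have "csum B (\<lambda>l. cadj B (N l j) \<otimes>\<^bsub>B\<^esub> N l j) n = (N \<otimes>\<^bsub>M\<^esub> N) j j"
      using ij by (simp add: M_mult)
    also have "\<dots> = \<zero>\<^bsub>B\<^esub>"
      unfolding \<open>N \<otimes>\<^bsub>M\<^esub> N = \<zero>\<^bsub>M\<^esub>\<close> by (simp add: M_def matalg_sel)
    finally show ?thesis
      by (rule B.csum_star_mult_eq_0[rotated]) (use hN(2) M_entry ij in auto)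
  qed
  then have "N = \<zero>\<^bsub>M\<^esub>"
    using hN(2) unfolding M_def by (intro B.matalg_eqI[of _ n]) (auto simp: matalg_sel matalg_carrier)
  \<comment> \<open>Without negative part X' is c h^2, so H is a self-adjoint root of X' and
    provides the factorization.\<close>
  define H where "H = complex_of_real (sqrt c) \<odot>\<^bsub>M\<^esub> h"
  have H: "H \<in> carrier M" using hN(1) by (simp add: H_def)
  have "cadj M H \<otimes>\<^bsub>M\<^esub> H = X'"
    unfolding XT hN(6) using \<open>N = \<zero>\<^bsub>M\<^esub>\<close> hN(1,3) c by (simp add: H_def flip: of_real_mult)
  then have "X i j = csum B (\<lambda>k. cadj B (H k i) \<otimes>\<^bsub>B\<^esub> H k j) n" if "i < n" "j < n" for i j
    using that M_mult[of i j "cadj M H" H] by (simp add: M_adj X'_def)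
  then show ?thesis
    unfolding mat_positive_def using H M_entry by blast
qed

text \<open>A Kadison--Schwarz argument: in a factorization \<open>W\<^sup>*W\<close> of the image of the Gram matrix of
  \<open>b\<^sub>0\<close>, \<open>b\<close>, \<open>x\<close>, the columns satisfy \<open>w\<^sub>1 = w\<^sub>0 z\<close>.\<close>
lemma cp_map_module:
  fixes D :: "'d cstar" and C :: "'c cstar"
  assumes "normed_star D" "unital_cstar C" and cp: "cp_map D (carrier D) C h"
    and cl: "b\<^sub>0 \<in> carrier D" "b \<in> carrier D" "x \<in> carrier D" "z \<in> carrier C"
    and h: "h (cadj D b\<^sub>0 \<otimes>\<^bsub>D\<^esub> b) = h (cadj D b\<^sub>0 \<otimes>\<^bsub>D\<^esub> b\<^sub>0) \<otimes>\<^bsub>C\<^esub> z"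
      "h (cadj D b \<otimes>\<^bsub>D\<^esub> b\<^sub>0) = cadj C z \<otimes>\<^bsub>C\<^esub> h (cadj D b\<^sub>0 \<otimes>\<^bsub>D\<^esub> b\<^sub>0)"
      "h (cadj D b \<otimes>\<^bsub>D\<^esub> b) = cadj C z \<otimes>\<^bsub>C\<^esub> (h (cadj D b\<^sub>0 \<otimes>\<^bsub>D\<^esub> b\<^sub>0) \<otimes>\<^bsub>C\<^esub> z)"
  shows "h (cadj D b \<otimes>\<^bsub>D\<^esub> x) = cadj C z \<otimes>\<^bsub>C\<^esub> h (cadj D b\<^sub>0 \<otimes>\<^bsub>D\<^esub> x)"
    and "h (cadj D x \<otimes>\<^bsub>D\<^esub> b) = h (cadj D x \<otimes>\<^bsub>D\<^esub> b\<^sub>0) \<otimes>\<^bsub>C\<^esub> z"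
proof -
  interpret D: normed_star D by fact
  interpret C: unital_cstar C by fact
  define c where "c i = (if i = 0 then b\<^sub>0 else if i = Suc 0 then b else x)" for i :: nat
  have c: "c i \<in> carrier D" for i using cl by (simp add: c_def)
  have "mat_positive D 3 (\<lambda>i j. cadj D (c i) \<otimes>\<^bsub>D\<^esub> c j)"
    unfolding mat_positive_def
  proof (intro exI conjI allI impI)
    fix i j :: nat
    \<comment> \<open>The Gram matrix is R^* R for the single row R = (c 0, c 1, c 2), padded with
      zero rows to a square matrix as \<open>mat_positive\<close> wants.\<close>
    let ?Y = "\<lambda>k i. if k = 0 then c i else \<zero>\<^bsub>D\<^esub>"
    have "csum D (\<lambda>k. cadj D (?Y k i) \<otimes>\<^bsub>D\<^esub> ?Y k j) 3 = cadj D (?Y 0 i) \<otimes>\<^bsub>D\<^esub> ?Y 0 j"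
      using c by (simp add: numeral_3_eq_3)
    then show "cadj D (c i) \<otimes>\<^bsub>D\<^esub> c j = csum D (\<lambda>k. cadj D (?Y k i) \<otimes>\<^bsub>D\<^esub> ?Y k j) 3" by simp
    show "?Y i j \<in> carrier D" using c by simp
  qed
  then have "mat_positive C 3 (\<lambda>i j. h (cadj D (c i) \<otimes>\<^bsub>D\<^esub> c j))"
    using cp c unfolding cp_map_def by simp
  then obtain W where W: "\<forall>i<3. \<forall>j<3. W i j \<in> carrier C"
    and hW: "\<forall>i<3. \<forall>j<3. h (cadj D (c i) \<otimes>\<^bsub>D\<^esub> c j) = csum C (\<lambda>k. cadj C (W k i) \<otimes>\<^bsub>C\<^esub> W k j) 3"
    unfolding mat_positive_def by blast
  let ?s = "\<lambda>i j. csum C (\<lambda>k. cadj C (W k i) \<otimes>\<^bsub>C\<^esub> W k j) (3::nat)"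
  have Wk: "W k 0 \<in> carrier C" "W k (Suc 0) \<in> carrier C" "W k 2 \<in> carrier C" if "k < 3" for k
    using W that by auto
  have hs: "h (cadj D b\<^sub>0 \<otimes>\<^bsub>D\<^esub> b\<^sub>0) = ?s 0 0" "h (cadj D b\<^sub>0 \<otimes>\<^bsub>D\<^esub> b) = ?s 0 (Suc 0)"
    "h (cadj D b \<otimes>\<^bsub>D\<^esub> b\<^sub>0) = ?s (Suc 0) 0" "h (cadj D b \<otimes>\<^bsub>D\<^esub> b) = ?s (Suc 0) (Suc 0)"
    "h (cadj D b \<otimes>\<^bsub>D\<^esub> x) = ?s (Suc 0) 2" "h (cadj D b\<^sub>0 \<otimes>\<^bsub>D\<^esub> x) = ?s 0 2"
    "h (cadj D x \<otimes>\<^bsub>D\<^esub> b) = ?s 2 (Suc 0)" "h (cadj D x \<otimes>\<^bsub>D\<^esub> b\<^sub>0) = ?s 2 0"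
    using hW[rule_format, of 0 0] hW[rule_format, of 0 "Suc 0"] hW[rule_format, of "Suc 0" 0]
      hW[rule_format, of "Suc 0" "Suc 0"] hW[rule_format, of "Suc 0" 2] hW[rule_format, of 0 2]
      hW[rule_format, of 2 "Suc 0"] hW[rule_format, of 2 0]
    by (simp_all add: c_def)
  have s00: "?s 0 0 \<in> carrier C" using Wk by auto
  \<comment> \<open>Writing out the sum of the v_k^* v_k produces exactly the expressions in the
    hypotheses on \<open>b\<^sub>0\<close> and b, which cancel; so each v k is zero.\<close>
  define v where "v k = W k (Suc 0) \<ominus>\<^bsub>C\<^esub> W k 0 \<otimes>\<^bsub>C\<^esub> z" for k
  have v: "v k \<in> carrier C" if "k < 3" for k using Wk[OF that] cl by (simp add: v_def)
  have vv: "cadj C (v k) \<otimes>\<^bsub>C\<^esub> v k = (cadj C (W k (Suc 0)) \<otimes>\<^bsub>C\<^esub> W k (Suc 0) \<oplus>\<^bsub>C\<^esub>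
      (- 1) \<odot>\<^bsub>C\<^esub> ((cadj C (W k (Suc 0)) \<otimes>\<^bsub>C\<^esub> W k 0) \<otimes>\<^bsub>C\<^esub> z)) \<oplus>\<^bsub>C\<^esub>
      ((- 1) \<odot>\<^bsub>C\<^esub> (cadj C z \<otimes>\<^bsub>C\<^esub> (cadj C (W k 0) \<otimes>\<^bsub>C\<^esub> W k (Suc 0))) \<oplus>\<^bsub>C\<^esub>
      cadj C z \<otimes>\<^bsub>C\<^esub> ((cadj C (W k 0) \<otimes>\<^bsub>C\<^esub> W k 0) \<otimes>\<^bsub>C\<^esub> z))" if "k < 3" for k
    using Wk[OF that] cl
    by (simp add: v_def cdiff_def C.adj_sum C.adj_prod C.l_distr C.r_distr C.s_add C.m_assoc C.a_ac)
  have "csum C (\<lambda>k. cadj C (v k) \<otimes>\<^bsub>C\<^esub> v k) 3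
      = (?s (Suc 0) (Suc 0) \<oplus>\<^bsub>C\<^esub> (- 1) \<odot>\<^bsub>C\<^esub> (?s (Suc 0) 0 \<otimes>\<^bsub>C\<^esub> z)) \<oplus>\<^bsub>C\<^esub>
        ((- 1) \<odot>\<^bsub>C\<^esub> (cadj C z \<otimes>\<^bsub>C\<^esub> ?s 0 (Suc 0)) \<oplus>\<^bsub>C\<^esub> cadj C z \<otimes>\<^bsub>C\<^esub> (?s 0 0 \<otimes>\<^bsub>C\<^esub> z))"
    using Wk cl by (simp add: C.csum_cong[OF vv] C.csum_add C.csum_scale C.csum_mult_l C.csum_mult_r)
  also have "\<dots> = \<zero>\<^bsub>C\<^esub>"
    unfolding h(1-3)[unfolded hs] using s00 cl by (simp add: C.m_assoc)
  finally have "v k = \<zero>\<^bsub>C\<^esub>" if "k < 3" for k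
    by (rule C.csum_star_mult_eq_0[rotated]) (use v that in auto)
  then have W1: "W k (Suc 0) = W k 0 \<otimes>\<^bsub>C\<^esub> z" if "k < 3" for k
    using that Wk[OF that] cl by (simp add: v_def C.minus_0_iff[symmetric])
  have "?s (Suc 0) 2 = csum C (\<lambda>k. cadj C z \<otimes>\<^bsub>C\<^esub> (cadj C (W k 0) \<otimes>\<^bsub>C\<^esub> W k 2)) 3"
    by (rule C.csum_cong) (use W1 Wk cl in \<open>simp add: C.adj_prod C.m_assoc\<close>)
  then show "h (cadj D b \<otimes>\<^bsub>D\<^esub> x) = cadj C z \<otimes>\<^bsub>C\<^esub> h (cadj D b\<^sub>0 \<otimes>\<^bsub>D\<^esub> x)"
    unfolding hs using Wk cl by (simp add: C.csum_mult_l)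
  have "?s 2 (Suc 0) = csum C (\<lambda>k. (cadj C (W k 2) \<otimes>\<^bsub>C\<^esub> W k 0) \<otimes>\<^bsub>C\<^esub> z) 3"
    by (rule C.csum_cong) (use W1 Wk cl in \<open>simp add: C.m_assoc\<close>)
  then show "h (cadj D x \<otimes>\<^bsub>D\<^esub> b) = h (cadj D x \<otimes>\<^bsub>D\<^esub> b\<^sub>0) \<otimes>\<^bsub>C\<^esub> z"
    unfolding hs using Wk cl by (simp add: C.csum_mult_r)
qed

section \<open>Direct sums and isomorphic copies\<close>

definition cstar_sum :: "'a cstar \<Rightarrow> ('a \<times> 'a) cstar" where
  "cstar_sum A =
    \<lparr>carrier = carrier A \<times> carrier A,
     czero = (\<zero>\<^bsub>A\<^esub>, \<zero>\<^bsub>A\<^esub>),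
     cadd = (\<lambda>x y. (fst x \<oplus>\<^bsub>A\<^esub> fst y, snd x \<oplus>\<^bsub>A\<^esub> snd y)),
     cscale = (\<lambda>c x. (c \<odot>\<^bsub>A\<^esub> fst x, c \<odot>\<^bsub>A\<^esub> snd x)),
     cmult = (\<lambda>x y. (fst x \<otimes>\<^bsub>A\<^esub> fst y, snd x \<otimes>\<^bsub>A\<^esub> snd y)),
     cadj = (\<lambda>x. (cadj A (fst x), cadj A (snd x))),
     cnorm = (\<lambda>x. max (cnorm A (fst x)) (cnorm A (snd x)))\<rparr>"

lemma cstar_sum_sel:
  "x \<in> carrier (cstar_sum A) \<longleftrightarrow> fst x \<in> carrier A \<and> snd x \<in> carrier A"
  "\<zero>\<^bsub>cstar_sum A\<^esub> = (\<zero>\<^bsub>A\<^esub>, \<zero>\<^bsub>A\<^esub>)"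
  "x \<oplus>\<^bsub>cstar_sum A\<^esub> y = (fst x \<oplus>\<^bsub>A\<^esub> fst y, snd x \<oplus>\<^bsub>A\<^esub> snd y)"
  "c \<odot>\<^bsub>cstar_sum A\<^esub> x = (c \<odot>\<^bsub>A\<^esub> fst x, c \<odot>\<^bsub>A\<^esub> snd x)"
  "x \<ominus>\<^bsub>cstar_sum A\<^esub> y = (fst x \<ominus>\<^bsub>A\<^esub> fst y, snd x \<ominus>\<^bsub>A\<^esub> snd y)"
  "x \<otimes>\<^bsub>cstar_sum A\<^esub> y = (fst x \<otimes>\<^bsub>A\<^esub> fst y, snd x \<otimes>\<^bsub>A\<^esub> snd y)"
  "cadj (cstar_sum A) x = (cadj A (fst x), cadj A (snd x))"
  "cnorm (cstar_sum A) x = max (cnorm A (fst x)) (cnorm A (snd x))"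
  by (auto simp: cstar_sum_def cdiff_def mem_Times_iff)

lemma (in cstar_algebra) cstar_algebra_cstar_sum: "cstar_algebra (cstar_sum A)"
proof (rule cstar_algebraI)
  show "normed_star (cstar_sum A)"
  proof
    fix x y :: "'a \<times> 'a" and c :: complex
    assume x: "x \<in> carrier (cstar_sum A)"
    show "cnorm (cstar_sum A) x = 0 \<longleftrightarrow> x = \<zero>\<^bsub>cstar_sum A\<^esub>"
    proof -
      have "max a b = 0 \<longleftrightarrow> a = 0 \<and> b = 0" if "0 \<le> a" "0 \<le> b" for a b :: real
        using that by (auto simp: max_def)
      then show ?thesis using x by (simp add: cstar_sum_sel norm_0_iff prod_eq_iff)
    qed
    show "cnorm (cstar_sum A) (c \<odot>\<^bsub>cstar_sum A\<^esub> x) = cmod c * cnorm (cstar_sum A) x"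
      using x by (simp add: cstar_sum_sel norm_s max_mult_distrib_left)
    assume y: "y \<in> carrier (cstar_sum A)"
    show "cnorm (cstar_sum A) (x \<oplus>\<^bsub>cstar_sum A\<^esub> y) \<le> cnorm (cstar_sum A) x + cnorm (cstar_sum A) y"
      using x y norm_add[of "fst x" "fst y"] norm_add[of "snd x" "snd y"] by (auto simp: cstar_sum_sel)
    have "cnorm A (s \<otimes> t) \<le> p * q"
      if "s \<in> carrier A" "t \<in> carrier A" "cnorm A s \<le> p" "cnorm A t \<le> q" for s t p q
      using that norm_prod[of s t] mult_mono[of "cnorm A s" p "cnorm A t" q] norm_ge_0[of s] norm_ge_0[of t]
      by linarith
    then show "cnorm (cstar_sum A) (x \<otimes>\<^bsub>cstar_sum A\<^esub> y) \<le> cnorm (cstar_sum A) x * cnorm (cstar_sum A) y"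
      using x y by (simp add: cstar_sum_sel)
  qed (auto simp: cstar_sum_sel a_ac s_add add_s m_assoc r_distr l_distr adj_sum adj_prod
      le_max_iff_disj)
next
  fix x assume x: "x \<in> carrier (cstar_sum A)"
  have "(max a b)\<^sup>2 = max (a\<^sup>2) (b\<^sup>2)" if "0 \<le> a" "0 \<le> b" for a b :: real
    using that by (auto simp: max_def power_mono_iff)
  then show "cnorm (cstar_sum A) (cadj (cstar_sum A) x \<otimes>\<^bsub>cstar_sum A\<^esub> x) = (cnorm (cstar_sum A) x)\<^sup>2"
    using x by (simp add: cstar_sum_sel cstar_identity)
next
  fix s assume s: "ccauchy (cstar_sum A) s"
  then have cl: "fst (s n) \<in> carrier A" "snd (s n) \<in> carrier A" for n
    by (auto simp: ccauchy_def cstar_sum_sel)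
  have "ccauchy A (\<lambda>n. fst (s n))" "ccauchy A (\<lambda>n. snd (s n))"
    using s cl unfolding ccauchy_def by (simp_all add: cstar_sum_sel) blast+
  then obtain l m where lm: "clim A (\<lambda>n. fst (s n)) l" "clim A (\<lambda>n. snd (s n)) m"
    using ccauchy_clim by blast
  have "(\<lambda>n. cnorm (cstar_sum A) (s n \<ominus>\<^bsub>cstar_sum A\<^esub> (l, m))) \<longlonglongrightarrow> max 0 0"
    unfolding cstar_sum_sel using lm by (intro tendsto_max) (auto simp: clim_def)
  then have "clim (cstar_sum A) s (l, m)"
    using lm cl by (simp add: clim_def cstar_sum_sel)
  then show "\<exists>l. clim (cstar_sum A) s l" by blast
qed

text \<open>Transport of structure along an injective f. It moves an algebra into the one type over
  which \<open>injective_cstar\<close> lets the ambient algebra range.\<close>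

definition copy :: "('a \<Rightarrow> 'b) \<Rightarrow> 'a cstar \<Rightarrow> 'b cstar" where
  "copy f A =
    \<lparr>carrier = f ` carrier A,
     czero = f \<zero>\<^bsub>A\<^esub>,
     cadd = (\<lambda>x y. f (inv f x \<oplus>\<^bsub>A\<^esub> inv f y)),
     cscale = (\<lambda>c x. f (c \<odot>\<^bsub>A\<^esub> inv f x)),
     cmult = (\<lambda>x y. f (inv f x \<otimes>\<^bsub>A\<^esub> inv f y)),
     cadj = (\<lambda>x. f (cadj A (inv f x))),
     cnorm = (\<lambda>x. cnorm A (inv f x))\<rparr>"

lemma copy_sel:
  assumes "inj f"
  shows "carrier (copy f A) = f ` carrier A"
    "\<zero>\<^bsub>copy f A\<^esub> = f \<zero>\<^bsub>A\<^esub>"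
    "f x \<oplus>\<^bsub>copy f A\<^esub> f y = f (x \<oplus>\<^bsub>A\<^esub> y)"
    "c \<odot>\<^bsub>copy f A\<^esub> f x = f (c \<odot>\<^bsub>A\<^esub> x)"
    "f x \<ominus>\<^bsub>copy f A\<^esub> f y = f (x \<ominus>\<^bsub>A\<^esub> y)"
    "f x \<otimes>\<^bsub>copy f A\<^esub> f y = f (x \<otimes>\<^bsub>A\<^esub> y)"
    "cadj (copy f A) (f x) = f (cadj A x)"
    "cnorm (copy f A) (f x) = cnorm A x"
  using assms by (simp_all add: copy_def cdiff_def)

lemma (in cstar_algebra) cstar_algebra_copy:
  assumes "inj f"
  shows "cstar_algebra (copy f A)"
proof (rule cstar_algebraI)
  note [simp] = copy_sel[OF assms]
  show "normed_star (copy f A)"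
    by unfold_locales (use assms in \<open>auto simp: a_ac s_add add_s m_assoc r_distr l_distr
      adj_sum adj_prod norm_0_iff norm_add norm_s norm_prod inj_eq\<close>)
  show "cnorm (copy f A) (cadj (copy f A) x \<otimes>\<^bsub>copy f A\<^esub> x) = (cnorm (copy f A) x)\<^sup>2"
    if "x \<in> carrier (copy f A)" for x
    using that by (auto simp: cstar_identity)
  fix s assume s: "ccauchy (copy f A) s"
  define t where "t n = inv f (s n)" for n
  have st: "s n = f (t n)" and t: "t n \<in> carrier A" for n
    using s assms unfolding t_def ccauchy_def by (auto simp: image_iff) (metis inv_f_f)+
  have "ccauchy A t" using s t unfolding ccauchy_def by (simp add: st)
  then obtain l where "clim A t l" using ccauchy_clim by blast
  then have "clim (copy f A) s (f l)" by (simp add: clim_def st)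
  then show "\<exists>l. clim (copy f A) s l" by blast
qed

text \<open>The type of \<open>D\<close> is the one over which \<open>injective_cstar\<close> quantifies; the elements of \<open>D\<close> are
  codes of pairs, and their matrix multiplication plays no role.\<close>
lemma (in unital_cstar) exists_cstar_sum:
  obtains D :: "('a \<Rightarrow> 'a \<Rightarrow> complex) cstar" and p\<^sub>1 p\<^sub>2 q where
    "unital_cstar D" "star_hom D A p\<^sub>1" "star_hom D A p\<^sub>2" "p\<^sub>1 \<one>\<^bsub>D\<^esub> = \<one>" "p\<^sub>2 \<one>\<^bsub>D\<^esub> = \<one>"
    "\<And>x y. x \<in> carrier A \<Longrightarrow> y \<in> carrier A \<Longrightarrow>
      q x y \<in> carrier D \<and> p\<^sub>1 (q x y) = x \<and> p\<^sub>2 (q x y) = y"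
    "\<And>z w. z \<in> carrier D \<Longrightarrow> w \<in> carrier D \<Longrightarrow> p\<^sub>1 z = p\<^sub>1 w \<Longrightarrow> p\<^sub>2 z = p\<^sub>2 w \<Longrightarrow> z = w"
proof
  \<comment> \<open>A pair is coded as the matrix unit whose position is that pair.\<close>
  define code :: "'a \<times> 'a \<Rightarrow> 'a \<Rightarrow> 'a \<Rightarrow> complex"
    where "code x i j = (if i = fst x \<and> j = snd x then 1 else 0)" for x i j
  have inj: "inj code"
  proof (rule injI)
    fix x y assume "code x = code y"
    then have "code x (fst x) (snd x) = code y (fst x) (snd x)" by simp
    then show "x = y" by (simp add: code_def prod_eq_iff split: if_splits)
  qed
  define D where "D = copy code (cstar_sum A)"
  note sel = copy_sel[OF inj, of "cstar_sum A", folded D_def]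
  interpret S: cstar_algebra "cstar_sum A" by (rule cstar_algebra_cstar_sum)
  interpret D: cstar_algebra D unfolding D_def by (rule S.cstar_algebra_copy[OF inj])
  define p\<^sub>1 where "p\<^sub>1 z = fst (inv code z)" for z
  define p\<^sub>2 where "p\<^sub>2 z = snd (inv code z)" for z
  have p: "p\<^sub>1 (code x) = fst x" "p\<^sub>2 (code x) = snd x" for x
    using inj by (auto simp: p\<^sub>1_def p\<^sub>2_def)
  have u: "cunit D (code (\<one>, \<one>))"
    unfolding cunit_def by (auto simp: sel cstar_sum_sel)
  show "unital_cstar D"
    using u by unfold_locales (auto simp: cunital_def)
  show "p\<^sub>1 \<one>\<^bsub>D\<^esub> = \<one>" "p\<^sub>2 \<one>\<^bsub>D\<^esub> = \<one>"
    by (simp_all add: cone_eq[OF u] p)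
  show "star_hom D A p\<^sub>1" "star_hom D A p\<^sub>2"
    by (auto simp: star_hom_def sel cstar_sum_sel p)
  show "code (x, y) \<in> carrier D \<and> p\<^sub>1 (code (x, y)) = x \<and> p\<^sub>2 (code (x, y)) = y"
    if "x \<in> carrier A" "y \<in> carrier A" for x y
    using that by (auto simp: sel cstar_sum_sel p)
  show "z = w" if "z \<in> carrier D" "w \<in> carrier D" "p\<^sub>1 z = p\<^sub>1 w" "p\<^sub>2 z = p\<^sub>2 w" for z w
    using that by (auto simp: sel p prod_eq_iff)
qed

section \<open>Orthogonality in the injective envelope\<close>

text \<open>Let \<open>E\<close> consist of the pairs \<open>(s, t)\<close> in \<open>I \<oplus> I\<close> for which some \<open>r\<close> in \<open>B\<close> acts on \<open>K\<close>
  like \<open>s\<close> and on \<open>M\<close> like \<open>t\<close>.  The map \<open>(s, t) \<mapsto> r\<close> is completely positive on \<open>E\<close>, and it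
  sends the diagonal copy of \<open>b\<close> to \<open>b\<close>, and \<open>(0, x)\<close> and \<open>(y, 0)\<close> to \<open>0\<close>.  By rigidity an
  extension to \<open>I \<oplus> I\<close> restricts to the identity on the diagonal, hence is \<open>I\<close>-bilinear.\<close>
lemma envelope_orthogonal:
  fixes B :: "'b cstar" and I :: "'c cstar"
  assumes "cstar_algebra B" "cunital B" and env: "injective_envelope_unital B I \<iota>"
    and KM: "K \<subseteq> carrier B" "M \<subseteq> carrier B"
      "\<And>b k. b \<in> carrier B \<Longrightarrow> k \<in> K \<Longrightarrow> b \<otimes>\<^bsub>B\<^esub> k \<in> K"
      "\<And>b m. b \<in> carrier B \<Longrightarrow> m \<in> M \<Longrightarrow> b \<otimes>\<^bsub>B\<^esub> m \<in> M"
    and ess: "\<And>b. b \<in> carrier B \<Longrightarrow> (\<And>k. k \<in> K \<union> M \<Longrightarrow> b \<otimes>\<^bsub>B\<^esub> k = \<zero>\<^bsub>B\<^esub>) \<Longrightarrow> b = \<zero>\<^bsub>B\<^esub>"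
    and x: "x \<in> carrier I"
      "\<And>m. m \<in> M \<Longrightarrow> x \<otimes>\<^bsub>I\<^esub> \<iota> m = \<zero>\<^bsub>I\<^esub>" "\<And>m. m \<in> M \<Longrightarrow> cadj I x \<otimes>\<^bsub>I\<^esub> \<iota> m = \<zero>\<^bsub>I\<^esub>"
    and y: "y \<in> carrier I"
      "\<And>k. k \<in> K \<Longrightarrow> y \<otimes>\<^bsub>I\<^esub> \<iota> k = \<zero>\<^bsub>I\<^esub>" "\<And>k. k \<in> K \<Longrightarrow> cadj I y \<otimes>\<^bsub>I\<^esub> \<iota> k = \<zero>\<^bsub>I\<^esub>"
  shows "x \<otimes>\<^bsub>I\<^esub> y = \<zero>\<^bsub>I\<^esub>" and "y \<otimes>\<^bsub>I\<^esub> x = \<zero>\<^bsub>I\<^esub>"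
proof -
  have inj_I: "injective_cstar I" and hom: "star_hom B I \<iota>" and inj: "inj_on \<iota> (carrier B)"
    and \<iota>_one: "\<iota> \<one>\<^bsub>B\<^esub> = \<one>\<^bsub>I\<^esub>"
    and rigid: "\<And>\<phi> z. ucp_map I (carrier I) I \<phi> \<Longrightarrow> (\<And>b. b \<in> carrier B \<Longrightarrow> \<phi> (\<iota> b) = \<iota> b)
      \<Longrightarrow> z \<in> carrier I \<Longrightarrow> \<phi> z = z"
    using env by (auto simp: injective_envelope_unital_def)
  interpret B: unital_cstar B
    using assms(1,2) by (simp add: unital_cstar_def unital_cstar_axioms_def)
  interpret I: unital_cstar I
    using inj_I by (simp add: unital_cstar_def unital_cstar_axioms_def injective_cstar_def)
  interpret \<iota>: cstar_hom B I \<iota> by unfold_locales (rule hom)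
  obtain D :: "('c \<Rightarrow> 'c \<Rightarrow> complex) cstar" and p\<^sub>1 p\<^sub>2 q where
    D: "unital_cstar D" and ph: "star_hom D I p\<^sub>1" "star_hom D I p\<^sub>2"
    and p_one: "p\<^sub>1 \<one>\<^bsub>D\<^esub> = \<one>\<^bsub>I\<^esub>" "p\<^sub>2 \<one>\<^bsub>D\<^esub> = \<one>\<^bsub>I\<^esub>"
    and q: "\<And>x y. x \<in> carrier I \<Longrightarrow> y \<in> carrier I \<Longrightarrow>
      q x y \<in> carrier D \<and> p\<^sub>1 (q x y) = x \<and> p\<^sub>2 (q x y) = y"
    and p_eq: "\<And>z w. z \<in> carrier D \<Longrightarrow> w \<in> carrier D \<Longrightarrow> p\<^sub>1 z = p\<^sub>1 w \<Longrightarrow> p\<^sub>2 z = p\<^sub>2 w \<Longrightarrow> z = w"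
    by (rule I.exists_cstar_sum) (rule that; assumption)
  interpret D: unital_cstar D by fact
  interpret p\<^sub>1: cstar_hom D I p\<^sub>1 by unfold_locales fact
  interpret p\<^sub>2: cstar_hom D I p\<^sub>2 by unfold_locales fact
  \<comment> \<open>The clauses for adjoints make E closed under \<open>cadj\<close>, as an operator
    system must be. All factors k stand on the right since K and M are only assumed to absorb from
    the left.\<close>
  define rel where "rel z r \<longleftrightarrow> r \<in> carrier B \<and>
    (\<forall>k\<in>K. p\<^sub>1 z \<otimes>\<^bsub>I\<^esub> \<iota> k = \<iota> (r \<otimes>\<^bsub>B\<^esub> k) \<and> cadj I (p\<^sub>1 z) \<otimes>\<^bsub>I\<^esub> \<iota> k = \<iota> (cadj B r \<otimes>\<^bsub>B\<^esub> k)) \<and>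
    (\<forall>k\<in>M. p\<^sub>2 z \<otimes>\<^bsub>I\<^esub> \<iota> k = \<iota> (r \<otimes>\<^bsub>B\<^esub> k) \<and> cadj I (p\<^sub>2 z) \<otimes>\<^bsub>I\<^esub> \<iota> k = \<iota> (cadj B r \<otimes>\<^bsub>B\<^esub> k))" for z r
  have KB: "k \<in> carrier B" if "k \<in> K" for k using that KM by blast
  have MB: "k \<in> carrier B" if "k \<in> M" for k using that KM by blast
  \<comment> \<open>The difference of two candidates annihilates K and M from the left, hence
    vanishes by \<open>ess\<close>.\<close>
  have rel_unique: "r = r'" if "rel z r" "rel z r'" for z r r'
  proof -
    have rr: "r \<in> carrier B" "r' \<in> carrier B" using that by (auto simp: rel_def)
    have "(r \<ominus>\<^bsub>B\<^esub> r') \<otimes>\<^bsub>B\<^esub> k = \<zero>\<^bsub>B\<^esub>" if k: "k \<in> K \<union> M" for k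
    proof -
      have "\<iota> (r \<otimes>\<^bsub>B\<^esub> k) = \<iota> (r' \<otimes>\<^bsub>B\<^esub> k)"
        using k \<open>rel z r\<close> \<open>rel z r'\<close> by (auto simp: rel_def)
      moreover have "k \<in> carrier B" using k KB MB by blast
      ultimately have "r \<otimes>\<^bsub>B\<^esub> k = r' \<otimes>\<^bsub>B\<^esub> k" using inj rr by (simp add: inj_on_eq_iff)
      then show ?thesis using rr \<open>k \<in> carrier B\<close> by (simp add: B.r_minus)
    qed
    then show ?thesis using ess[of "r \<ominus>\<^bsub>B\<^esub> r'"] rr B.minus_0_iff by simp
  qed
  define E where "E = {z \<in> carrier D. \<exists>r. rel z r}"
  define f where "f z = \<iota> (THE r. rel z r)" for z
  have f: "f z = \<iota> r" if "rel z r" for z r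
    unfolding f_def using that rel_unique by (metis the_equality)
  have rel_add: "rel (z \<oplus>\<^bsub>D\<^esub> w) (r \<oplus>\<^bsub>B\<^esub> s)"
    if "z \<in> carrier D" "w \<in> carrier D" "rel z r" "rel w s" for z w r s
    using that KB MB
    by (simp add: rel_def p\<^sub>1.hom_add p\<^sub>2.hom_add I.r_distr I.adj_sum B.r_distr B.adj_sum \<iota>.hom_add)
  have rel_scale: "rel (c \<odot>\<^bsub>D\<^esub> z) (c \<odot>\<^bsub>B\<^esub> r)" if "z \<in> carrier D" "rel z r" for c z r
    using that KB MB by (simp add: rel_def p\<^sub>1.hom_scale p\<^sub>2.hom_scale \<iota>.hom_scale)
  have rel_adj: "rel (cadj D z) (cadj B r)" if "z \<in> carrier D" "rel z r" for z r
    using that KB MB by (simp add: rel_def p\<^sub>1.hom_adj p\<^sub>2.hom_adj)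
  have rel_diag: "rel (q (\<iota> b) (\<iota> b)) b" if "b \<in> carrier B" for b
    using that KB MB q[of "\<iota> b" "\<iota> b"] by (simp add: rel_def \<iota>.hom_mult \<iota>.hom_adj)
  have D_one: "\<one>\<^bsub>D\<^esub> = q (\<iota> \<one>\<^bsub>B\<^esub>) (\<iota> \<one>\<^bsub>B\<^esub>)"
    using q[of "\<one>\<^bsub>I\<^esub>" "\<one>\<^bsub>I\<^esub>"] p_one unfolding \<iota>_one by (intro p_eq) auto
  have E_zero: "\<zero>\<^bsub>D\<^esub> \<in> E"
    unfolding E_def using KB MB by (auto simp: rel_def intro!: exI[of _ "\<zero>\<^bsub>B\<^esub>"])
  have sub: "operator_system D E"
    unfolding operator_system_def csubspace_def
  proof (intro conjI ballI allI)
    show "E \<subseteq> carrier D" by (auto simp: E_def)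
    show "\<one>\<^bsub>D\<^esub> \<in> E" unfolding E_def using D.one_cl rel_diag[of "\<one>\<^bsub>B\<^esub>", folded D_one] by auto
    show "\<zero>\<^bsub>D\<^esub> \<in> E" by (rule E_zero)
    fix z assume "z \<in> E"
    then obtain r where z: "z \<in> carrier D" "rel z r" by (auto simp: E_def)
    show "c \<odot>\<^bsub>D\<^esub> z \<in> E" for c using rel_scale[OF z] z(1) by (auto simp: E_def)
    show "cadj D z \<in> E" using rel_adj[OF z] z(1) by (auto simp: E_def)
    fix w assume "w \<in> E"
    then obtain s where w: "w \<in> carrier D" "rel w s" by (auto simp: E_def)
    show "z \<oplus>\<^bsub>D\<^esub> w \<in> E" using rel_add[OF z(1) w(1) z(2) w(2)] z(1) w(1) by (auto simp: E_def)
  qed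
  have cp: "cp_map D E I f"
    unfolding cp_map_def
  proof (intro conjI ballI allI impI)
    show "f \<in> E \<rightarrow> carrier I"
      using f by (fastforce simp: E_def rel_def)
    fix z assume z: "z \<in> E"
    then obtain r where r: "rel z r" "r \<in> carrier B" "z \<in> carrier D" by (auto simp: E_def rel_def)
    show "f (c \<odot>\<^bsub>D\<^esub> z) = c \<odot>\<^bsub>I\<^esub> f z" for c
      using r f[OF r(1)] f[OF rel_scale[OF r(3,1)]] by (simp add: \<iota>.hom_scale)
    fix w assume w: "w \<in> E"
    then obtain s where s: "rel w s" "s \<in> carrier B" "w \<in> carrier D" by (auto simp: E_def rel_def)
    show "f (z \<oplus>\<^bsub>D\<^esub> w) = f z \<oplus>\<^bsub>I\<^esub> f w"
      using r s f[OF r(1)] f[OF s(1)] f[OF rel_add[OF r(3) s(3) r(1) s(1)]] by (simp add: \<iota>.hom_add)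
  next
    fix n and X :: "nat \<Rightarrow> nat \<Rightarrow> 'c \<Rightarrow> 'c \<Rightarrow> complex"
    assume XE: "\<forall>i<n. \<forall>j<n. X i j \<in> E" and pos: "mat_positive D n X"
    from XE obtain r where r: "\<And>i j. i < n \<Longrightarrow> j < n \<Longrightarrow> rel (X i j) (r i j)"
      unfolding E_def by simp metis
    have X: "X i j \<in> carrier D" if "i < n" "j < n" for i j using XE that by (auto simp: E_def)
    have rB: "r i j \<in> carrier B" if "i < n" "j < n" for i j using r[OF that] by (simp add: rel_def)
    obtain Y where Y: "\<And>i j. i < n \<Longrightarrow> j < n \<Longrightarrow> Y i j \<in> carrier D"
      and XY: "\<And>i j. i < n \<Longrightarrow> j < n \<Longrightarrow> X i j = csum D (\<lambda>k. cadj D (Y k i) \<otimes>\<^bsub>D\<^esub> Y k j) n"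
      using pos unfolding mat_positive_def by blast
    \<comment> \<open>On vectors with entries b_i k the matrix r acts like the first coordinates of
      X if k is in K and like the second ones if k is in M. Both coordinate matrices are positive,
      so \<open>pos_gram\<close> supplies the test.\<close>
    have "mat_positive B n r"
    proof (rule mat_positive_test[OF B.unital_cstar_axioms I.unital_cstar_axioms hom inj, of "K \<union> M"])
      show "K \<union> M \<subseteq> carrier B" using KM by blast
      fix i j assume ij: "i < n" "j < n"
      have "X j i = cadj D (X i j)"
        using ij Y by (auto simp: XY D.csum_adj D.adj_prod intro!: D.csum_cong)
      then have "rel (X j i) (cadj B (r i j))"
        using rel_adj[OF X[OF ij] r[OF ij]] by simp
      then have "r j i = cadj B (r i j)" using rel_unique r ij by blast
      then show "cadj B (r j i) = r i j" using rB ij by simp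
    next
      fix k b assume k: "k \<in> K \<union> M" and b: "\<And>i. i < n \<Longrightarrow> b i \<in> carrier B"
      have kB: "k \<in> carrier B" using k KB MB by blast
      obtain p where p: "star_hom D I p" "p = p\<^sub>1 \<and> k \<in> K \<or> p = p\<^sub>2 \<and> k \<in> M"
        using k ph by blast
      interpret p: cstar_hom D I p by unfold_locales (rule p(1))
      have act: "\<iota> (r i l \<otimes>\<^bsub>B\<^esub> (b l \<otimes>\<^bsub>B\<^esub> k)) = p (X i l) \<otimes>\<^bsub>I\<^esub> \<iota> (b l \<otimes>\<^bsub>B\<^esub> k)"
        if "i < n" "l < n" for i l
        using p(2) r[OF that] KM(3,4) b[OF that(2)] by (auto simp: rel_def)
      have "I.pos (csum I (\<lambda>i. cadj I (\<iota> (b i \<otimes>\<^bsub>B\<^esub> k)) \<otimes>\<^bsub>I\<^esub>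
          csum I (\<lambda>l. p (X i l) \<otimes>\<^bsub>I\<^esub> \<iota> (b l \<otimes>\<^bsub>B\<^esub> k)) n) n)"
        by (rule I.pos_gram[where Y = "\<lambda>i j. p (Y i j)"])
          (use Y b kB in \<open>auto simp: XY p.hom_csum p.hom_mult p.hom_adj intro!: I.csum_cong\<close>)
      also have "csum I (\<lambda>i. cadj I (\<iota> (b i \<otimes>\<^bsub>B\<^esub> k)) \<otimes>\<^bsub>I\<^esub>
          csum I (\<lambda>l. p (X i l) \<otimes>\<^bsub>I\<^esub> \<iota> (b l \<otimes>\<^bsub>B\<^esub> k)) n) n
        = \<iota> (csum B (\<lambda>i. cadj B (b i \<otimes>\<^bsub>B\<^esub> k) \<otimes>\<^bsub>B\<^esub>
            csum B (\<lambda>l. r i l \<otimes>\<^bsub>B\<^esub> (b l \<otimes>\<^bsub>B\<^esub> k)) n) n)"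
        (is "csum I ?g n = \<iota> (csum B ?h n)")
      proof -
        have h: "?h i \<in> carrier B" if "i < n" for i
          using that b kB rB by (intro B.mult_cl B.adj_cl B.csum_cl) auto
        have "?g i = \<iota> (?h i)" if i: "i < n" for i
        proof -
          have "csum I (\<lambda>l. p (X i l) \<otimes>\<^bsub>I\<^esub> \<iota> (b l \<otimes>\<^bsub>B\<^esub> k)) n
              = csum I (\<lambda>l. \<iota> (r i l \<otimes>\<^bsub>B\<^esub> (b l \<otimes>\<^bsub>B\<^esub> k))) n"
            by (rule I.csum_cong) (use act i in auto)
          also have "\<dots> = \<iota> (csum B (\<lambda>l. r i l \<otimes>\<^bsub>B\<^esub> (b l \<otimes>\<^bsub>B\<^esub> k)) n)"
            by (rule \<iota>.hom_csum[symmetric]) (use b kB rB i in auto)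
          finally have eq: "csum I (\<lambda>l. p (X i l) \<otimes>\<^bsub>I\<^esub> \<iota> (b l \<otimes>\<^bsub>B\<^esub> k)) n = \<dots>" .
          have "csum B (\<lambda>l. r i l \<otimes>\<^bsub>B\<^esub> (b l \<otimes>\<^bsub>B\<^esub> k)) n \<in> carrier B"
            using b kB rB i by (intro B.csum_cl) auto
          then show ?thesis
            unfolding eq using b[OF i] kB
            by (simp add: \<iota>.hom_adj[symmetric] \<iota>.hom_mult[symmetric] del: B.adj_prod)
        qed
        then have "csum I ?g n = csum I (\<lambda>i. \<iota> (?h i)) n" by (rule I.csum_cong)
        also have "\<dots> = \<iota> (csum B ?h n)" by (rule \<iota>.hom_csum[symmetric]) (rule h)
        finally show ?thesis .
      qed
      finally show "I.pos \<dots>" .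
    qed (use ess rB in auto)
    then have "mat_positive I n (\<lambda>i j. \<iota> (r i j))" by (rule \<iota>.hom_mat_positive)
    then show "mat_positive I n (\<lambda>i j. f (X i j))"
      unfolding mat_positive_def using f[OF r] by simp
  qed
  have f_ucp: "ucp_map D E I f"
    unfolding ucp_map_def using cp f[OF rel_diag[of "\<one>\<^bsub>B\<^esub>"]] D_one \<iota>_one by simp
  have "operator_system D (carrier D)" "E \<subseteq> carrier D"
    by (auto simp: operator_system_def csubspace_def E_def)
  then have prem: "cstar_algebra D \<and> cunital D \<and> operator_system D E \<and>
      operator_system D (carrier D) \<and> E \<subseteq> carrier D \<and> ucp_map D E I f"
    using sub D.cstar_algebra_axioms D.unital f_ucp by simp
  have "\<exists>g. ucp_map D (carrier D) I g \<and> (\<forall>x\<in>E. g x = f x)"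
    using inj_I[unfolded injective_cstar_def, THEN conjunct2, THEN conjunct2, rule_format, OF prem] .
  then obtain g where g: "ucp_map D (carrier D) I g" and gf: "\<And>z. z \<in> E \<Longrightarrow> g z = f z"
    by blast
  have g_cp: "cp_map D (carrier D) I g" and g_one: "g \<one>\<^bsub>D\<^esub> = \<one>\<^bsub>I\<^esub>"
    using g by (auto simp: ucp_map_def)
  have g_cl: "g z \<in> carrier I" if "z \<in> carrier D" for z
    using g_cp that by (auto simp: cp_map_def)
  have g_add: "g (z \<oplus>\<^bsub>D\<^esub> w) = g z \<oplus>\<^bsub>I\<^esub> g w" if "z \<in> carrier D" "w \<in> carrier D" for z w
    using g_cp that by (auto simp: cp_map_def)
  have q_cl: "q s t \<in> carrier D" if "s \<in> carrier I" "t \<in> carrier I" for s t using q that by blast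
  have q_add: "q s t \<oplus>\<^bsub>D\<^esub> q s' t' = q (s \<oplus>\<^bsub>I\<^esub> s') (t \<oplus>\<^bsub>I\<^esub> t')"
    and q_mult: "q s t \<otimes>\<^bsub>D\<^esub> q s' t' = q (s \<otimes>\<^bsub>I\<^esub> s') (t \<otimes>\<^bsub>I\<^esub> t')"
    if "s \<in> carrier I" "t \<in> carrier I" "s' \<in> carrier I" "t' \<in> carrier I" for s t s' t'
    using q that
    by (auto intro!: p_eq simp: p\<^sub>1.hom_add p\<^sub>2.hom_add p\<^sub>1.hom_mult p\<^sub>2.hom_mult)
  have q_scale: "c \<odot>\<^bsub>D\<^esub> q s t = q (c \<odot>\<^bsub>I\<^esub> s) (c \<odot>\<^bsub>I\<^esub> t)"
    and q_adj: "cadj D (q s t) = q (cadj I s) (cadj I t)"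
    if "s \<in> carrier I" "t \<in> carrier I" for c s t
    using q that
    by (auto intro!: p_eq simp: p\<^sub>1.hom_scale p\<^sub>2.hom_scale p\<^sub>1.hom_adj p\<^sub>2.hom_adj)
  have q_zero: "q \<zero>\<^bsub>I\<^esub> \<zero>\<^bsub>I\<^esub> = \<zero>\<^bsub>D\<^esub>" using q by (auto intro!: p_eq)
  \<comment> \<open>The diagonal embedding is a homomorphism, and composed with g it fixes every
    \<iota> b. Rigidity can therefore be applied to it.\<close>
  have "ucp_map I (carrier I) I (\<lambda>z. g (q z z))"
    unfolding ucp_map_def cp_map_def
  proof (intro conjI allI ballI impI)
    show "(\<lambda>z. g (q z z)) \<in> carrier I \<rightarrow> carrier I" using g_cl q_cl by auto
    show "g (q \<one>\<^bsub>I\<^esub> \<one>\<^bsub>I\<^esub>) = \<one>\<^bsub>I\<^esub>" using D_one g_one \<iota>_one by simp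
    fix z assume z: "z \<in> carrier I"
    show "g (q (c \<odot>\<^bsub>I\<^esub> z) (c \<odot>\<^bsub>I\<^esub> z)) = c \<odot>\<^bsub>I\<^esub> g (q z z)" for c
      using g_cp q_cl z by (auto simp: cp_map_def q_scale[symmetric])
    show "g (q (z \<oplus>\<^bsub>I\<^esub> w) (z \<oplus>\<^bsub>I\<^esub> w)) = g (q z z) \<oplus>\<^bsub>I\<^esub> g (q w w)" if "w \<in> carrier I" for w
      using z that by (simp add: q_add[symmetric] g_add q_cl)
  next
    fix n and X :: "nat \<Rightarrow> nat \<Rightarrow> 'c"
    assume X: "\<forall>i<n. \<forall>j<n. X i j \<in> carrier I" and "mat_positive I n X"
    then obtain Y where Y: "\<forall>i<n. \<forall>j<n. Y i j \<in> carrier I"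
      and XY: "\<forall>i<n. \<forall>j<n. X i j = csum I (\<lambda>k. cadj I (Y k i) \<otimes>\<^bsub>I\<^esub> Y k j) n"
      unfolding mat_positive_def by blast
    have q_csum: "q (csum I u m) (csum I u m) = csum D (\<lambda>k. q (u k) (u k)) m"
      if "\<And>k. k < m \<Longrightarrow> u k \<in> carrier I" for u m
      using that by (induction m) (simp_all add: q_zero q_add[symmetric])
    have "mat_positive D n (\<lambda>i j. q (X i j) (X i j))"
      unfolding mat_positive_def
      by (rule exI[of _ "\<lambda>i j. q (Y i j) (Y i j)"])
        (use XY Y q_cl in \<open>auto simp: q_csum q_adj q_mult intro!: D.csum_cong\<close>)
    then show "mat_positive I n (\<lambda>i j. g (q (X i j) (X i j)))"
      using g_cp X q_cl unfolding cp_map_def by simp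
  qed
  then have diag: "g (q z z) = z" if "z \<in> carrier I" for z
  proof (rule rigid)
    show "g (q (\<iota> b) (\<iota> b)) = \<iota> b" if "b \<in> carrier B" for b
      using gf[of "q (\<iota> b) (\<iota> b)"] f[OF rel_diag[OF that]] rel_diag[OF that] q_cl that
      by (auto simp: E_def)
  qed fact
  \<comment> \<open>As g restricts to a homomorphism on the diagonal, diagonal elements lie in its
    multiplicative domain: this is \<open>cp_map_module\<close> with the unit as
    \<open>b\<^sub>0\<close>.\<close>
  have bilinear: "g (q z z \<otimes>\<^bsub>D\<^esub> w) = z \<otimes>\<^bsub>I\<^esub> g w" "g (w \<otimes>\<^bsub>D\<^esub> q z z) = g w \<otimes>\<^bsub>I\<^esub> z"
    if z: "z \<in> carrier I" and w: "w \<in> carrier D" for z w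
  proof -
    have *: "g (cadj D (q u u) \<otimes>\<^bsub>D\<^esub> v) = cadj I u \<otimes>\<^bsub>I\<^esub> g (cadj D \<one>\<^bsub>D\<^esub> \<otimes>\<^bsub>D\<^esub> v)"
      "g (cadj D v \<otimes>\<^bsub>D\<^esub> q u u) = g (cadj D v \<otimes>\<^bsub>D\<^esub> \<one>\<^bsub>D\<^esub>) \<otimes>\<^bsub>I\<^esub> u"
      if "u \<in> carrier I" "v \<in> carrier D" for u v
      by (rule cp_map_module[OF D.normed_star_axioms I.unital_cstar_axioms g_cp];
          use that q_cl in \<open>simp add: g_one diag q_adj q_mult\<close>)+
    show "g (q z z \<otimes>\<^bsub>D\<^esub> w) = z \<otimes>\<^bsub>I\<^esub> g w"
      using *(1)[of "cadj I z" w] z w by (simp add: q_adj)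
    show "g (w \<otimes>\<^bsub>D\<^esub> q z z) = g w \<otimes>\<^bsub>I\<^esub> z"
      using *(2)[of z "cadj D w"] z w by simp
  qed
  \<comment> \<open>The pair (0, x) acts as 0 on K through its first coordinate and on M through its
    second one, so it is related to r = 0; symmetrically for (y, 0) below.\<close>
  have gx: "g (q \<zero>\<^bsub>I\<^esub> x) = \<zero>\<^bsub>I\<^esub>"
  proof -
    have "rel (q \<zero>\<^bsub>I\<^esub> x) \<zero>\<^bsub>B\<^esub>" using q[of "\<zero>\<^bsub>I\<^esub>" x] x KB MB by (simp add: rel_def)
    moreover have "q \<zero>\<^bsub>I\<^esub> x \<in> carrier D" using q_cl x(1) by simp
    ultimately have "g (q \<zero>\<^bsub>I\<^esub> x) = \<iota> \<zero>\<^bsub>B\<^esub>" using f gf[of "q \<zero>\<^bsub>I\<^esub> x"] unfolding E_def by auto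
    then show ?thesis by simp
  qed
  have gy: "g (q y \<zero>\<^bsub>I\<^esub>) = \<zero>\<^bsub>I\<^esub>"
  proof -
    have "rel (q y \<zero>\<^bsub>I\<^esub>) \<zero>\<^bsub>B\<^esub>" using q[of y "\<zero>\<^bsub>I\<^esub>"] y KB MB by (simp add: rel_def)
    moreover have "q y \<zero>\<^bsub>I\<^esub> \<in> carrier D" using q_cl y(1) by simp
    ultimately have "g (q y \<zero>\<^bsub>I\<^esub>) = \<iota> \<zero>\<^bsub>B\<^esub>" using f gf[of "q y \<zero>\<^bsub>I\<^esub>"] unfolding E_def by auto
    then show ?thesis by simp
  qed
  have split: "g (q s s) = g (q s \<zero>\<^bsub>I\<^esub>) \<oplus>\<^bsub>I\<^esub> g (q \<zero>\<^bsub>I\<^esub> s)" if "s \<in> carrier I" for s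
    using that g_add[of "q s \<zero>\<^bsub>I\<^esub>" "q \<zero>\<^bsub>I\<^esub> s"] q_cl by (simp add: q_add)
  \<comment> \<open>This gives x y = g(x y, x y) = g(x y, 0) + g(0, x y) = x g(y, 0) + g(0, x) y =
    0, and likewise for y x.\<close>
  have "g (q (x \<otimes>\<^bsub>I\<^esub> y) \<zero>\<^bsub>I\<^esub>) = x \<otimes>\<^bsub>I\<^esub> g (q y \<zero>\<^bsub>I\<^esub>)" "g (q \<zero>\<^bsub>I\<^esub> (x \<otimes>\<^bsub>I\<^esub> y)) = g (q \<zero>\<^bsub>I\<^esub> x) \<otimes>\<^bsub>I\<^esub> y"
    "g (q (y \<otimes>\<^bsub>I\<^esub> x) \<zero>\<^bsub>I\<^esub>) = g (q y \<zero>\<^bsub>I\<^esub>) \<otimes>\<^bsub>I\<^esub> x" "g (q \<zero>\<^bsub>I\<^esub> (y \<otimes>\<^bsub>I\<^esub> x)) = y \<otimes>\<^bsub>I\<^esub> g (q \<zero>\<^bsub>I\<^esub> x)"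
    using x(1) y(1) q_cl by (simp_all add: bilinear[symmetric] q_mult)
  then show "x \<otimes>\<^bsub>I\<^esub> y = \<zero>\<^bsub>I\<^esub>" "y \<otimes>\<^bsub>I\<^esub> x = \<zero>\<^bsub>I\<^esub>"
    using split[of "x \<otimes>\<^bsub>I\<^esub> y"] split[of "y \<otimes>\<^bsub>I\<^esub> x"] x(1) y(1) by (simp_all add: gx gy diag)
qed

section \<open>Unitizations\<close>

lemma unitization_sel:
  "z \<in> carrier (unitization A) \<longleftrightarrow> fst z \<in> carrier A"
  "\<zero>\<^bsub>unitization A\<^esub> = (\<zero>\<^bsub>A\<^esub>, 0)"
  "z \<oplus>\<^bsub>unitization A\<^esub> w = (fst z \<oplus>\<^bsub>A\<^esub> fst w, snd z + snd w)"
  "k \<odot>\<^bsub>unitization A\<^esub> z = (k \<odot>\<^bsub>A\<^esub> fst z, k * snd z)"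
  "z \<ominus>\<^bsub>unitization A\<^esub> w = (fst z \<ominus>\<^bsub>A\<^esub> fst w, snd z - snd w)"
  "z \<otimes>\<^bsub>unitization A\<^esub> w
    = (fst z \<otimes>\<^bsub>A\<^esub> fst w \<oplus>\<^bsub>A\<^esub> snd w \<odot>\<^bsub>A\<^esub> fst z \<oplus>\<^bsub>A\<^esub> snd z \<odot>\<^bsub>A\<^esub> fst w, snd z * snd w)"
  "cadj (unitization A) z = (cadj A (fst z), cnj (snd z))"
  by (auto simp: unitization_def cdiff_def mem_Times_iff split: prod.splits)

text \<open>Left multiplication on the original algebra; its operator norm is the norm of
  \<open>unitization A\<close>.\<close>

definition mult_op :: "'a cstar \<Rightarrow> 'a \<times> complex \<Rightarrow> 'a \<Rightarrow> 'a" where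
  "mult_op A z y = fst z \<otimes>\<^bsub>A\<^esub> y \<oplus>\<^bsub>A\<^esub> snd z \<odot>\<^bsub>A\<^esub> y"

lemma unitization_norm:
  "cnorm (unitization A) z = (SUP y\<in>{y\<in>carrier A. cnorm A y \<le> 1}. cnorm A (mult_op A z y))"
  by (simp add: unitization_def mult_op_def split: prod.splits)

locale nonunital_cstar = cstar_algebra +
  assumes nonunital: "\<not> cunital A"
begin

abbreviation U where "U \<equiv> unitization A"

lemma op_cl [simp, intro]: "z \<in> carrier U \<Longrightarrow> y \<in> carrier A \<Longrightarrow> mult_op A z y \<in> carrier A"
  by (simp add: mult_op_def unitization_sel)

lemma op_scale: "z \<in> carrier U \<Longrightarrow> y \<in> carrier A \<Longrightarrow> mult_op A z (c \<odot> y) = c \<odot> mult_op A z y"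
  by (simp add: mult_op_def unitization_sel s_add mult.commute)

lemma op_add: "z \<in> carrier U \<Longrightarrow> w \<in> carrier U \<Longrightarrow> y \<in> carrier A
    \<Longrightarrow> mult_op A (z \<oplus>\<^bsub>U\<^esub> w) y = mult_op A z y \<oplus> mult_op A w y"
  by (simp add: mult_op_def unitization_sel add_s r_distr a_ac)

lemma scale_op: "z \<in> carrier U \<Longrightarrow> y \<in> carrier A \<Longrightarrow> mult_op A (c \<odot>\<^bsub>U\<^esub> z) y = c \<odot> mult_op A z y"
  by (simp add: mult_op_def unitization_sel s_add)

lemma op_mult: "z \<in> carrier U \<Longrightarrow> w \<in> carrier U \<Longrightarrow> y \<in> carrier A
    \<Longrightarrow> mult_op A (z \<otimes>\<^bsub>U\<^esub> w) y = mult_op A z (mult_op A w y)"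
  by (simp add: mult_op_def unitization_sel s_add l_distr r_distr m_assoc a_ac)

text \<open>Carries the C*-identity of A over to operator norms: ||z y||^2 is bounded by ||y|| times
  the norm of (z^* z) y.\<close>

lemma star_op: "z \<in> carrier U \<Longrightarrow> y \<in> carrier A
    \<Longrightarrow> cadj A (mult_op A z y) \<otimes> mult_op A z y = cadj A y \<otimes> mult_op A (cadj U z \<otimes>\<^bsub>U\<^esub> z) y"
  by (simp add: mult_op_def unitization_sel adj_sum adj_prod s_add l_distr r_distr m_assoc a_ac mult.commute)

lemma op_bound:
  assumes "z \<in> carrier U" "y \<in> carrier A"
  shows "cnorm A (mult_op A z y) \<le> (cnorm A (fst z) + cmod (snd z)) * cnorm A y"
proof -
  have z: "fst z \<in> carrier A" using assms by (simp add: unitization_sel)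
  have "cnorm A (mult_op A z y) \<le> cnorm A (fst z \<otimes> y) + cnorm A (snd z \<odot> y)"
    unfolding mult_op_def using z assms norm_add by simp
  then show ?thesis
    using z assms norm_prod[of "fst z" y] by (simp add: norm_s algebra_simps)
qed

lemma bdd_op:
  assumes z: "z \<in> carrier U"
  shows "bdd_above ((\<lambda>y. cnorm A (mult_op A z y)) ` {y\<in>carrier A. cnorm A y \<le> 1})"
proof (rule bdd_aboveI2)
  fix y assume y: "y \<in> {y\<in>carrier A. cnorm A y \<le> 1}"
  have "cnorm A (mult_op A z y) \<le> (cnorm A (fst z) + cmod (snd z)) * cnorm A y"
    using op_bound[OF z] y by simp
  also have "\<dots> \<le> cnorm A (fst z) + cmod (snd z)"
    using y z by (intro mult_left_le) (auto simp: unitization_sel)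
  finally show "cnorm A (mult_op A z y) \<le> cnorm A (fst z) + cmod (snd z)" .
qed

lemma norm_U_ge_0:
  assumes z: "z \<in> carrier U"
  shows "0 \<le> cnorm U z"
  unfolding unitization_norm
  by (rule cSUP_upper2[OF bdd_op[OF z], of \<zero>]) (use z in auto)

lemma norm_op_le:
  assumes z: "z \<in> carrier U" and y: "y \<in> carrier A"
  shows "cnorm A (mult_op A z y) \<le> cnorm U z * cnorm A y"
proof (cases "y = \<zero>")
  case True
  then show ?thesis using z by (simp add: mult_op_def unitization_sel)
next
  case False
  define t where "t = cnorm A y"
  have t: "t > 0" using False y norm_0_iff[of y] norm_ge_0[of y] by (simp add: t_def less_le)
  define w where "w = complex_of_real (1/t) \<odot> y"
  have w: "w \<in> carrier A" "cnorm A w \<le> 1" using y t by (auto simp: w_def norm_s norm_divide t_def)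
  have "cnorm A (mult_op A z w) \<le> cnorm U z"
    unfolding unitization_norm by (rule cSUP_upper[OF _ bdd_op[OF z]]) (use w in auto)
  then show ?thesis
    using t z y by (simp add: w_def op_scale norm_s norm_divide t_def field_simps)
qed

lemma norm_U_le:
  assumes "z \<in> carrier U" "0 \<le> C" "\<And>y. y \<in> carrier A \<Longrightarrow> cnorm A (mult_op A z y) \<le> C * cnorm A y"
  shows "cnorm U z \<le> C"
  unfolding unitization_norm
proof (rule cSUP_least)
  show "{y \<in> carrier A. cnorm A y \<le> 1} \<noteq> {}" using norm_zero by (auto intro!: exI[of _ \<zero>])
  fix y assume "y \<in> {y \<in> carrier A. cnorm A y \<le> 1}"
  then show "cnorm A (mult_op A z y) \<le> C"
    using assms(3)[of y] mult_left_mono[of "cnorm A y" 1 C] assms(2) by fastforce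
qed

text \<open>This is where A must have no unit: a nonzero scalar part c would make -x/c a left unit,
  its adjoint a right unit, and so both a unit of A. It gives definiteness of the operator
  norm.\<close>

lemma op_eq_0:
  assumes z: "z \<in> carrier U" and 0: "\<And>y. y \<in> carrier A \<Longrightarrow> mult_op A z y = \<zero>"
  shows "z = \<zero>\<^bsub>U\<^esub>"
proof -
  have x: "fst z \<in> carrier A" using z by (simp add: unitization_sel)
  have c: "snd z = 0"
  proof (rule ccontr)
    assume c: "snd z \<noteq> 0"
    define e where "e = (- 1 / snd z) \<odot> fst z"
    have e: "e \<in> carrier A" using x by (simp add: e_def)
    have ey: "e \<otimes> y = y" if y: "y \<in> carrier A" for y
    proof -
      have "fst z \<otimes> y \<oplus> snd z \<odot> y = \<zero>" using 0[OF y] by (simp add: mult_op_def)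
      then have "fst z \<otimes> y \<ominus> (- snd z) \<odot> y = \<zero>" using x y by (simp add: cdiff_def)
      then have "fst z \<otimes> y = (- snd z) \<odot> y" using x y by (simp add: minus_0_iff)
      then show ?thesis using x y c by (simp add: e_def)
    qed
    have ye: "y \<otimes> cadj A e = y" if y: "y \<in> carrier A" for y
      using ey[of "cadj A y"] adj_prod[of e "cadj A y"] e y by simp
    have "e = cadj A e" using ey[of "cadj A e"] ye[of e] e by simp
    then have "cunit A e" using e ey ye by (simp add: cunit_def)
    then show False using nonunital by (auto simp: cunital_def)
  qed
  have "fst z \<otimes> cadj A (fst z) = \<zero>"
    using 0[of "cadj A (fst z)"] x c by (simp add: mult_op_def)
  then have "fst z = \<zero>"
    using cstar_identity[of "cadj A (fst z)"] x norm_0_iff by simp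
  then show ?thesis using c by (simp add: unitization_sel prod_eq_iff)
qed

lemma norm_U_star:
  assumes z: "z \<in> carrier U"
  shows "(cnorm U z)\<^sup>2 \<le> cnorm U (cadj U z \<otimes>\<^bsub>U\<^esub> z)"
proof -
  let ?w = "cadj U z \<otimes>\<^bsub>U\<^esub> z"
  have w: "?w \<in> carrier U" using z by (simp add: unitization_sel)
  have "cnorm U z \<le> sqrt (cnorm U ?w)"
  proof (rule norm_U_le[OF z])
    fix y assume y: "y \<in> carrier A"
    have "(cnorm A (mult_op A z y))\<^sup>2 = cnorm A (cadj A y \<otimes> mult_op A ?w y)"
      using cstar_identity[of "mult_op A z y"] z y by (simp add: star_op)
    also have "\<dots> \<le> cnorm A y * cnorm A (mult_op A ?w y)"
      using norm_prod[of "cadj A y" "mult_op A ?w y"] w y by simp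
    also have "\<dots> \<le> cnorm A y * (cnorm U ?w * cnorm A y)"
      using norm_op_le[OF w y] y by (intro mult_left_mono) auto
    also have "\<dots> = (sqrt (cnorm U ?w) * cnorm A y)\<^sup>2"
      using norm_U_ge_0[OF w] by (simp add: power_mult_distrib power2_eq_square)
    finally show "cnorm A (mult_op A z y) \<le> sqrt (cnorm U ?w) * cnorm A y"
      using y norm_U_ge_0[OF w] by (meson norm_ge_0 mult_nonneg_nonneg power2_le_imp_le real_sqrt_ge_zero)
  qed (use norm_U_ge_0[OF w] in simp)
  then have "(cnorm U z)\<^sup>2 \<le> (sqrt (cnorm U ?w))\<^sup>2"
    using norm_U_ge_0[OF z] by (rule power_mono)
  then show ?thesis using norm_U_ge_0[OF w] by simp
qed

lemma norm_U_mult: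
  assumes z: "z \<in> carrier U" and w: "w \<in> carrier U"
  shows "cnorm U (z \<otimes>\<^bsub>U\<^esub> w) \<le> cnorm U z * cnorm U w"
proof (rule norm_U_le)
  fix y assume y: "y \<in> carrier A"
  have "cnorm A (mult_op A z (mult_op A w y)) \<le> cnorm U z * cnorm A (mult_op A w y)"
    using norm_op_le[OF z] w y by simp
  also have "\<dots> \<le> cnorm U z * (cnorm U w * cnorm A y)"
    by (intro mult_left_mono norm_op_le norm_U_ge_0 z w y)
  finally show "cnorm A (mult_op A (z \<otimes>\<^bsub>U\<^esub> w) y) \<le> cnorm U z * cnorm U w * cnorm A y"
    using z w y by (simp add: op_mult)
qed (use z w norm_U_ge_0 in \<open>auto simp: unitization_sel\<close>)

lemma norm_U_adj:
  assumes z: "z \<in> carrier U"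
  shows "cnorm U (cadj U z) = cnorm U z"
proof -
  have *: "cnorm U w \<le> cnorm U (cadj U w)" if w: "w \<in> carrier U" for w
  proof (cases "cnorm U w = 0")
    case True
    then show ?thesis using norm_U_ge_0[of "cadj U w"] w by (simp add: unitization_sel)
  next
    case False
    have "cnorm U w * cnorm U w \<le> cnorm U (cadj U w) * cnorm U w"
      using norm_U_star[OF w] norm_U_mult[of "cadj U w" w] w
      by (simp add: power2_eq_square unitization_sel)
    then show ?thesis using False norm_U_ge_0[OF w] by simp
  qed
  have "cadj U (cadj U z) = z" using z by (simp add: unitization_sel)
  then show ?thesis using *[OF z] *[of "cadj U z"] z by (simp add: unitization_sel)
qed

lemma normed_star_U: "normed_star U"
proof
  fix z w v and c d :: complex
  show "\<zero>\<^bsub>U\<^esub> \<in> carrier U" by (simp add: unitization_sel)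
  assume z: "z \<in> carrier U"
  show "c \<odot>\<^bsub>U\<^esub> z \<in> carrier U" "cadj U z \<in> carrier U" "z \<oplus>\<^bsub>U\<^esub> \<zero>\<^bsub>U\<^esub> = z" "z \<ominus>\<^bsub>U\<^esub> z = \<zero>\<^bsub>U\<^esub>"
    "(c + d) \<odot>\<^bsub>U\<^esub> z = c \<odot>\<^bsub>U\<^esub> z \<oplus>\<^bsub>U\<^esub> d \<odot>\<^bsub>U\<^esub> z" "c \<odot>\<^bsub>U\<^esub> d \<odot>\<^bsub>U\<^esub> z = (c * d) \<odot>\<^bsub>U\<^esub> z"
    "1 \<odot>\<^bsub>U\<^esub> z = z" "cadj U (c \<odot>\<^bsub>U\<^esub> z) = cnj c \<odot>\<^bsub>U\<^esub> cadj U z" "cadj U (cadj U z) = z"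
    using z by (auto simp: unitization_sel add_s algebra_simps prod_eq_iff)
  show "0 \<le> cnorm U z" by (rule norm_U_ge_0[OF z])
  show "cnorm U (cadj U z) = cnorm U z" by (rule norm_U_adj[OF z])
  have "cnorm U z = 0 \<Longrightarrow> z = \<zero>\<^bsub>U\<^esub>"
    using norm_op_le[OF z] norm_ge_0 norm_0_iff z op_cl
    by (intro op_eq_0[OF z]) (metis mult_zero_left order_antisym)
  moreover have "cnorm U \<zero>\<^bsub>U\<^esub> = 0"
    by (intro antisym norm_U_ge_0 norm_U_le) (auto simp: unitization_sel mult_op_def)
  ultimately show "cnorm U z = 0 \<longleftrightarrow> z = \<zero>\<^bsub>U\<^esub>" by blast
  have scale: "cnorm U (k \<odot>\<^bsub>U\<^esub> w) \<le> cmod k * cnorm U w" if w: "w \<in> carrier U" for k w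
  proof (rule norm_U_le)
    fix y assume "y \<in> carrier A"
    then show "cnorm A (mult_op A (k \<odot>\<^bsub>U\<^esub> w) y) \<le> cmod k * cnorm U w * cnorm A y"
      using norm_op_le[OF w] w by (simp add: scale_op norm_s mult.assoc mult_left_mono)
  qed (use w norm_U_ge_0 in \<open>auto simp: unitization_sel\<close>)
  show "cnorm U (c \<odot>\<^bsub>U\<^esub> z) = cmod c * cnorm U z"
  proof (cases "c = 0")
    case True
    then have "c \<odot>\<^bsub>U\<^esub> z = \<zero>\<^bsub>U\<^esub>" using z by (simp add: unitization_sel)
    then show ?thesis using True \<open>cnorm U \<zero>\<^bsub>U\<^esub> = 0\<close> by simp
  next
    case False
    have cz: "c \<odot>\<^bsub>U\<^esub> z \<in> carrier U" using z by (simp add: unitization_sel)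
    have "(1 / c) \<odot>\<^bsub>U\<^esub> (c \<odot>\<^bsub>U\<^esub> z) = z" using z False by (simp add: unitization_sel)
    then have "cnorm U z \<le> cmod (1 / c) * cnorm U (c \<odot>\<^bsub>U\<^esub> z)" using scale[OF cz, of "1 / c"] by simp
    then have "cmod c * cnorm U z \<le> cnorm U (c \<odot>\<^bsub>U\<^esub> z)"
      using False by (simp add: norm_divide field_simps)
    then show ?thesis using scale[OF z, of c] by simp
  qed
  assume w: "w \<in> carrier U"
  show "z \<oplus>\<^bsub>U\<^esub> w \<in> carrier U" "z \<otimes>\<^bsub>U\<^esub> w \<in> carrier U" "z \<oplus>\<^bsub>U\<^esub> w = w \<oplus>\<^bsub>U\<^esub> z"
    "c \<odot>\<^bsub>U\<^esub> (z \<oplus>\<^bsub>U\<^esub> w) = c \<odot>\<^bsub>U\<^esub> z \<oplus>\<^bsub>U\<^esub> c \<odot>\<^bsub>U\<^esub> w"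
    "cadj U (z \<oplus>\<^bsub>U\<^esub> w) = cadj U z \<oplus>\<^bsub>U\<^esub> cadj U w"
    "(c \<odot>\<^bsub>U\<^esub> z) \<otimes>\<^bsub>U\<^esub> w = c \<odot>\<^bsub>U\<^esub> (z \<otimes>\<^bsub>U\<^esub> w)" "z \<otimes>\<^bsub>U\<^esub> (c \<odot>\<^bsub>U\<^esub> w) = c \<odot>\<^bsub>U\<^esub> (z \<otimes>\<^bsub>U\<^esub> w)"
    "cadj U (z \<otimes>\<^bsub>U\<^esub> w) = cadj U w \<otimes>\<^bsub>U\<^esub> cadj U z"
    using z w by (auto simp: unitization_sel s_add a_ac adj_sum adj_prod algebra_simps)
  show "cnorm U (z \<otimes>\<^bsub>U\<^esub> w) \<le> cnorm U z * cnorm U w" by (rule norm_U_mult[OF z w])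
  show "cnorm U (z \<oplus>\<^bsub>U\<^esub> w) \<le> cnorm U z + cnorm U w"
  proof (rule norm_U_le)
    fix y assume y: "y \<in> carrier A"
    have "cnorm A (mult_op A (z \<oplus>\<^bsub>U\<^esub> w) y) \<le> cnorm A (mult_op A z y) + cnorm A (mult_op A w y)"
      using norm_add z w y by (simp add: op_add)
    also have "\<dots> \<le> cnorm U z * cnorm A y + cnorm U w * cnorm A y"
      by (intro add_mono norm_op_le z w y)
    finally show "cnorm A (mult_op A (z \<oplus>\<^bsub>U\<^esub> w) y) \<le> (cnorm U z + cnorm U w) * cnorm A y"
      by (simp add: algebra_simps)
  qed (use z w norm_U_ge_0 in \<open>auto simp: unitization_sel\<close>)
  assume v: "v \<in> carrier U"
  show "z \<oplus>\<^bsub>U\<^esub> w \<oplus>\<^bsub>U\<^esub> v = z \<oplus>\<^bsub>U\<^esub> (w \<oplus>\<^bsub>U\<^esub> v)"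
    using z w v by (simp add: unitization_sel a_assoc)
  show "z \<otimes>\<^bsub>U\<^esub> w \<otimes>\<^bsub>U\<^esub> v = z \<otimes>\<^bsub>U\<^esub> (w \<otimes>\<^bsub>U\<^esub> v)"
    using z w v by (simp add: unitization_sel s_add l_distr r_distr m_assoc a_ac algebra_simps)
  show "(z \<oplus>\<^bsub>U\<^esub> w) \<otimes>\<^bsub>U\<^esub> v = z \<otimes>\<^bsub>U\<^esub> v \<oplus>\<^bsub>U\<^esub> w \<otimes>\<^bsub>U\<^esub> v"
    "z \<otimes>\<^bsub>U\<^esub> (w \<oplus>\<^bsub>U\<^esub> v) = z \<otimes>\<^bsub>U\<^esub> w \<oplus>\<^bsub>U\<^esub> z \<otimes>\<^bsub>U\<^esub> v"
    using z w v by (simp_all add: unitization_sel s_add add_s l_distr r_distr a_ac algebra_simps)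
qed

lemma norm_U_embed:
  assumes x: "x \<in> carrier A"
  shows "cnorm U (x, 0) = cnorm A x"
proof (rule antisym)
  have xU: "(x, 0) \<in> carrier U" using x by (simp add: unitization_sel)
  show "cnorm U (x, 0) \<le> cnorm A x"
    by (rule norm_U_le[OF xU]) (use x norm_prod in \<open>auto simp: mult_op_def\<close>)
  have "(cnorm A x)\<^sup>2 = cnorm A (mult_op A (x, 0) (cadj A x))"
    using cstar_identity[of "cadj A x"] x by (simp add: mult_op_def)
  also have "\<dots> \<le> cnorm U (x, 0) * cnorm A x" using norm_op_le[OF xU, of "cadj A x"] x by simp
  finally have "cnorm A x * cnorm A x \<le> cnorm U (x, 0) * cnorm A x" by (simp add: power2_eq_square)
  then show "cnorm A x \<le> cnorm U (x, 0)"
    using norm_U_ge_0[OF xU] norm_ge_0[OF x] by (cases "cnorm A x = 0") auto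
qed

lemma norm_U_scalar_le: "cnorm U (\<zero>, c) \<le> cmod c"
  by (rule norm_U_le) (auto simp: unitization_sel mult_op_def norm_s)

text \<open>Since \<open>A\<close> is complete, it is closed in its unitization.\<close>
lemma norm_U_scalar_bound:
  obtains \<delta> where "\<delta> > 0" "\<And>z. z \<in> carrier U \<Longrightarrow> \<delta> * cmod (snd z) \<le> cnorm U z"
proof -
  interpret U: normed_star U by (rule normed_star_U)
  \<comment> \<open>Otherwise some pairs (s n, 1) tend to 0, so the s n form a Cauchy sequence in A.
    For its limit l the norm of (l, 1) is 0, which the scalar part 1 forbids.\<close>
  have "\<exists>\<delta>>0. \<forall>x\<in>carrier A. \<delta> \<le> cnorm U (x, 1)"
  proof (rule ccontr)
    assume "\<not> ?thesis"
    then have "\<exists>x\<in>carrier A. cnorm U (x, 1) < 1 / real (Suc n)" for n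
      by (metis not_le of_nat_0_less_iff zero_less_Suc zero_less_divide_1_iff)
    then obtain s where s: "\<And>n. s n \<in> carrier A" "\<And>n. cnorm U (s n, 1) < 1 / real (Suc n)" by metis
    have sU: "(s n, 1) \<in> carrier U" for n using s by (simp add: unitization_sel)
    have "ccauchy A s"
      unfolding ccauchy_def
    proof (intro conjI allI impI s)
      fix e :: real assume "e > 0"
      then obtain k where k: "1 / real (Suc k) < e / 2" using nat_approx_posE[of "e / 2"] by auto
      have small: "cnorm U (s m, 1) < e / 2" if "m \<ge> k" for m
      proof -
        have "1 / real (Suc m) \<le> 1 / real (Suc k)" using that by (simp add: frac_le)
        then show ?thesis using s(2)[of m] k by linarith
      qed
      have "cnorm A (s m \<ominus> s n) < e" if "m \<ge> k" "n \<ge> k" for m n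
      proof -
        have "cnorm A (s m \<ominus> s n) = cnorm U ((s m, 1) \<ominus>\<^bsub>U\<^esub> (s n, 1))"
          using s norm_U_embed[of "s m \<ominus> s n"] by (simp add: unitization_sel)
        also have "\<dots> \<le> cnorm U (s m, 1) + cnorm U (s n, 1)"
          using U.norm_minus_le sU by blast
        finally show ?thesis using small[OF that(1)] small[OF that(2)] by linarith
      qed
      then show "\<exists>k. \<forall>m\<ge>k. \<forall>n\<ge>k. cnorm A (s m \<ominus> s n) < e" by blast
    qed
    then obtain l where l: "clim A s l" using ccauchy_clim by blast
    then have l_cl: "l \<in> carrier A" by (rule clim_D)
    have lU: "(l, 1) \<in> carrier U" using l_cl by (simp add: unitization_sel)
    have "cnorm U (l, 1) \<le> cnorm A (s n \<ominus> l) + 1 / real (Suc n)" for n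
    proof -
      have "cnorm U (l, 1) \<le> cnorm U ((l, 1) \<ominus>\<^bsub>U\<^esub> (s n, 1)) + cnorm U (s n, 1)"
        using U.norm_le_minus lU sU by blast
      also have "cnorm U ((l, 1) \<ominus>\<^bsub>U\<^esub> (s n, 1)) = cnorm A (s n \<ominus> l)"
        using norm_U_embed[of "l \<ominus> s n"] s l_cl norm_minus_comm by (simp add: unitization_sel)
      finally show ?thesis using s(2)[of n] by linarith
    qed
    moreover have "(\<lambda>n. cnorm A (s n \<ominus> l) + 1 / real (Suc n)) \<longlonglongrightarrow> 0 + 0"
      using l LIMSEQ_Suc[OF lim_1_over_n] by (intro tendsto_add) (auto simp: clim_def)
    ultimately have "cnorm U (l, 1) \<le> 0"
      using LIMSEQ_le_const by fastforce
    then have "(l, 1) = \<zero>\<^bsub>U\<^esub>" using U.norm_ge_0[OF lU] U.norm_0_iff[OF lU] by simp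
    then show False by (simp add: unitization_sel)
  qed
  then obtain \<delta> where \<delta>: "\<delta> > 0" "\<And>x. x \<in> carrier A \<Longrightarrow> \<delta> \<le> cnorm U (x, 1)" by blast
  show ?thesis
  proof (rule that[OF \<delta>(1)])
    fix z assume z: "z \<in> carrier U"
    show "\<delta> * cmod (snd z) \<le> cnorm U z"
    proof (cases "snd z = 0")
      case True
      then show ?thesis using z by simp
    next
      case False
      let ?w = "((1 / snd z) \<odot> fst z, 1 :: complex)"
      have w: "?w \<in> carrier U" using z by (simp add: unitization_sel)
      have "z = snd z \<odot>\<^bsub>U\<^esub> ?w" using z False by (simp add: unitization_sel prod_eq_iff)
      then have "cnorm U z = cmod (snd z) * cnorm U ?w" using U.norm_s[OF w] by metis
      moreover have "\<delta> \<le> cnorm U ?w" using \<delta>(2) z by (simp add: unitization_sel)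
      ultimately show ?thesis using mult_left_mono[of \<delta> "cnorm U ?w" "cmod (snd z)"] by (simp add: mult.commute)
    qed
  qed
qed

text \<open>The main point is completeness: by \<open>norm_U_scalar_bound\<close> the scalar parts
  of a Cauchy sequence are Cauchy, and then so are the components in A.\<close>

lemma cstar_algebra_U: "cstar_algebra U"
proof (rule cstar_algebraI)
  interpret U: normed_star U by (rule normed_star_U)
  show "normed_star U" by (rule normed_star_U)
  show "cnorm U (cadj U z \<otimes>\<^bsub>U\<^esub> z) = (cnorm U z)\<^sup>2" if z: "z \<in> carrier U" for z
    using norm_U_star[OF z] U.norm_prod[of "cadj U z" z] z by (simp add: power2_eq_square)
  fix s assume s: "ccauchy U s"
  then have sU: "s n \<in> carrier U" for n by (simp add: ccauchy_def)
  then have s1: "fst (s n) \<in> carrier A" for n by (simp add: unitization_sel)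
  obtain \<delta> where \<delta>: "\<delta> > 0" "\<And>z. z \<in> carrier U \<Longrightarrow> \<delta> * cmod (snd z) \<le> cnorm U z"
    by (rule norm_U_scalar_bound) (rule that; assumption)
  have snd_le: "cmod (snd (s m) - snd (s n)) \<le> cnorm U (s m \<ominus>\<^bsub>U\<^esub> s n) / \<delta>" for m n
    using \<delta>(2)[of "s m \<ominus>\<^bsub>U\<^esub> s n"] \<delta>(1) sU U.minus_cl
    by (simp add: unitization_sel(5) pos_le_divide_eq mult.commute)
  have fst_le: "cnorm A (fst (s m) \<ominus> fst (s n)) \<le> cnorm U (s m \<ominus>\<^bsub>U\<^esub> s n) * (1 + 1 / \<delta>)" for m n
  proof -
    let ?z = "s m \<ominus>\<^bsub>U\<^esub> s n" and ?c = "(\<zero>, snd (s m) - snd (s n))"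
    have "(fst (s m) \<ominus> fst (s n), 0) = ?z \<ominus>\<^bsub>U\<^esub> ?c"
      using s1 by (simp add: unitization_sel)
    then have "cnorm A (fst (s m) \<ominus> fst (s n)) = cnorm U (?z \<ominus>\<^bsub>U\<^esub> ?c)"
      using norm_U_embed s1 by (metis minus_cl)
    also have "\<dots> \<le> cnorm U ?z + cnorm U ?c"
      by (rule U.norm_minus_le) (use s1 in \<open>auto simp: unitization_sel\<close>)
    also have "cnorm U ?c \<le> cnorm U ?z / \<delta>"
      using norm_U_scalar_le snd_le by (rule order_trans)
    finally show ?thesis by (simp add: algebra_simps)
  qed
  have small: "\<exists>k. \<forall>m\<ge>k. \<forall>n\<ge>k. cnorm U (s m \<ominus>\<^bsub>U\<^esub> s n) < e" if "e > 0" for e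
    using s that by (simp add: ccauchy_def)
  have "ccauchy A (\<lambda>n. fst (s n))"
    unfolding ccauchy_def
  proof (intro conjI allI impI s1)
    fix e :: real assume "e > 0"
    then obtain k where k: "\<forall>m\<ge>k. \<forall>n\<ge>k. cnorm U (s m \<ominus>\<^bsub>U\<^esub> s n) < e / (1 + 1 / \<delta>)"
      using small[of "e / (1 + 1 / \<delta>)"] \<delta>(1) by (auto simp: add_pos_pos)
    have "cnorm A (fst (s m) \<ominus> fst (s n)) < e" if "m \<ge> k" "n \<ge> k" for m n
    proof -
      have "cnorm U (s m \<ominus>\<^bsub>U\<^esub> s n) * (1 + 1 / \<delta>) < e"
        using k that \<delta>(1) pos_less_divide_eq[of "1 + 1 / \<delta>"] by (simp add: add_pos_pos)
      then show ?thesis using fst_le[of m n] by linarith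
    qed
    then show "\<exists>k. \<forall>m\<ge>k. \<forall>n\<ge>k. cnorm A (fst (s m) \<ominus> fst (s n)) < e" by blast
  qed
  then obtain l where l: "clim A (\<lambda>n. fst (s n)) l" using ccauchy_clim by blast
  have "Cauchy (\<lambda>n. snd (s n))"
    unfolding Cauchy_def dist_norm
  proof (intro allI impI)
    fix e :: real assume "e > 0"
    then obtain k where k: "\<forall>m\<ge>k. \<forall>n\<ge>k. cnorm U (s m \<ominus>\<^bsub>U\<^esub> s n) < e * \<delta>"
      using small[of "e * \<delta>"] \<delta>(1) by auto
    have "cmod (snd (s m) - snd (s n)) < e" if "m \<ge> k" "n \<ge> k" for m n
    proof -
      have "cnorm U (s m \<ominus>\<^bsub>U\<^esub> s n) / \<delta> < e" using k that \<delta>(1) by (simp add: pos_divide_less_eq)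
      then show ?thesis using snd_le[of m n] by linarith
    qed
    then show "\<exists>k. \<forall>m\<ge>k. \<forall>n\<ge>k. cmod (snd (s m) - snd (s n)) < e" by blast
  qed
  then obtain c where c: "(\<lambda>n. snd (s n)) \<longlonglongrightarrow> c"
    by (meson Cauchy_convergent_iff convergent_def)
  have l_cl: "l \<in> carrier A" using l by (rule clim_D)
  have "clim U s (l, c)"
  proof (rule U.clim_dominated)
    fix n
    let ?x = "(fst (s n) \<ominus> l, 0 :: complex)" and ?c = "(\<zero>, snd (s n) - c)"
    have "s n \<ominus>\<^bsub>U\<^esub> (l, c) = ?x \<oplus>\<^bsub>U\<^esub> ?c" using s1 l_cl by (simp add: unitization_sel)
    then have "cnorm U (s n \<ominus>\<^bsub>U\<^esub> (l, c)) \<le> cnorm U ?x + cnorm U ?c"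
      using U.norm_add[of ?x ?c] s1 l_cl by (simp add: unitization_sel(1))
    then show "cnorm U (s n \<ominus>\<^bsub>U\<^esub> (l, c)) \<le> cnorm A (fst (s n) \<ominus> l) + cmod (snd (s n) - c)"
      using norm_U_embed[of "fst (s n) \<ominus> l"] norm_U_scalar_le[of "snd (s n) - c"] s1 l_cl by simp
  next
    show "(\<lambda>n. cnorm A (fst (s n) \<ominus> l) + cmod (snd (s n) - c)) \<longlonglongrightarrow> 0"
      using tendsto_add[OF clim_D(3)[OF l] tendsto_norm_zero[OF LIM_zero[OF c]]] by simp
  qed (use sU l_cl in \<open>auto simp: unitization_sel(1)\<close>)
  then show "\<exists>l. clim U s l" by blast
qed

lemma cunit_U: "cunit U (\<zero>, 1)"
  by (auto simp: cunit_def unitization_sel)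

end

text \<open>If B has no unit, \<open>envelope_orthogonal\<close> is applied to the unitization, with
  K and M embedded as pairs of scalar part 0. They have to be subspaces because (x, c) times (k, 0)
  has first component x k + c k.\<close>

lemma injective_envelope_orthogonal:
  fixes B :: "'b cstar" and I :: "'c cstar"
  assumes "cstar_algebra B" and env: "injective_envelope B I \<iota>"
    and \<iota>_cl: "\<And>b. b \<in> carrier B \<Longrightarrow> \<iota> b \<in> carrier I"
    and K: "csubspace B K" "\<And>b k. b \<in> carrier B \<Longrightarrow> k \<in> K \<Longrightarrow> b \<otimes>\<^bsub>B\<^esub> k \<in> K"
    and M: "csubspace B M" "\<And>b m. b \<in> carrier B \<Longrightarrow> m \<in> M \<Longrightarrow> b \<otimes>\<^bsub>B\<^esub> m \<in> M"
    and ess: "\<And>b. b \<in> carrier B \<Longrightarrow> (\<And>k. k \<in> K \<union> M \<Longrightarrow> b \<otimes>\<^bsub>B\<^esub> k = \<zero>\<^bsub>B\<^esub>) \<Longrightarrow> b = \<zero>\<^bsub>B\<^esub>"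
    and x: "x \<in> carrier I"
      "\<And>m. m \<in> M \<Longrightarrow> x \<otimes>\<^bsub>I\<^esub> \<iota> m = \<zero>\<^bsub>I\<^esub>" "\<And>m. m \<in> M \<Longrightarrow> cadj I x \<otimes>\<^bsub>I\<^esub> \<iota> m = \<zero>\<^bsub>I\<^esub>"
    and y: "y \<in> carrier I"
      "\<And>k. k \<in> K \<Longrightarrow> y \<otimes>\<^bsub>I\<^esub> \<iota> k = \<zero>\<^bsub>I\<^esub>" "\<And>k. k \<in> K \<Longrightarrow> cadj I y \<otimes>\<^bsub>I\<^esub> \<iota> k = \<zero>\<^bsub>I\<^esub>"
  shows "x \<otimes>\<^bsub>I\<^esub> y = \<zero>\<^bsub>I\<^esub> \<and> y \<otimes>\<^bsub>I\<^esub> x = \<zero>\<^bsub>I\<^esub>"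
proof (cases "cunital B")
  case True
  then have envB: "injective_envelope_unital B I \<iota>" using env by (simp add: injective_envelope_def)
  have KM: "K \<subseteq> carrier B" "M \<subseteq> carrier B"
    using K(1) M(1) by (auto simp: csubspace_def)
  show ?thesis
    by (rule conjI; rule envelope_orthogonal[OF assms(1) True envB KM]) (fact K(2) M(2) ess x y)+
next
  case False
  interpret B: nonunital_cstar B
    using assms(1) False by (simp add: nonunital_cstar_def nonunital_cstar_axioms_def)
  let ?U = "unitization B" and ?j = "\<lambda>(b, c). \<iota> b \<oplus>\<^bsub>I\<^esub> c \<odot>\<^bsub>I\<^esub> \<one>\<^bsub>I\<^esub>"
  have envU: "injective_envelope_unital ?U I ?j" using env False by (simp add: injective_envelope_def)
  then have "injective_cstar I" by (simp add: injective_envelope_unital_def)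
  then interpret I: unital_cstar I
    by (simp add: unital_cstar_def unital_cstar_axioms_def injective_cstar_def)
  have KB: "k \<in> carrier B" if "k \<in> K \<union> M" for k using that K(1) M(1) by (auto simp: csubspace_def)
  have j: "?j (k, 0) = \<iota> k" if "k \<in> K \<union> M" for k using KB[OF that] \<iota>_cl by simp
  have ideal: "z \<otimes>\<^bsub>?U\<^esub> (k, 0) \<in> L \<times> {0}"
    if L: "csubspace B L" "\<And>b k. b \<in> carrier B \<Longrightarrow> k \<in> L \<Longrightarrow> b \<otimes>\<^bsub>B\<^esub> k \<in> L"
      and z: "z \<in> carrier ?U" and k: "k \<in> L" for z k L
  proof -
    have "k \<in> carrier B" using L(1) k by (auto simp: csubspace_def)
    moreover have "fst z \<otimes>\<^bsub>B\<^esub> k \<oplus>\<^bsub>B\<^esub> snd z \<odot>\<^bsub>B\<^esub> k \<in> L"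
      using L z k by (auto simp: csubspace_def unitization_sel)
    ultimately show ?thesis using z by (simp add: unitization_sel)
  qed
  \<comment> \<open>For b in B the element z b of B annihilates K and M, since b k stays in K or M.
    So z b = 0 for every b, and z = 0 by \<open>op_eq_0\<close>.\<close>
  have essU: "z = \<zero>\<^bsub>?U\<^esub>"
    if z: "z \<in> carrier ?U" and zk: "\<And>k. k \<in> K \<times> {0} \<union> M \<times> {0} \<Longrightarrow> z \<otimes>\<^bsub>?U\<^esub> k = \<zero>\<^bsub>?U\<^esub>" for z
  proof (rule B.op_eq_0[OF z])
    fix b assume b: "b \<in> carrier B"
    have op0: "mult_op B z k = \<zero>\<^bsub>B\<^esub>" if k: "k \<in> K \<union> M" for k
      using zk[of "(k, 0)"] k z KB[OF k] by (auto simp: unitization_sel mult_op_def)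
    show "mult_op B z b = \<zero>\<^bsub>B\<^esub>"
    proof (rule ess)
      show "mult_op B z b \<in> carrier B" using z b by simp
      fix k assume k: "k \<in> K \<union> M"
      have "mult_op B z b \<otimes>\<^bsub>B\<^esub> k = mult_op B z (b \<otimes>\<^bsub>B\<^esub> k)"
        using z b KB[OF k] by (simp add: mult_op_def unitization_sel B.r_distr B.m_assoc)
      also have "\<dots> = \<zero>\<^bsub>B\<^esub>" using op0 K(2) M(2) b k by blast
      finally show "mult_op B z b \<otimes>\<^bsub>B\<^esub> k = \<zero>\<^bsub>B\<^esub>" .
    qed
  qed
  have "cunital ?U" using B.cunit_U by (auto simp: cunital_def)
  have KMU: "K \<times> {0} \<subseteq> carrier ?U" "M \<times> {0} \<subseteq> carrier ?U" using KB by (auto simp: unitization_sel)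
  have idealU: "z \<otimes>\<^bsub>?U\<^esub> k \<in> K \<times> {0}" if "z \<in> carrier ?U" "k \<in> K \<times> {0}" for z k
    using that(2) ideal[OF K that(1)] by (elim SigmaE) simp
  have idealU': "z \<otimes>\<^bsub>?U\<^esub> k \<in> M \<times> {0}" if "z \<in> carrier ?U" "k \<in> M \<times> {0}" for z k
    using that(2) ideal[OF M that(1)] by (elim SigmaE) simp
  have x': "x \<otimes>\<^bsub>I\<^esub> ?j m = \<zero>\<^bsub>I\<^esub>" "cadj I x \<otimes>\<^bsub>I\<^esub> ?j m = \<zero>\<^bsub>I\<^esub>" if "m \<in> M \<times> {0}" for m
    using that x j by auto
  have y': "y \<otimes>\<^bsub>I\<^esub> ?j k = \<zero>\<^bsub>I\<^esub>" "cadj I y \<otimes>\<^bsub>I\<^esub> ?j k = \<zero>\<^bsub>I\<^esub>" if "k \<in> K \<times> {0}" for k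
    using that y j by auto
  show ?thesis
    by (rule conjI; rule envelope_orthogonal[OF B.cstar_algebra_U \<open>cunital ?U\<close> envU KMU])
      (fact idealU idealU' essU x(1) x' y(1) y')+
qed

section \<open>Boolean algebras of sets\<close>

text \<open>Such a family is a Boolean algebra under inclusion, by Glivenko's theorem on
  pseudocomplemented semilattices; joins need not be unions.\<close>
locale complemented_family =
  fixes F :: "'a set set" and c :: "'a set \<Rightarrow> 'a set" and Z :: "'a set"
  assumes Z: "Z \<in> F" "X \<in> F \<Longrightarrow> Z \<subseteq> X"
    and Int: "\<lbrakk>X \<in> F; Y \<in> F\<rbrakk> \<Longrightarrow> X \<inter> Y \<in> F"
    and compl: "X \<in> F \<Longrightarrow> c X \<in> F" "X \<in> F \<Longrightarrow> c (c X) = X"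
    and disjoint: "\<lbrakk>X \<in> F; Y \<in> F\<rbrakk> \<Longrightarrow> X \<inter> Y \<subseteq> Z \<longleftrightarrow> X \<subseteq> c Y"
begin

abbreviation L where "L \<equiv> inclusion_order F"

lemma compl_anti: "\<lbrakk>X \<in> F; Y \<in> F; X \<subseteq> Y\<rbrakk> \<Longrightarrow> c Y \<subseteq> c X"
  using disjoint[of "c Y" Y] disjoint[of "c Y" X] compl by blast

lemma compl_Z: "X \<in> F \<Longrightarrow> X \<subseteq> c Z"
  using disjoint[of X Z] Z by blast

definition jn where "jn X Y = c (c X \<inter> c Y)"

lemma jn:
  assumes "X \<in> F" "Y \<in> F"
  shows "jn X Y \<in> F" "X \<subseteq> jn X Y" "Y \<subseteq> jn X Y"
    and "W \<in> F \<Longrightarrow> X \<subseteq> W \<Longrightarrow> Y \<subseteq> W \<Longrightarrow> jn X Y \<subseteq> W"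
proof -
  show "jn X Y \<in> F" using assms by (simp add: jn_def Int compl)
  show "X \<subseteq> jn X Y" "Y \<subseteq> jn X Y"
    using compl_anti[of "c X \<inter> c Y" "c X"] compl_anti[of "c X \<inter> c Y" "c Y"] assms
    by (auto simp: jn_def Int compl)
  assume W: "W \<in> F" "X \<subseteq> W" "Y \<subseteq> W"
  then have "c W \<subseteq> c X \<inter> c Y" using compl_anti assms by blast
  then have "jn X Y \<subseteq> c (c W)"
    unfolding jn_def using compl_anti[of "c W" "c X \<inter> c Y"] assms W Int compl by blast
  then show "jn X Y \<subseteq> W" using W compl by simp
qed

lemma bounded_lattice_L: "bounded_lattice L"
proof -
  interpret partial_order L by unfold_locales auto
  show ?thesis
  proof
    fix X Y assume "X \<in> carrier L" "Y \<in> carrier L"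
    then have XY: "X \<in> F" "Y \<in> F" by auto
    have "least L (jn X Y) (Upper L {X, Y})"
      using jn[OF XY] XY by (auto simp: least_def Upper_def)
    then show "\<exists>s. least L s (Upper L {X, Y})" by blast
    have "greatest L (X \<inter> Y) (Lower L {X, Y})"
      using Int[OF XY] XY by (auto simp: greatest_def Lower_def)
    then show "\<exists>s. greatest L s (Lower L {X, Y})" by blast
  next
    show "\<exists>x. least L x (carrier L)" using Z by (auto simp: least_def)
    show "\<exists>x. greatest L x (carrier L)"
      using compl_Z compl(1)[OF Z(1)] by (auto simp: greatest_def)
  qed
qed

interpretation bounded_lattice L by (rule bounded_lattice_L)

lemma bottom_L: "\<bottom>\<^bsub>L\<^esub> = Z"
  using bottom_eq[of Z] Z by simp

lemma top_L: "\<top>\<^bsub>L\<^esub> = c Z"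
  using top_eq[of "c Z"] compl_Z compl(1)[OF Z(1)] by simp

lemma join_L:
  assumes "X \<in> F" "Y \<in> F"
  shows "X \<squnion>\<^bsub>L\<^esub> Y = jn X Y"
proof (rule le_antisym)
  show "X \<squnion>\<^bsub>L\<^esub> Y \<sqsubseteq>\<^bsub>L\<^esub> jn X Y" by (rule join_le) (use jn assms in auto)
  show "jn X Y \<sqsubseteq>\<^bsub>L\<^esub> X \<squnion>\<^bsub>L\<^esub> Y"
    using jn(4)[OF assms, of "X \<squnion>\<^bsub>L\<^esub> Y"] join_left[of X Y] join_right[of X Y] join_closed[of X Y] assms
    by simp
qed (use jn assms join_closed in auto)

lemma meet_L:
  assumes "X \<in> F" "Y \<in> F"
  shows "X \<sqinter>\<^bsub>L\<^esub> Y = X \<inter> Y"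
proof (rule le_antisym)
  show "X \<inter> Y \<sqsubseteq>\<^bsub>L\<^esub> X \<sqinter>\<^bsub>L\<^esub> Y" by (rule meet_le) (use Int assms in auto)
  show "X \<sqinter>\<^bsub>L\<^esub> Y \<sqsubseteq>\<^bsub>L\<^esub> X \<inter> Y"
    using meet_left[of X Y] meet_right[of X Y] assms by simp
qed (use Int assms meet_closed in auto)

lemma Int_compl: "X \<in> F \<Longrightarrow> X \<inter> c X = Z"
  using disjoint[of X "c X"] compl Z(2) Int by blast

lemma jn_compl:
  assumes "X \<in> F"
  shows "jn X (c X) = c Z"
  using Int_compl[of "c X"] assms compl by (simp add: jn_def)

text \<open>Let ?M be the complement of the right-hand side. Then ?M \<inter> X is disjoint from Y
  and from W, hence below both complements and disjoint from their join; so X \<inter> jn Y W is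
  disjoint from ?M. The other inclusion is general.\<close>

lemma distrib:
  assumes XYW: "X \<in> F" "Y \<in> F" "W \<in> F"
  shows "X \<inter> jn Y W = jn (X \<inter> Y) (X \<inter> W)"
proof
  note c = Int compl
  let ?M = "c (X \<inter> Y) \<inter> c (X \<inter> W)"
  have M: "?M \<in> F" "?M \<inter> X \<in> F" using XYW c by simp_all
  have "?M \<inter> X \<inter> Y \<subseteq> Z"
    using disjoint[of ?M "X \<inter> Y"] M XYW c by (simp add: Int_assoc)
  then have "?M \<inter> X \<subseteq> c Y" using disjoint[OF M(2) XYW(2)] by simp
  moreover have "?M \<inter> X \<inter> W \<subseteq> Z"
    using disjoint[of ?M "X \<inter> W"] M XYW c by (simp add: Int_assoc)
  then have "?M \<inter> X \<subseteq> c W" using disjoint[OF M(2) XYW(3)] by simp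
  ultimately have "?M \<inter> X \<subseteq> c (jn Y W)" using XYW c by (simp add: jn_def)
  then have "?M \<inter> X \<inter> jn Y W \<subseteq> Z" using disjoint[OF M(2) jn(1)] XYW by simp
  then have "X \<inter> jn Y W \<inter> ?M \<subseteq> Z" by blast
  then show "X \<inter> jn Y W \<subseteq> jn (X \<inter> Y) (X \<inter> W)"
    using disjoint[of "X \<inter> jn Y W" ?M] M jn(1) XYW c by (simp add: jn_def)
  show "jn (X \<inter> Y) (X \<inter> W) \<subseteq> X \<inter> jn Y W"
    using jn[of Y W] XYW c by (intro jn(4)) auto
qed

lemma boolean_lattice_L: "boolean_lattice L"
proof
  fix X Y W assume "X \<in> carrier L" "Y \<in> carrier L" "W \<in> carrier L"
  then show "X \<sqinter>\<^bsub>L\<^esub> (Y \<squnion>\<^bsub>L\<^esub> W) = (X \<sqinter>\<^bsub>L\<^esub> Y) \<squnion>\<^bsub>L\<^esub> (X \<sqinter>\<^bsub>L\<^esub> W)"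
    by (simp add: join_L meet_L jn(1) Int distrib)
next
  fix X assume "X \<in> carrier L"
  then show "\<exists>Y\<in>carrier L. X \<sqinter>\<^bsub>L\<^esub> Y = \<bottom>\<^bsub>L\<^esub> \<and> X \<squnion>\<^bsub>L\<^esub> Y = \<top>\<^bsub>L\<^esub>"
    by (intro bexI[of _ "c X"]) (simp_all add: join_L meet_L compl bottom_L top_L Int_compl jn_compl)
qed

lemma complement_of_L:
  assumes X: "X \<in> F"
  shows "complement_of L X = c X"
  unfolding complement_of_def
proof (rule the_equality)
  show "c X \<in> carrier L \<and> X \<sqinter>\<^bsub>L\<^esub> c X = \<bottom>\<^bsub>L\<^esub> \<and> X \<squnion>\<^bsub>L\<^esub> c X = \<top>\<^bsub>L\<^esub>"
    using X by (simp add: join_L meet_L compl bottom_L top_L Int_compl jn_compl)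
  fix Y assume *: "Y \<in> carrier L \<and> X \<sqinter>\<^bsub>L\<^esub> Y = \<bottom>\<^bsub>L\<^esub> \<and> X \<squnion>\<^bsub>L\<^esub> Y = \<top>\<^bsub>L\<^esub>"
  then have "Y \<in> F" by simp
  with * have Y: "Y \<in> F" "X \<inter> Y = Z" "jn X Y = c Z"
    using join_L[OF X] meet_L[OF X] bottom_L top_L by metis+
  have "Y \<subseteq> c X" using disjoint[of Y X] X Y by (simp add: Int_commute)
  moreover have "c X \<inter> c Y = Z"
    using arg_cong[OF Y(3), of c] X Y(1) Z(1) Int compl by (simp add: jn_def)
  then have "c X \<subseteq> Y" using disjoint[of "c X" "c Y"] X Y(1) compl by simp
  ultimately show "Y = c X" by blast
qed

end

text \<open>Intersections and complements are enough, because joins are obtained from them by de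
  Morgan.\<close>

lemma boolean_iso_complemented_family:
  assumes "complemented_family F c Z" "complemented_family G d W"
    and bij: "bij_betw f F G" and Z: "f Z = W"
    and Int: "\<And>X Y. X \<in> F \<Longrightarrow> Y \<in> F \<Longrightarrow> f (X \<inter> Y) = f X \<inter> f Y"
    and compl: "\<And>X. X \<in> F \<Longrightarrow> f (c X) = d (f X)"
  shows "boolean_iso (inclusion_order F) (inclusion_order G) f"
proof -
  interpret F: complemented_family F c Z by fact
  interpret G: complemented_family G d W by fact
  have f: "f X \<in> G" if "X \<in> F" for X using bij that by (auto simp: bij_betw_def)
  have lat: "lattice (inclusion_order F)" "lattice (inclusion_order G)"
    using F.bounded_lattice_L G.bounded_lattice_L by (simp_all add: bounded_lattice_def)
  have jn: "f (F.jn X Y) = G.jn (f X) (f Y)" if "X \<in> F" "Y \<in> F" for X Y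
    using that by (simp add: F.jn_def G.jn_def F.Int F.compl Int compl)
  show ?thesis
    unfolding boolean_iso_def join_pres_def meet_pres_def
    using F.boolean_lattice_L G.boolean_lattice_L lat bij f Z compl[OF F.Z(1)]
    by (simp add: F.join_L F.meet_L G.join_L G.meet_L jn Int F.bottom_L G.bottom_L F.top_L G.top_L
      F.complement_of_L G.complement_of_L compl)
qed

section \<open>Annihilators\<close>

lemma annihilator_iff:
  "a \<in> annihilator A X \<longleftrightarrow> a \<in> carrier A \<and>
    (\<forall>x\<in>X. a \<otimes>\<^bsub>A\<^esub> x = \<zero>\<^bsub>A\<^esub> \<and> x \<otimes>\<^bsub>A\<^esub> a = \<zero>\<^bsub>A\<^esub>)"
  by (simp add: annihilator_def)

lemma annihilator_anti: "X \<subseteq> Y \<Longrightarrow> annihilator A Y \<subseteq> annihilator A X"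
  unfolding annihilator_def by blast

lemma annihilator_restr: "B \<subseteq> carrier A \<Longrightarrow> annihilator (A restr B) X = annihilator A X \<inter> B"
  by (auto simp: annihilator_def)

lemma cdiff_restr [simp]: "x \<ominus>\<^bsub>A restr B\<^esub> y = x \<ominus>\<^bsub>A\<^esub> y"
  by (simp add: cdiff_def)

text \<open>The multiplicative part of \<open>cstar_ideal\<close>, without additivity or closedness.
  It already supports the annihilator calculus.\<close>

definition two_sided :: "'a cstar \<Rightarrow> 'a set \<Rightarrow> bool" where
  "two_sided A J \<longleftrightarrow> J \<subseteq> carrier A \<and> (\<forall>a\<in>carrier A. \<forall>x\<in>J. a \<otimes>\<^bsub>A\<^esub> x \<in> J \<and> x \<otimes>\<^bsub>A\<^esub> a \<in> J)"

lemma cstar_ideal_two_sided: "cstar_ideal A J \<Longrightarrow> two_sided A J"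
  by (auto simp: cstar_ideal_def two_sided_def csubspace_def)

lemma (in normed_star) closedin_iff:
  "closedin mtopology S \<longleftrightarrow> S \<subseteq> carrier A \<and> (\<forall>s l. (\<forall>n. s n \<in> S) \<and> clim A s l \<longrightarrow> l \<in> S)"
proof -
  have "range s \<subseteq> S \<and> limitin mtopology s l sequentially \<longleftrightarrow> (\<forall>n. s n \<in> S) \<and> clim A s l"
    if "S \<subseteq> carrier A" for s l
    using that limitin_iff[of s l] by (auto simp: image_subset_iff)
  then show ?thesis unfolding metric_closedin_iff_sequentially_closed by blast
qed

lemma (in normed_star) dense_span_subset:
  assumes "dense_span A X" "X \<subseteq> V" "csubspace A V" "closedin mtopology V"
  shows "carrier A \<subseteq> V"
proof -
  have "cspan A X \<subseteq> V" unfolding cspan_def by (rule hull_minimal) (use assms in auto)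
  then have "cclosure A (cspan A X) \<subseteq> V"
    unfolding cclosure_def using assms(4) by (rule closure_of_minimal)
  then show ?thesis using assms(1) by (simp add: dense_span_def)
qed

context cstar_algebra
begin

lemma star_mult_0: "x \<in> carrier A \<Longrightarrow> cadj A x \<otimes> x = \<zero> \<Longrightarrow> x = \<zero>"
  using cstar_identity[of x] norm_0_iff[of x] by simp

lemma mult_star_0: "x \<in> carrier A \<Longrightarrow> x \<otimes> cadj A x = \<zero> \<Longrightarrow> x = \<zero>"
  using star_mult_0[of "cadj A x"] by (metis adj_cl adj_invol adj_zero)

text \<open>(x^* x)^2 = x^*(x x^* x) = 0, and the C*-identity is applied twice. The annihilator
  lemmas below reduce to this cancellation.\<close>

lemma triple_0:
  assumes x: "x \<in> carrier A" and 0: "x \<otimes> (cadj A x \<otimes> x) = \<zero>"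
  shows "x = \<zero>"
proof -
  have "cadj A (cadj A x \<otimes> x) \<otimes> (cadj A x \<otimes> x) = cadj A x \<otimes> (x \<otimes> (cadj A x \<otimes> x))"
    using x by (simp add: adj_prod m_assoc)
  then have "cadj A x \<otimes> x = \<zero>" using star_mult_0[of "cadj A x \<otimes> x"] x 0 by simp
  then show ?thesis using star_mult_0[OF x] by simp
qed

lemma two_sided_cl: "two_sided A J \<Longrightarrow> x \<in> J \<Longrightarrow> x \<in> carrier A"
  and two_sided_mult: "two_sided A J \<Longrightarrow> x \<in> J \<Longrightarrow> a \<in> carrier A \<Longrightarrow> a \<otimes> x \<in> J"
    "two_sided A J \<Longrightarrow> x \<in> J \<Longrightarrow> a \<in> carrier A \<Longrightarrow> x \<otimes> a \<in> J"
  by (auto simp: two_sided_def)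

text \<open>For x in J the product y = x a is in J, and so is y^* y. Hence y y^* y = x (a (y^* y)) =
  0, so annihilating J from the left is enough.\<close>

lemma annihilatorI:
  assumes J: "two_sided A J" and a: "a \<in> carrier A" and 0: "\<And>x. x \<in> J \<Longrightarrow> a \<otimes> x = \<zero>"
  shows "a \<in> annihilator A J"
  unfolding annihilator_iff
proof (intro conjI ballI a 0)
  fix x assume x: "x \<in> J"
  have xc: "x \<in> carrier A" using J x by (rule two_sided_cl)
  let ?y = "x \<otimes> a"
  have "?y \<in> J" using two_sided_mult(2)[OF J x a] .
  then have "cadj A ?y \<otimes> ?y \<in> J" using two_sided_mult(1)[OF J] a xc by simp
  then have "a \<otimes> (cadj A ?y \<otimes> ?y) = \<zero>" by (rule 0)
  then have "?y \<otimes> (cadj A ?y \<otimes> ?y) = \<zero>" using a xc by (simp add: m_assoc)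
  moreover have "?y \<in> carrier A" using a xc by simp
  ultimately show "?y = \<zero>" by (rule triple_0[rotated])
qed

text \<open>A \<open>two_sided\<close> set need not be closed under adjoints, so the argument goes
  through w = a^* x in J, for which w^* w = x^*(a w) = 0.\<close>

lemma annihilator_adj:
  assumes J: "two_sided A J" and a: "a \<in> annihilator A J"
  shows "cadj A a \<in> annihilator A J"
proof (rule annihilatorI[OF J])
  have ac: "a \<in> carrier A" using a by (simp add: annihilator_iff)
  then show "cadj A a \<in> carrier A" by simp
  fix x assume x: "x \<in> J"
  have xc: "x \<in> carrier A" using J x by (rule two_sided_cl)
  have "cadj A a \<otimes> x \<in> J" using two_sided_mult J x ac by simp
  then have "a \<otimes> (cadj A a \<otimes> x) = \<zero>" using a by (simp add: annihilator_iff)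
  then have "cadj A (cadj A a \<otimes> x) \<otimes> (cadj A a \<otimes> x) = \<zero>"
    using ac xc by (simp add: adj_prod m_assoc)
  moreover have "cadj A a \<otimes> x \<in> carrier A" using ac xc by simp
  ultimately show "cadj A a \<otimes> x = \<zero>" by (rule star_mult_0[rotated])
qed

lemma csubspace_annihilator: "X \<subseteq> carrier A \<Longrightarrow> csubspace A (annihilator A X)"
  by (auto simp: csubspace_def annihilator_iff l_distr r_distr subset_iff)

lemma closedin_annihilator:
  assumes X: "X \<subseteq> carrier A"
  shows "closedin mtopology (annihilator A X)"
  unfolding closedin_iff
proof (intro conjI allI impI)
  show "annihilator A X \<subseteq> carrier A" by (auto simp: annihilator_iff)
  fix s l assume s: "(\<forall>n. s n \<in> annihilator A X) \<and> clim A s l"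
  have "l \<otimes> x = \<zero> \<and> x \<otimes> l = \<zero>" if x: "x \<in> X" for x
  proof -
    have xc: "x \<in> carrier A" using x X by blast
    have "clim A (\<lambda>n. s n \<otimes> x) (l \<otimes> x)" "clim A (\<lambda>n. x \<otimes> s n) (x \<otimes> l)"
      using s xc by (auto intro: clim_mult clim_const)
    moreover have "s n \<otimes> x = \<zero>" "x \<otimes> s n = \<zero>" for n
      using s x by (auto simp: annihilator_iff)
    ultimately show ?thesis using clim_unique[OF _ clim_const[OF zero_cl]] by simp
  qed
  then show "l \<in> annihilator A X" using s clim_D(1) by (auto simp: annihilator_iff)
qed

lemma cstar_ideal_annihilator:
  assumes J: "two_sided A J"
  shows "cstar_ideal A (annihilator A J)"
proof -
  have JA: "J \<subseteq> carrier A" using J by (simp add: two_sided_def)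
  have "c \<otimes> a \<in> annihilator A J \<and> a \<otimes> c \<in> annihilator A J"
    if c: "c \<in> carrier A" and a: "a \<in> annihilator A J" for a c
  proof -
    have ac: "a \<in> carrier A" and 0: "\<And>x. x \<in> J \<Longrightarrow> a \<otimes> x = \<zero>" using a by (auto simp: annihilator_iff)
    have "(c \<otimes> a) \<otimes> x = \<zero>" "(a \<otimes> c) \<otimes> x = \<zero>" if x: "x \<in> J" for x
      using two_sided_cl[OF J x] 0[OF x] 0[OF two_sided_mult(1)[OF J x c]] c ac
      by (simp_all add: m_assoc)
    then show ?thesis using c ac by (auto intro!: annihilatorI[OF J])
  qed
  then show ?thesis
    unfolding cstar_ideal_def using csubspace_annihilator closedin_annihilator JA by blast
qed

lemma two_sided_annihilator: "two_sided A J \<Longrightarrow> two_sided A (annihilator A J)"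
  by (rule cstar_ideal_two_sided[OF cstar_ideal_annihilator])

text \<open>Products of elements of J and J' lie in both sets. Conversely an x in both has x^* x in
  J', so it satisfies x x^* x = 0.\<close>

lemma disjoint_iff_annihilator:
  assumes J: "two_sided A J" and J': "two_sided A J'"
  shows "J \<inter> J' \<subseteq> {\<zero>} \<longleftrightarrow> J \<subseteq> annihilator A J'"
proof
  assume 0: "J \<inter> J' \<subseteq> {\<zero>}"
  show "J \<subseteq> annihilator A J'"
  proof
    fix x assume x: "x \<in> J"
    have "x \<otimes> y \<in> J \<inter> J' \<and> y \<otimes> x \<in> J \<inter> J'" if "y \<in> J'" for y
      using two_sided_mult[OF J x two_sided_cl[OF J' that]]
        two_sided_mult[OF J' that two_sided_cl[OF J x]] by simp
    then show "x \<in> annihilator A J'" using 0 two_sided_cl[OF J x] by (auto simp: annihilator_iff)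
  qed
next
  assume le: "J \<subseteq> annihilator A J'"
  show "J \<inter> J' \<subseteq> {\<zero>}"
  proof
    fix x assume x: "x \<in> J \<inter> J'"
    have xc: "x \<in> carrier A" using two_sided_cl[OF J] x by blast
    have "cadj A x \<otimes> x \<in> J'" using two_sided_mult(1)[OF J'] x xc by simp
    then show "x \<in> {\<zero>}" using triple_0[OF xc] le x by (auto simp: annihilator_iff)
  qed
qed

lemma subset_biannihilator: "X \<subseteq> carrier A \<Longrightarrow> X \<subseteq> biannihilator A X"
  by (auto simp: annihilator_iff)

lemma annihilator_tri: "X \<subseteq> carrier A \<Longrightarrow> annihilator A (biannihilator A X) = annihilator A X"
  by (intro equalityI annihilator_anti subset_biannihilator) (auto simp: annihilator_def)

lemma annihilator_regular:
  assumes "two_sided A J"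
  shows "annihilator A J \<in> regular_ideals A"
  using cstar_ideal_annihilator[OF assms] annihilator_tri[of J] assms
  by (auto simp: regular_ideals_def two_sided_def)

lemma annihilator_carrier: "annihilator A (carrier A) = {\<zero>}"
  by (auto simp: annihilator_iff) (meson adj_cl mult_star_0)

lemma cstar_ideal_Int: "cstar_ideal A J \<Longrightarrow> cstar_ideal A J' \<Longrightarrow> cstar_ideal A (J \<inter> J')"
  by (auto simp: cstar_ideal_def csubspace_def intro: closedin_Int)

lemma regular_ideals_complemented: "complemented_family (regular_ideals A) (annihilator A) {\<zero>}"
proof
  have id: "cstar_ideal A J" "biannihilator A J = J" "two_sided A J" if "J \<in> regular_ideals A" for J
    using that cstar_ideal_two_sided by (auto simp: regular_ideals_def)
  have "two_sided A (carrier A)" by (auto simp: two_sided_def)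
  then show "{\<zero>} \<in> regular_ideals A" using annihilator_regular annihilator_carrier by fastforce
  fix X Y assume X: "X \<in> regular_ideals A"
  show "{\<zero>} \<subseteq> X" using id(1)[OF X] by (auto simp: cstar_ideal_def csubspace_def)
  show "annihilator A X \<in> regular_ideals A" using annihilator_regular id X by blast
  show "annihilator A (annihilator A X) = X" using id X by blast
  assume Y: "Y \<in> regular_ideals A"
  show "X \<inter> Y \<subseteq> {\<zero>} \<longleftrightarrow> X \<subseteq> annihilator A Y" using disjoint_iff_annihilator id X Y by blast
  have "X \<inter> Y \<subseteq> carrier A" using id(3)[OF X] by (auto simp: two_sided_def)
  moreover have "biannihilator A (X \<inter> Y) \<subseteq> biannihilator A X \<inter> biannihilator A Y"
    by (intro Int_greatest annihilator_anti) auto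
  ultimately have "X \<inter> Y = biannihilator A (X \<inter> Y)"
    using subset_biannihilator[of "X \<inter> Y"] id(2)[OF X] id(2)[OF Y] by auto
  then show "X \<inter> Y \<in> regular_ideals A"
    using cstar_ideal_Int[OF id(1)[OF X] id(1)[OF Y]] by (simp add: regular_ideals_def)
qed

lemma cstar_algebra_restr:
  assumes "cstar_subalgebra A B"
  shows "cstar_algebra (A restr B)"
proof (rule cstar_algebraI)
  have B: "B \<subseteq> carrier A" "\<zero> \<in> B" "\<And>x y. x \<in> B \<Longrightarrow> y \<in> B \<Longrightarrow> x \<oplus> y \<in> B"
    "\<And>c x. x \<in> B \<Longrightarrow> c \<odot> x \<in> B" "\<And>x y. x \<in> B \<Longrightarrow> y \<in> B \<Longrightarrow> x \<otimes> y \<in> B"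
    "\<And>x. x \<in> B \<Longrightarrow> cadj A x \<in> B"
    using assms by (auto simp: cstar_subalgebra_def csubspace_def)
  have Bc: "x \<in> B \<Longrightarrow> x \<in> carrier A" for x using B by blast
  show "normed_star (A restr B)"
    by unfold_locales (use B Bc in \<open>auto simp: s_add add_s m_assoc r_distr l_distr
      adj_sum adj_prod norm_0_iff norm_add norm_s norm_prod a_ac\<close>)
  show "cnorm (A restr B) (cadj (A restr B) x \<otimes>\<^bsub>A restr B\<^esub> x) = (cnorm (A restr B) x)\<^sup>2"
    if "x \<in> carrier (A restr B)" for x
    using that Bc cstar_identity by simp
  fix s assume "ccauchy (A restr B) s"
  then have s: "ccauchy A s" "\<forall>n. s n \<in> B" using Bc by (auto simp: ccauchy_def)
  then obtain l where l: "clim A s l" using ccauchy_clim by blast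
  then have "l \<in> B" using assms s(2) closedin_iff[of B] by (auto simp: cstar_subalgebra_def)
  then show "\<exists>l. clim (A restr B) s l" using l s(2) by (auto simp: clim_def)
qed

end

section \<open>Regular inclusions\<close>

locale regular_incl =
  fixes A :: "'a cstar" (structure) and B :: "'a set"
  assumes regular: "regular_inclusion A B"

sublocale regular_incl \<subseteq> cstar_algebra A
  using regular by (simp add: regular_inclusion_def cstar_inclusion_def)

context regular_incl
begin

lemma subalgebra: "cstar_subalgebra A B"
  using regular by (simp add: regular_inclusion_def cstar_inclusion_def)

lemma B_cl: "x \<in> B \<Longrightarrow> x \<in> carrier A"
  and B_mult: "x \<in> B \<Longrightarrow> y \<in> B \<Longrightarrow> x \<otimes> y \<in> B"
  and B_adj: "x \<in> B \<Longrightarrow> cadj A x \<in> B"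
  using subalgebra by (auto simp: cstar_subalgebra_def csubspace_def)

sublocale B: cstar_algebra "A restr B"
  by (rule cstar_algebra_restr[OF subalgebra])

lemma annihilator_B: "annihilator (A restr B) X = annihilator A X \<inter> B"
  using B_cl by (intro annihilator_restr) blast

lemma two_sided_B:
  "two_sided (A restr B) K \<longleftrightarrow> K \<subseteq> B \<and> (\<forall>b\<in>B. \<forall>k\<in>K. b \<otimes> k \<in> K \<and> k \<otimes> b \<in> K)"
  by (simp add: two_sided_def)

lemma normalizer_cl: "n \<in> normalizers A B \<Longrightarrow> n \<in> carrier A"
  and normalizer_conj: "n \<in> normalizers A B \<Longrightarrow> b \<in> B \<Longrightarrow> n \<otimes> b \<otimes> cadj A n \<in> B"
  and normalizer_adj: "n \<in> normalizers A B \<Longrightarrow> cadj A n \<in> normalizers A B"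
  by (auto simp: normalizers_def conj_set_def)

text \<open>Density of the span of the normalizers enters through this rule.\<close>

lemma dense_induct:
  assumes "\<And>n. n \<in> normalizers A B \<Longrightarrow> P n" "P \<zero>"
    and "\<And>x y. x \<in> carrier A \<Longrightarrow> y \<in> carrier A \<Longrightarrow> P x \<Longrightarrow> P y \<Longrightarrow> P (x \<oplus> y)"
    and "\<And>c x. x \<in> carrier A \<Longrightarrow> P x \<Longrightarrow> P (c \<odot> x)"
    and "\<And>s l. clim A s l \<Longrightarrow> (\<And>n. P (s n)) \<Longrightarrow> P l"
    and "c \<in> carrier A"
  shows "P c"
proof -
  have "carrier A \<subseteq> {x \<in> carrier A. P x}"
  proof (rule dense_span_subset)
    show "dense_span A (normalizers A B)" using regular by (simp add: regular_inclusion_def)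
    show "closedin mtopology {x \<in> carrier A. P x}"
      unfolding closedin_iff using assms(5) clim_D(1) by blast
  qed (use assms normalizer_cl in \<open>auto simp: csubspace_def\<close>)
  then show ?thesis using assms(6) by blast
qed

section \<open>Invariant ideals and their annihilators in A\<close>

definition invariant :: "'a set \<Rightarrow> bool" where
  "invariant K \<longleftrightarrow> (\<forall>n\<in>normalizers A B. \<forall>k\<in>K. n \<otimes> k \<otimes> cadj A n \<in> K)"

lemma invariantD:
  assumes "invariant K" "n \<in> normalizers A B" "k \<in> K"
  shows "n \<otimes> k \<otimes> cadj A n \<in> K" "cadj A n \<otimes> k \<otimes> n \<in> K"
  using assms normalizer_adj[OF assms(2)] normalizer_cl[OF assms(2)]
  unfolding invariant_def by fastforce+

lemma invariant_regular_iff: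
  "K \<in> invariant_regular_ideals A B \<longleftrightarrow> K \<in> regular_ideals (A restr B) \<and> invariant K"
  by (auto simp: invariant_regular_ideals_def invariant_def conj_set_def)

lemma star_mult_in:
  assumes "two_sided (A restr B) K" "k \<in> K"
  shows "k \<in> B" "cadj A k \<otimes> k \<in> K" "k \<otimes> cadj A k \<in> K"
  using assms B_adj by (auto simp: two_sided_B)

lemma mult_right_annihilates:
  assumes K: "two_sided (A restr B) K" "invariant K"
    and a: "a \<in> carrier A" "\<And>k. k \<in> K \<Longrightarrow> a \<otimes> k = \<zero>" and k: "k \<in> K" and c: "c \<in> carrier A"
  shows "(a \<otimes> c) \<otimes> k = \<zero>"
proof -
  have kc: "k \<in> carrier A" using star_mult_in(1)[OF K(1) k] by (rule B_cl)
  show ?thesis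
  proof (rule dense_induct[where P = "\<lambda>c. (a \<otimes> c) \<otimes> k = \<zero>" and c = c])
    fix n assume n: "n \<in> normalizers A B"
    have nc: "n \<in> carrier A" using n by (rule normalizer_cl)
    have "n \<otimes> (k \<otimes> cadj A k) \<otimes> cadj A n \<in> K"
      using invariantD(1)[OF K(2) n] star_mult_in(3)[OF K(1) k] by blast
    then have "a \<otimes> (n \<otimes> (k \<otimes> cadj A k) \<otimes> cadj A n) = \<zero>" by (rule a(2))
    then have "(a \<otimes> (n \<otimes> (k \<otimes> cadj A k) \<otimes> cadj A n)) \<otimes> cadj A a = \<zero>" using a(1) by simp
    then have "((a \<otimes> n) \<otimes> k) \<otimes> cadj A ((a \<otimes> n) \<otimes> k) = \<zero>"
      using a(1) nc kc by (simp add: adj_prod m_assoc)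
    then show "(a \<otimes> n) \<otimes> k = \<zero>" by (rule mult_star_0[rotated]) (use a(1) nc kc in simp)
  next
    fix s l assume s: "clim A s l" "\<And>n. (a \<otimes> s n) \<otimes> k = \<zero>"
    have "clim A (\<lambda>n. (a \<otimes> s n) \<otimes> k) ((a \<otimes> l) \<otimes> k)"
      using s(1) a(1) kc by (intro clim_mult clim_const)
    then show "(a \<otimes> l) \<otimes> k = \<zero>" using clim_unique[OF _ clim_const[OF zero_cl]] s(2) by simp
  qed (use a(1) kc c in \<open>auto simp: l_distr r_distr\<close>)
qed

text \<open>K absorbs products with B only, so \<open>annihilatorI\<close> does not apply in A. For
  w = k a, \<open>mult_right_annihilates\<close> with c = w^* gives w w^* w = k (a w^* k) a =
  0.\<close>

lemma one_sided_annihilator: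
  assumes K: "two_sided (A restr B) K" "invariant K"
    and a: "a \<in> carrier A" "\<And>k. k \<in> K \<Longrightarrow> a \<otimes> k = \<zero>"
  shows "a \<in> annihilator A K"
  unfolding annihilator_iff
proof (intro conjI ballI a)
  fix k assume k: "k \<in> K"
  have kc: "k \<in> carrier A" using star_mult_in(1)[OF K(1) k] by (rule B_cl)
  let ?w = "k \<otimes> a"
  have "(a \<otimes> cadj A ?w) \<otimes> k = \<zero>"
    using mult_right_annihilates[OF K a k] a(1) kc by simp
  then have "k \<otimes> (((a \<otimes> cadj A ?w) \<otimes> k) \<otimes> a) = \<zero>" using a(1) kc by simp
  then have "?w \<otimes> (cadj A ?w \<otimes> ?w) = \<zero>" using a(1) kc by (simp add: m_assoc)
  then show "?w = \<zero>" by (rule triple_0[rotated]) (use a(1) kc in simp)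
qed

lemma two_sided_annihilator_invariant:
  assumes K: "two_sided (A restr B) K" "invariant K"
  shows "two_sided A (annihilator A K)"
  unfolding two_sided_def
proof (intro conjI ballI)
  show "annihilator A K \<subseteq> carrier A" by (auto simp: annihilator_iff)
  fix c a assume c: "c \<in> carrier A" and a: "a \<in> annihilator A K"
  have ac: "a \<in> carrier A" and 0: "\<And>k. k \<in> K \<Longrightarrow> a \<otimes> k = \<zero>" using a by (auto simp: annihilator_iff)
  show "a \<otimes> c \<in> annihilator A K"
    by (rule one_sided_annihilator[OF K]) (use c ac mult_right_annihilates[OF K ac 0] in auto)
  show "c \<otimes> a \<in> annihilator A K"
  proof (rule one_sided_annihilator[OF K])
    fix k assume k: "k \<in> K"
    then show "(c \<otimes> a) \<otimes> k = \<zero>"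
      using c ac 0 B_cl[OF star_mult_in(1)[OF K(1) k]] by (simp add: m_assoc)
  qed (use c ac in simp)
qed

lemma invariant_annihilator:
  assumes K: "two_sided (A restr B) K" "invariant K"
  shows "invariant (annihilator (A restr B) K)"
  unfolding invariant_def
proof (intro ballI)
  fix n b assume n: "n \<in> normalizers A B" and b: "b \<in> annihilator (A restr B) K"
  have bB: "b \<in> B" and bA: "b \<in> annihilator A K" using b by (auto simp: annihilator_B)
  have "n \<otimes> b \<otimes> cadj A n \<in> annihilator A K"
    using two_sided_mult[OF two_sided_annihilator_invariant[OF K]] normalizer_cl[OF n] bA adj_cl by blast
  then show "n \<otimes> b \<otimes> cadj A n \<in> annihilator (A restr B) K"
    using normalizer_conj[OF n bB] by (simp add: annihilator_B)
qed

lemma regular_ideals_B_two_sided: "K \<in> regular_ideals (A restr B) \<Longrightarrow> two_sided (A restr B) K"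
  by (auto simp: regular_ideals_def intro: cstar_ideal_two_sided)

lemma invariant_regular_complemented:
  "complemented_family (invariant_regular_ideals A B) (annihilator (A restr B)) {\<zero>}"
proof -
  interpret F: complemented_family "regular_ideals (A restr B)" "annihilator (A restr B)" "{\<zero>}"
    using B.regular_ideals_complemented by simp
  show ?thesis
  proof
    show "{\<zero>} \<in> invariant_regular_ideals A B"
      using F.Z(1) normalizer_cl by (auto simp: invariant_regular_iff invariant_def)
    fix X Y assume X: "X \<in> invariant_regular_ideals A B"
    then have XR: "X \<in> regular_ideals (A restr B)" "invariant X" by (auto simp: invariant_regular_iff)
    show "{\<zero>} \<subseteq> X" using F.Z(2) XR by blast
    show "annihilator (A restr B) X \<in> invariant_regular_ideals A B"
      using F.compl XR invariant_annihilator regular_ideals_B_two_sided by (simp add: invariant_regular_iff)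
    show "annihilator (A restr B) (annihilator (A restr B) X) = X" using F.compl XR by blast
    assume "Y \<in> invariant_regular_ideals A B"
    then have YR: "Y \<in> regular_ideals (A restr B)" "invariant Y" by (auto simp: invariant_regular_iff)
    show "X \<inter> Y \<in> invariant_regular_ideals A B"
      using F.Int XR YR by (auto simp: invariant_regular_iff invariant_def)
    show "X \<inter> Y \<subseteq> {\<zero>} \<longleftrightarrow> X \<subseteq> annihilator (A restr B) Y" using F.disjoint XR YR by blast
  qed
qed

end

section \<open>Consequences of the ideal intersection property\<close>

locale regular_incl_iip = regular_incl +
  assumes iip: "ideal_intersection_property A B"
begin

lemma two_sided_Int_B: "two_sided A J \<Longrightarrow> two_sided (A restr B) (J \<inter> B)"
  unfolding two_sided_B using B_cl B_mult by (auto simp: two_sided_def)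

lemma invariant_Int_B: "two_sided A J \<Longrightarrow> invariant (J \<inter> B)"
  using normalizer_cl normalizer_conj by (auto simp: invariant_def two_sided_def)

text \<open>The ideal \<open>(J \<inter> B)\<^sup>\<bottom> \<inter> J\<close> of \<open>A\<close> meets \<open>B\<close> trivially.\<close>
lemma annihilator_Int_B:
  assumes J: "cstar_ideal A J"
  shows "annihilator A (J \<inter> B) = annihilator A J"
proof
  have J2: "two_sided A J" using J by (rule cstar_ideal_two_sided)
  let ?K = "J \<inter> B"
  have K: "two_sided (A restr B) ?K" "invariant ?K"
    using two_sided_Int_B invariant_Int_B J2 by auto
  have KA: "two_sided A (annihilator A ?K)" by (rule two_sided_annihilator_invariant[OF K])
  have KcA: "?K \<subseteq> carrier A" using J2 by (auto simp: two_sided_def)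
  have "cstar_ideal A (annihilator A ?K)"
    unfolding cstar_ideal_def
    using csubspace_annihilator[OF KcA] closedin_annihilator[OF KcA] KA by (auto simp: two_sided_def)
  then have id: "cstar_ideal A (annihilator A ?K \<inter> J)" using J by (rule cstar_ideal_Int)
  have "annihilator A ?K \<inter> J \<inter> B \<subseteq> {\<zero>}"
  proof
    fix x assume x: "x \<in> annihilator A ?K \<inter> J \<inter> B"
    then have "cadj A x \<otimes> x \<in> ?K" using star_mult_in(2)[OF K(1), of x] by simp
    then have "x \<otimes> (cadj A x \<otimes> x) = \<zero>" using x by (simp add: annihilator_iff)
    then show "x \<in> {\<zero>}" using triple_0[of x] x B_cl by simp
  qed
  moreover have "\<zero> \<in> annihilator A ?K \<inter> J \<inter> B"
    using id subalgebra by (auto simp: cstar_ideal_def csubspace_def cstar_subalgebra_def)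
  ultimately have "annihilator A ?K \<inter> J \<inter> B = {\<zero>}" by blast
  then have "annihilator A ?K \<inter> J = {\<zero>}"
    using iip id unfolding ideal_intersection_property_def by blast
  then show "annihilator A ?K \<subseteq> annihilator A J" using disjoint_iff_annihilator[OF KA J2] by simp
  show "annihilator A J \<subseteq> annihilator A ?K" by (rule annihilator_anti) blast
qed

lemma cstar_ideal_Int_B:
  assumes J: "cstar_ideal A J"
  shows "cstar_ideal (A restr B) (J \<inter> B)"
  unfolding cstar_ideal_def
proof (intro conjI)
  show "csubspace (A restr B) (J \<inter> B)"
    using J subalgebra by (auto simp: cstar_ideal_def cstar_subalgebra_def csubspace_def)
  have "closedin mtopology (J \<inter> B)"
    using J subalgebra by (auto simp: cstar_ideal_def cstar_subalgebra_def)
  then have lim: "l \<in> J \<inter> B" if "\<forall>n. s n \<in> J \<inter> B" "clim A s l" for s l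
    unfolding closedin_iff using that by blast
  show "closedin B.mtopology (J \<inter> B)"
    unfolding B.closedin_iff
  proof (intro conjI allI impI)
    fix s l assume s: "(\<forall>n. s n \<in> J \<inter> B) \<and> clim (A restr B) s l"
    then have "clim A s l" using B_cl by (simp add: clim_def)
    then show "l \<in> J \<inter> B" using lim[of s l] s by blast
  qed simp
  show "\<forall>a\<in>carrier (A restr B). \<forall>x\<in>J \<inter> B. a \<otimes>\<^bsub>A restr B\<^esub> x \<in> J \<inter> B \<and> x \<otimes>\<^bsub>A restr B\<^esub> a \<in> J \<inter> B"
    using two_sided_Int_B[OF cstar_ideal_two_sided[OF J]] by (simp add: two_sided_def)
qed

text \<open>Intersecting with B thus turns complements into complements and keeps
  regularity.\<close>

lemma annihilator_B_Int:
  assumes "J \<in> regular_ideals A"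
  shows "annihilator (A restr B) (J \<inter> B) = annihilator A J \<inter> B"
  using annihilator_Int_B assms by (auto simp: annihilator_B regular_ideals_def)

lemma Int_B_invariant_regular:
  assumes J: "J \<in> regular_ideals A"
  shows "J \<inter> B \<in> invariant_regular_ideals A B"
proof -
  have id: "cstar_ideal A J" "biannihilator A J = J" using J by (auto simp: regular_ideals_def)
  have "annihilator A J \<in> regular_ideals A"
    using annihilator_regular cstar_ideal_two_sided[OF id(1)] by blast
  then have "biannihilator (A restr B) (J \<inter> B) = J \<inter> B"
    using annihilator_B_Int J id(2) by simp
  then show ?thesis
    using cstar_ideal_Int_B[OF id(1)] invariant_Int_B[OF cstar_ideal_two_sided[OF id(1)]]
    by (simp add: invariant_regular_iff regular_ideals_def)
qed

lemma biannihilator_Int_B: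
  assumes "J \<in> regular_ideals A"
  shows "biannihilator A (J \<inter> B) = J"
  using annihilator_Int_B assms by (auto simp: regular_ideals_def)

lemma biannihilator_invariant_regular:
  assumes K: "K \<in> invariant_regular_ideals A B"
  shows "biannihilator A K \<in> regular_ideals A" and "biannihilator A K \<inter> B = K"
proof -
  have KR: "K \<in> regular_ideals (A restr B)" "invariant K" "two_sided (A restr B) K"
    using K regular_ideals_B_two_sided by (auto simp: invariant_regular_iff)
  show "biannihilator A K \<in> regular_ideals A"
    by (rule annihilator_regular[OF two_sided_annihilator_invariant[OF KR(3,2)]])
  have KB: "K \<subseteq> B" using KR(3) by (simp add: two_sided_B)
  \<comment> \<open>The annihilator of K in B is contained in the one in A, so its own annihilator
    is larger.\<close>
  have "biannihilator A K \<inter> B \<subseteq> biannihilator (A restr B) K"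
    using annihilator_anti[of "annihilator (A restr B) K" "annihilator A K" A]
    by (auto simp: annihilator_B)
  then show "biannihilator A K \<inter> B = K"
    using KR(1) subset_biannihilator[of K] KB B_cl by (auto simp: regular_ideals_def)
qed

lemma boolean_iso_Int_B:
  "boolean_iso (inclusion_order (regular_ideals A))
    (inclusion_order (invariant_regular_ideals A B)) (\<lambda>J. J \<inter> B)"
proof (rule boolean_iso_complemented_family[OF regular_ideals_complemented invariant_regular_complemented])
  show "bij_betw (\<lambda>J. J \<inter> B) (regular_ideals A) (invariant_regular_ideals A B)"
    by (rule bij_betw_byWitness[where f' = "biannihilator A"])
      (auto simp: biannihilator_Int_B biannihilator_invariant_regular Int_B_invariant_regular)
  show "{\<zero>} \<inter> B = {\<zero>}"
    using subalgebra by (auto simp: cstar_subalgebra_def csubspace_def)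
qed (auto simp: annihilator_B_Int)

text \<open>\<open>annihilator_Int_B\<close> for the ideal \<open>K\<^sup>\<bottom>\<close> of A,
  whose intersection with B is the annihilator of K in B.\<close>

lemma annihilator_annihilator_B:
  assumes "K \<in> invariant_regular_ideals A B"
  shows "annihilator A (annihilator (A restr B) K) = biannihilator A K"
proof -
  have "two_sided A (annihilator A K)"
    using assms two_sided_annihilator_invariant regular_ideals_B_two_sided
    by (auto simp: invariant_regular_iff)
  moreover have "K \<subseteq> carrier A"
    using assms regular_ideals_B_two_sided B_cl by (force simp: invariant_regular_iff two_sided_B)
  ultimately have "cstar_ideal A (annihilator A K)"
    unfolding cstar_ideal_def
    using csubspace_annihilator closedin_annihilator by (auto simp: two_sided_def)
  then show ?thesis using annihilator_Int_B by (simp add: annihilator_B)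
qed

end

section \<open>Pseudo-expectations\<close>

text \<open>If B has no unit, the definition of the envelope only provides a homomorphism on the
  unitization; \<iota> is its restriction to the pairs (b, 0).\<close>

lemma injective_envelope_star_hom:
  assumes "cstar_algebra B" "injective_envelope B I \<iota>" "\<And>b. b \<in> carrier B \<Longrightarrow> \<iota> b \<in> carrier I"
  shows "star_hom B I \<iota>"
proof (cases "cunital B")
  case True
  then show ?thesis using assms by (simp add: injective_envelope_def injective_envelope_unital_def)
next
  case False
  interpret B: cstar_algebra B by fact
  let ?j = "\<lambda>(b, c). \<iota> b \<oplus>\<^bsub>I\<^esub> c \<odot>\<^bsub>I\<^esub> \<one>\<^bsub>I\<^esub>"
  have "injective_envelope_unital (unitization B) I ?j" using assms False by (simp add: injective_envelope_def)
  then have j: "star_hom (unitization B) I ?j" and "injective_cstar I"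
    by (auto simp: injective_envelope_unital_def)
  then interpret I: unital_cstar I
    by (simp add: unital_cstar_def unital_cstar_axioms_def injective_cstar_def)
  have j0: "?j (b, 0) = \<iota> b" if "b \<in> carrier B" for b using assms(3)[OF that] by simp
  have U: "(b, 0) \<in> carrier (unitization B)" if "b \<in> carrier B" for b
    using that by (simp add: unitization_sel)
  show ?thesis
    unfolding star_hom_def
  proof (intro conjI ballI allI)
    show "\<iota> \<in> carrier B \<rightarrow> carrier I" using assms(3) by blast
    fix x assume x: "x \<in> carrier B"
    have "?j (c \<odot>\<^bsub>unitization B\<^esub> (x, 0)) = c \<odot>\<^bsub>I\<^esub> ?j (x, 0)" for c
      using j U[OF x] unfolding star_hom_def by blast
    then show "\<iota> (c \<odot>\<^bsub>B\<^esub> x) = c \<odot>\<^bsub>I\<^esub> \<iota> x" for c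
      using x assms(3) by (simp add: unitization_sel)
    have "?j (cadj (unitization B) (x, 0)) = cadj I (?j (x, 0))"
      using j U[OF x] unfolding star_hom_def by blast
    then show "\<iota> (cadj B x) = cadj I (\<iota> x)" using x assms(3) by (simp add: unitization_sel)
    fix y assume y: "y \<in> carrier B"
    have "?j ((x, 0) \<oplus>\<^bsub>unitization B\<^esub> (y, 0)) = ?j (x, 0) \<oplus>\<^bsub>I\<^esub> ?j (y, 0)"
      "?j ((x, 0) \<otimes>\<^bsub>unitization B\<^esub> (y, 0)) = ?j (x, 0) \<otimes>\<^bsub>I\<^esub> ?j (y, 0)"
      using j U[OF x] U[OF y] unfolding star_hom_def by blast+
    then show "\<iota> (x \<oplus>\<^bsub>B\<^esub> y) = \<iota> x \<oplus>\<^bsub>I\<^esub> \<iota> y" "\<iota> (x \<otimes>\<^bsub>B\<^esub> y) = \<iota> x \<otimes>\<^bsub>I\<^esub> \<iota> y"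
      using x y assms(3) by (simp_all add: unitization_sel)
  qed
qed

locale faithful_pseudo_expectation = regular_incl_iip A B for A :: "'a cstar" (structure) and B +
  fixes I :: "'c cstar" and \<iota> \<Phi> :: "'a \<Rightarrow> 'c"
  assumes envelope: "injective_envelope (A restr B) I \<iota>"
    and pseudo: "pseudo_expectation A B I \<iota> \<Phi>"
    and faithful: "faithful_map A I \<Phi>"
begin

sublocale I: unital_cstar I
proof -
  have "injective_cstar I"
    using envelope by (auto simp: injective_envelope_def injective_envelope_unital_def split: if_splits)
  then show "unital_cstar I" by (simp add: unital_cstar_def unital_cstar_axioms_def injective_cstar_def)
qed

lemma \<Phi>_cp: "cp_map A (carrier A) I \<Phi>"
  and \<Phi>_cl [simp]: "a \<in> carrier A \<Longrightarrow> \<Phi> a \<in> carrier I"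
  and \<Phi>_norm: "a \<in> carrier A \<Longrightarrow> cnorm I (\<Phi> a) \<le> cnorm A a"
  and \<Phi>_B: "b \<in> B \<Longrightarrow> \<Phi> b = \<iota> b"
  using pseudo by (auto simp: pseudo_expectation_def cp_map_def)

lemma \<Phi>_minus: "x \<in> carrier A \<Longrightarrow> y \<in> carrier A \<Longrightarrow> \<Phi> (x \<ominus> y) = \<Phi> x \<ominus>\<^bsub>I\<^esub> \<Phi> y"
  using \<Phi>_cp by (simp add: cp_map_def cdiff_def)

lemma \<iota>_cl: "b \<in> B \<Longrightarrow> \<iota> b \<in> carrier I"
  using \<Phi>_B \<Phi>_cl B_cl by metis

sublocale \<iota>: cstar_hom "A restr B" I \<iota>
  by unfold_locales (rule injective_envelope_star_hom[OF B.cstar_algebra_axioms envelope], simp add: \<iota>_cl)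

lemmas \<iota>_mult = \<iota>.hom_mult[simplified] and \<iota>_adj = \<iota>.hom_adj[simplified]
  and \<iota>_zero = \<iota>.hom_zero[simplified]

lemma approximate_unit_B:
  assumes a: "a \<in> carrier A" and e: "e > 0"
  obtains u where "u \<in> B" "cadj A u = u" "cnorm A (a \<otimes> u \<ominus> a) < e"
proof -
  obtain U where U: "approximate_unit A U" "U \<subseteq> B"
    using regular by (auto simp: regular_inclusion_def cstar_inclusion_def)
  then obtain u where u: "u \<in> U"
    "\<forall>v\<in>U. cle A u v \<longrightarrow> cnorm A (a \<otimes> v \<ominus> a) < e"
    using a e unfolding approximate_unit_def by meson
  have uc: "u \<in> carrier A" using u(1) U(2) B_cl by blast
  \<comment> \<open>The estimate holds for all v above u, and u lies above itself because 0 = 0^*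
    0.\<close>
  have "cle A u u"
    unfolding cle_def cpositive_def using uc by (auto intro!: bexI[of _ \<zero>])
  moreover have "cpositive A u" using U(1) u(1) by (simp add: approximate_unit_def)
  then have "cadj A u = u" by (auto simp: cpositive_def adj_prod)
  ultimately show ?thesis using that u U(2) by blast
qed

text \<open>\<open>cp_map_module\<close> with u for \<open>b\<^sub>0\<close>, u b for b and \<iota>
  b for z. Its hypotheses concern products inside B, where \<Phi> is the homomorphism \<iota>. The
  factor u makes up for a unit that A may not have.\<close>

lemma \<Phi>_module_unit:
  assumes x: "x \<in> carrier A" and b: "b \<in> B" and u: "u \<in> B" "cadj A u = u"
  shows "\<Phi> ((x \<otimes> u) \<otimes> b) = \<Phi> (x \<otimes> u) \<otimes>\<^bsub>I\<^esub> \<iota> b"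
proof -
  note B = B_mult B_adj
  have uu: "u \<otimes> u \<in> B" and ub: "u \<otimes> b \<in> B" and c: "b \<in> carrier A" "u \<in> carrier A"
    using u(1) b B B_cl by auto
  have 1: "\<Phi> (cadj A u \<otimes> (u \<otimes> b)) = \<Phi> (cadj A u \<otimes> u) \<otimes>\<^bsub>I\<^esub> \<iota> b"
    using uu b u c B(1)[OF uu b] by (simp add: m_assoc[symmetric] \<Phi>_B \<iota>_mult)
  have 2: "\<Phi> (cadj A (u \<otimes> b) \<otimes> u) = cadj I (\<iota> b) \<otimes>\<^bsub>I\<^esub> \<Phi> (cadj A u \<otimes> u)"
    using uu b u c B(1)[OF B(2)[OF b] uu]
    by (simp add: adj_prod m_assoc \<Phi>_B \<iota>_mult \<iota>_adj B(2))
  have "cadj A (u \<otimes> b) \<otimes> (u \<otimes> b) = cadj A b \<otimes> ((u \<otimes> u) \<otimes> b)"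
    using u c by (simp add: adj_prod m_assoc)
  then have 3: "\<Phi> (cadj A (u \<otimes> b) \<otimes> (u \<otimes> b))
      = cadj I (\<iota> b) \<otimes>\<^bsub>I\<^esub> (\<Phi> (cadj A u \<otimes> u) \<otimes>\<^bsub>I\<^esub> \<iota> b)"
    using uu b u B(1)[OF uu b] B(1)[OF B(2)[OF b] B(1)[OF uu b]]
    by (simp add: \<Phi>_B \<iota>_mult \<iota>_adj B(2))
  have "\<Phi> (cadj A (cadj A x) \<otimes> (u \<otimes> b)) = \<Phi> (cadj A (cadj A x) \<otimes> u) \<otimes>\<^bsub>I\<^esub> \<iota> b"
    by (rule cp_map_module(2)[OF normed_star_axioms I.unital_cstar_axioms \<Phi>_cp _ _ _ _ 1 2 3])
      (use x c b \<iota>_cl in auto)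
  then show ?thesis using x c by (simp add: m_assoc)
qed

text \<open>The factor u is removed by letting a u approach a: \<Phi> is contractive, and right
  multiplication by b or \<iota> b is bounded.\<close>

lemma \<Phi>_module:
  assumes a: "a \<in> carrier A" and b: "b \<in> B"
  shows "\<Phi> (a \<otimes> b) = \<Phi> a \<otimes>\<^bsub>I\<^esub> \<iota> b"
proof -
  have bc: "b \<in> carrier A" "\<iota> b \<in> carrier I" using b B_cl \<iota>_cl by auto
  let ?p = "\<Phi> (a \<otimes> b)" and ?q = "\<Phi> a \<otimes>\<^bsub>I\<^esub> \<iota> b" and ?C = "cnorm A b + cnorm I (\<iota> b)"
  have pq: "?p \<in> carrier I" "?q \<in> carrier I" using a bc by auto
  have C: "0 \<le> ?C" using bc by simp
  have est: "cnorm I (?p \<ominus>\<^bsub>I\<^esub> ?q) \<le> e * ?C" if e: "e > 0" for e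
  proof -
    obtain u where u: "u \<in> B" "cadj A u = u" "cnorm A (a \<otimes> u \<ominus> a) < e"
      using approximate_unit_B[OF a e] by metis
    have uc: "u \<in> carrier A" using u(1) by (rule B_cl)
    let ?r = "\<Phi> (a \<otimes> u) \<otimes>\<^bsub>I\<^esub> \<iota> b"
    have "cnorm I (?p \<ominus>\<^bsub>I\<^esub> ?r) = cnorm I (\<Phi> ((a \<ominus> a \<otimes> u) \<otimes> b))"
      using a bc uc \<Phi>_module_unit[OF a b u(1,2)] by (simp add: \<Phi>_minus r_minus)
    also have "\<dots> \<le> cnorm A (a \<ominus> a \<otimes> u) * cnorm A b"
      using \<Phi>_norm[of "(a \<ominus> a \<otimes> u) \<otimes> b"] norm_prod[of "a \<ominus> a \<otimes> u" b] a bc uc by simp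
    also have "\<dots> \<le> e * cnorm A b"
      using u(3) norm_minus_comm[of a "a \<otimes> u"] a bc uc by (intro mult_right_mono) auto
    finally have 1: "cnorm I (?p \<ominus>\<^bsub>I\<^esub> ?r) \<le> e * cnorm A b" .
    have "?r \<ominus>\<^bsub>I\<^esub> ?q = \<Phi> (a \<otimes> u \<ominus> a) \<otimes>\<^bsub>I\<^esub> \<iota> b"
      using a bc uc by (simp add: \<Phi>_minus I.r_minus)
    then have "cnorm I (?r \<ominus>\<^bsub>I\<^esub> ?q) \<le> cnorm I (\<Phi> (a \<otimes> u \<ominus> a)) * cnorm I (\<iota> b)"
      using I.norm_prod[of "\<Phi> (a \<otimes> u \<ominus> a)" "\<iota> b"] a bc uc by simp
    also have "\<dots> \<le> e * cnorm I (\<iota> b)"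
      using u(3) \<Phi>_norm[of "a \<otimes> u \<ominus> a"] a bc uc by (intro mult_right_mono) auto
    finally have 2: "cnorm I (?r \<ominus>\<^bsub>I\<^esub> ?q) \<le> e * cnorm I (\<iota> b)" .
    have "cnorm I (?p \<ominus>\<^bsub>I\<^esub> ?q) \<le> cnorm I (?p \<ominus>\<^bsub>I\<^esub> ?r) + cnorm I (?r \<ominus>\<^bsub>I\<^esub> ?q)"
      using a bc uc by (intro I.norm_minus_triangle) auto
    then show ?thesis unfolding semiring_class.distrib_left using 1 2 by linarith
  qed
  have "cnorm I (?p \<ominus>\<^bsub>I\<^esub> ?q) \<le> 0 + e" if "e > 0" for e
  proof -
    have "cnorm I (?p \<ominus>\<^bsub>I\<^esub> ?q) \<le> (e / (?C + 1)) * ?C" using est[of "e / (?C + 1)"] that C by simp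
    also have "\<dots> \<le> e" using that C by (simp add: field_simps)
    finally show ?thesis by simp
  qed
  then have "cnorm I (?p \<ominus>\<^bsub>I\<^esub> ?q) \<le> 0" by (rule field_le_epsilon)
  then have "cnorm I (?p \<ominus>\<^bsub>I\<^esub> ?q) = 0" by (rule antisym) (use pq in simp)
  then show ?thesis using I.norm_0_iff[of "?p \<ominus>\<^bsub>I\<^esub> ?q"] I.minus_0_iff pq by simp
qed

text \<open>\<open>cp_map\<close> does not mention adjoints, but the image of the 2 by 2 Gram matrix
  of x and y factors as W^* W and is therefore self-adjoint.\<close>

lemma \<Phi>_star_mult_adj:
  assumes x: "x \<in> carrier A" and y: "y \<in> carrier A"
  shows "cadj I (\<Phi> (cadj A x \<otimes> y)) = \<Phi> (cadj A y \<otimes> x)"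
proof -
  define c where "c i = (if i = 0 then x else y)" for i :: nat
  have c: "c i \<in> carrier A" for i using x y by (simp add: c_def)
  have "mat_positive A 2 (\<lambda>i j. cadj A (c i) \<otimes> c j)"
    unfolding mat_positive_def
    by (rule exI[of _ "\<lambda>k i. if k = 0 then c i else \<zero>"]) (use c in \<open>simp add: numeral_2_eq_2\<close>)
  then have "mat_positive I 2 (\<lambda>i j. \<Phi> (cadj A (c i) \<otimes> c j))"
    using \<Phi>_cp c unfolding cp_map_def by simp
  then obtain W where W: "\<forall>i<2. \<forall>j<2. W i j \<in> carrier I"
    "\<forall>i<2. \<forall>j<2. \<Phi> (cadj A (c i) \<otimes> c j) = csum I (\<lambda>k. cadj I (W k i) \<otimes>\<^bsub>I\<^esub> W k j) 2"
    unfolding mat_positive_def by blast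
  have "cadj I (csum I (\<lambda>k. cadj I (W k 0) \<otimes>\<^bsub>I\<^esub> W k 1) 2) = csum I (\<lambda>k. cadj I (W k 1) \<otimes>\<^bsub>I\<^esub> W k 0) 2"
    using W(1) by (auto simp: I.csum_adj I.adj_prod intro!: I.csum_cong)
  then show ?thesis
    using W(2)[rule_format, of 0 1] W(2)[rule_format, of 1 0] by (simp add: c_def)
qed

lemma L_ideal_eq:
  assumes K: "K \<in> invariant_regular_ideals A B"
  shows "L_ideal A I \<iota> \<Phi> K = biannihilator A K"
proof -
  define M where "M = annihilator (A restr B) K"
  have KR: "K \<in> regular_ideals (A restr B)" "invariant K" "two_sided (A restr B) K"
    using K regular_ideals_B_two_sided by (auto simp: invariant_regular_iff)
  have M: "two_sided (A restr B) M" "invariant M" "cstar_ideal (A restr B) M"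
    unfolding M_def using B.two_sided_annihilator invariant_annihilator B.cstar_ideal_annihilator KR by auto
  have KM: "annihilator (A restr B) M = K" "cstar_ideal (A restr B) K"
    using KR(1) by (auto simp: M_def regular_ideals_def)
  have KB: "k \<in> B" if "k \<in> K" for k using KR(3) that by (auto simp: two_sided_B)
  have MB: "m \<in> B" if "m \<in> M" for m using M(1) that by (auto simp: two_sided_B)
  have AM: "annihilator A M = biannihilator A K"
    unfolding M_def by (rule annihilator_annihilator_B[OF K])
  have mk: "m \<otimes> k = \<zero>" "k \<otimes> m = \<zero>" if "m \<in> M" "k \<in> K" for m k
    using that by (auto simp: M_def annihilator_iff)
  have K_adj: "cadj A k \<in> K" if "k \<in> K" for k
    using B.annihilator_adj[OF M(1), of k] that KM(1) by simp
  have \<iota>KI: "\<iota> k \<in> carrier I" if "k \<in> K \<union> M" for k using that KB MB \<iota>_cl by blast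
  \<comment> \<open>Such a b lies in M, as it annihilates K, and also in the annihilator of M; the
    two meet in 0.\<close>
  have ess: "b = \<zero>" if b: "b \<in> B" and 0: "\<And>k. k \<in> K \<union> M \<Longrightarrow> b \<otimes> k = \<zero>" for b
  proof -
    have "b \<in> annihilator (A restr B) K" "b \<in> annihilator (A restr B) M"
      using B.annihilatorI[OF KR(3), of b] B.annihilatorI[OF M(1), of b] b 0 by auto
    then have "b \<in> M" "b \<in> annihilator (A restr B) M" by (auto simp: M_def)
    then show ?thesis using B.disjoint_iff_annihilator[OF B.two_sided_annihilator[OF M(1)] M(1)] by auto
  qed
  show ?thesis
  proof (intro equalityI subsetI)
    fix a assume "a \<in> L_ideal A I \<iota> \<Phi> K"
    then have a: "a \<in> carrier A" "\<Phi> (cadj A a \<otimes> a) \<in> biannihilator I (\<iota> ` K)"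
      by (auto simp: L_ideal_def)
    have "a \<otimes> m = \<zero>" if m: "m \<in> M" for m
    proof -
      have mB: "m \<in> B" and mc: "m \<in> carrier A" using MB[OF m] B_cl by auto
      have "\<iota> m \<in> annihilator I (\<iota> ` K)"
        using mk[OF m] KB mB \<iota>_cl \<iota>_zero \<iota>_mult by (auto simp: annihilator_iff) (metis \<iota>_mult)+
      then have 0: "\<Phi> (cadj A a \<otimes> a) \<otimes>\<^bsub>I\<^esub> \<iota> m = \<zero>\<^bsub>I\<^esub>" using a(2) by (simp add: annihilator_iff)
      have am: "a \<otimes> m \<in> carrier A" using a(1) mc by simp
      have "\<Phi> (cadj A a \<otimes> (a \<otimes> m)) = \<zero>\<^bsub>I\<^esub>"
        using 0 \<Phi>_module[of "cadj A a \<otimes> a" m] a(1) mc mB by (simp add: m_assoc)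
      \<comment> \<open>\<Phi> is known to respect multiplication by B on the right, so the adjoint
        is taken before the second factor m is multiplied on.\<close>
      then have "\<Phi> (cadj A (a \<otimes> m) \<otimes> a) = \<zero>\<^bsub>I\<^esub>"
        using \<Phi>_star_mult_adj[OF a(1) am] by simp
      then have "\<Phi> (cadj A (a \<otimes> m) \<otimes> (a \<otimes> m)) = \<zero>\<^bsub>I\<^esub>"
        using \<Phi>_module[of "cadj A (a \<otimes> m) \<otimes> a" m] a(1) mc mB \<iota>_cl[OF mB] am by (simp add: m_assoc)
      then show ?thesis using faithful a(1) mc by (simp add: faithful_map_def)
    qed
    then show "a \<in> biannihilator A K"
      using one_sided_annihilator[OF M(1,2) a(1)] AM by simp
  next
    fix a assume "a \<in> biannihilator A K"
    then have aM: "a \<in> annihilator A M" using AM by simp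
    then have a: "a \<in> carrier A" by (simp add: annihilator_iff)
    define x where "x = \<Phi> (cadj A a \<otimes> a)"
    have x: "x \<in> carrier I" "cadj I x = x" using a \<Phi>_star_mult_adj by (auto simp: x_def)
    have xm: "x \<otimes>\<^bsub>I\<^esub> \<iota> m = \<zero>\<^bsub>I\<^esub>" if m: "m \<in> M" for m
    proof -
      have "x \<otimes>\<^bsub>I\<^esub> \<iota> m = \<Phi> (cadj A a \<otimes> (a \<otimes> m))"
        using a MB[OF m] B_cl by (simp add: x_def \<Phi>_module[symmetric] m_assoc)
      also have "a \<otimes> m = \<zero>" using aM m by (simp add: annihilator_iff)
      also have "\<Phi> (cadj A a \<otimes> \<zero>) = \<zero>\<^bsub>I\<^esub>" using a \<Phi>_minus[of \<zero> \<zero>] by simp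
      finally show ?thesis .
    qed
    \<comment> \<open>The self-adjoint x annihilates \<iota>(M) and y annihilates \<iota>(K). Their
      orthogonality is what the envelope provides, and it puts x into the biannihilator of
      \<iota>(K).\<close>
    have "x \<otimes>\<^bsub>I\<^esub> y = \<zero>\<^bsub>I\<^esub> \<and> y \<otimes>\<^bsub>I\<^esub> x = \<zero>\<^bsub>I\<^esub>" if y: "y \<in> annihilator I (\<iota> ` K)" for y
    proof -
      have yc: "y \<in> carrier I" and yk: "\<And>k. k \<in> K \<Longrightarrow> y \<otimes>\<^bsub>I\<^esub> \<iota> k = \<zero>\<^bsub>I\<^esub> \<and> \<iota> k \<otimes>\<^bsub>I\<^esub> y = \<zero>\<^bsub>I\<^esub>"
        using y by (auto simp: annihilator_iff)
      have yk': "cadj I y \<otimes>\<^bsub>I\<^esub> \<iota> k = \<zero>\<^bsub>I\<^esub>" if k: "k \<in> K" for k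
      proof -
        have "cadj I (\<iota> (cadj A k) \<otimes>\<^bsub>I\<^esub> y) = cadj I y \<otimes>\<^bsub>I\<^esub> \<iota> k"
          using yc KB[OF k] \<iota>_cl[OF KB[OF k]] by (simp add: \<iota>_adj I.adj_prod)
        then show ?thesis using yk[OF K_adj[OF k]] by simp
      qed
      show ?thesis
      proof (rule injective_envelope_orthogonal[OF B.cstar_algebra_axioms envelope, of K M])
        show "csubspace (A restr B) K" "csubspace (A restr B) M"
          using KM(2) M(3) by (auto simp: cstar_ideal_def)
      qed (use KR(3) M(1) ess x xm yc yk yk' \<iota>_cl in \<open>auto simp: two_sided_B\<close>)
    qed
    then show "a \<in> L_ideal A I \<iota> \<Phi> K"
      using a x by (simp add: L_ideal_def annihilator_iff[of _ _ "annihilator I (\<iota> ` K)"] x_def[symmetric])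
  qed
qed

text \<open>The set is squeezed: K \<subseteq> \<open>J_ideal A \<iota> \<Phi> K\<close> \<subseteq>
  \<open>L_ideal A I \<iota> \<Phi> K\<close>, the last one is \<open>biannihilator A K\<close>, and
  taking biannihilators is monotone and idempotent.\<close>

lemma biannihilator_J_ideal:
  assumes K: "K \<in> invariant_regular_ideals A B"
  shows "biannihilator A (J_ideal A \<iota> \<Phi> K) = biannihilator A K"
proof
  have KR: "two_sided (A restr B) K"
    using K regular_ideals_B_two_sided by (auto simp: invariant_regular_iff)
  have "K \<subseteq> J_ideal A \<iota> \<Phi> K"
  proof
    fix k assume k: "k \<in> K"
    then show "k \<in> J_ideal A \<iota> \<Phi> K"
      using star_mult_in[OF KR k] star_mult_in(1)[OF KR, of "cadj A k \<otimes> k"] B_cl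
      by (auto simp: J_ideal_def \<Phi>_B)
  qed
  then show "biannihilator A K \<subseteq> biannihilator A (J_ideal A \<iota> \<Phi> K)"
    by (intro annihilator_anti)
  have "\<iota> ` K \<subseteq> carrier I" using KR \<iota>_cl by (auto simp: two_sided_B)
  then have "J_ideal A \<iota> \<Phi> K \<subseteq> L_ideal A I \<iota> \<Phi> K"
    using I.subset_biannihilator by (auto simp: J_ideal_def L_ideal_def)
  then have "biannihilator A (J_ideal A \<iota> \<Phi> K) \<subseteq> biannihilator A (biannihilator A K)"
    unfolding L_ideal_eq[OF K] by (intro annihilator_anti)
  also have "\<dots> = biannihilator A K"
    using annihilator_tri[of "annihilator A K"] by (auto simp: annihilator_iff)
  finally show "biannihilator A (J_ideal A \<iota> \<Phi> K) \<subseteq> biannihilator A K" .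
qed

end

theorem theorem3p11:
  fixes A :: "'a cstar" and B N :: "'a set"
    and I :: "'c cstar" and \<iota> \<Phi> :: "'a \<Rightarrow> 'c"
  assumes "regular_inclusion A B"
    and "ideal_intersection_property A B"
    and "injective_envelope (A restr B) I \<iota>"
    and "generating_star_semigroup A B N"
    and "pseudo_expectation A B I \<iota> \<Phi>"
    and "faithful_map A I \<Phi>"
    and "invariant_map A B I \<iota> N \<Phi>"
  shows "boolean_lattice (inclusion_order (invariant_regular_ideals A B)) \<and>
    boolean_iso (inclusion_order (regular_ideals A))
      (inclusion_order (invariant_regular_ideals A B)) (\<lambda>J. J \<inter> B) \<and>
    (\<forall>K\<in>invariant_regular_ideals A B.
      L_ideal A I \<iota> \<Phi> K = biannihilator A (J_ideal A \<iota> \<Phi> K) \<and>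
      biannihilator A (J_ideal A \<iota> \<Phi> K) = biannihilator A K \<and>
      L_ideal A I \<iota> \<Phi> K \<in> regular_ideals A \<and> L_ideal A I \<iota> \<Phi> K \<inter> B = K) \<and>
    (\<forall>J\<in>regular_ideals A. L_ideal A I \<iota> \<Phi> (J \<inter> B) = J)"
proof -
  interpret faithful_pseudo_expectation A B I \<iota> \<Phi>
    by unfold_locales (fact assms)+
  show ?thesis
    using boolean_iso_Int_B
    by (auto simp: boolean_iso_def L_ideal_eq biannihilator_J_ideal biannihilator_invariant_regular
        Int_B_invariant_regular biannihilator_Int_B)
qed

end
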